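(* Let $m,n$ be integers with $m+n\geq 8$, $\min\{m,n\}\geq 2$ and $\max\{m,n\}\geq 3$. Let $a,b\in\mathbb{C}$ with $b\neq 0$ and $a\neq b$, and let $$Q(z)=\sum_{i=0}^{m}\sum_{j=0}^{n}\binom{m}{i}\binom{n}{j}\frac{(-1)^{i+j}}{n+m+1-i-j}\,z^{n+m+1-i-j}a^{j}b^{i},\qquad P(z)=Q(z)+c,$$ where $c\in\mathbb{C}$ satisfies $c\notin\left\{0,-Q(a),-Q(b),-\frac{Q(a)+Q(b)}{2}\right\}$. Let $S_2=\{z\in\mathbb{C}: P(z)=0\}$. If two nonconstant meromorphic functions $f$ and $g$ on $\mathbb{C}$ share $\{\infty\}$ CM and share $S_2$ CM, then $f\equiv g$.
   Context: Meromorphic means meromorphic in the whole complex plane $\mathbb{C}$. For a non-empty set $S\subset\mathbb{C}\cup\{\infty\}$ and a meromorphic function $f$, put $E_f(S)=\bigcup_{\alpha\in S}\{z: f(z)-\alpha=0\}$, where a zero of $f-\alpha$ of multiplicity $k$ is counted $k$ times (so $E_f(S)$ is a set of points with multiplicities); for $\alpha=\infty$ the zeros of $f-\alpha$ are understood to be the poles of $f$, counted with multiplicity. Two meromorphic functions $f,g$ share the set $S$ CM (counting multiplicities) if $E_f(S)=E_g(S)$. In the formula for $Q$, the convention $0^0=1$ is used if $a=0$. *)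

theory Defs
  imports "HOL-Complex_Analysis.Complex_Analysis"
begin

text \<open>
  A meromorphic function on the plane is represented by some
  \<open>f :: complex \<Rightarrow> complex\<close> with \<open>f nicely_meromorphic_on UNIV\<close>: removable singularities
  are filled in and \<open>f\<close> takes the dummy value \<open>0\<close> at its poles. Hence each meromorphic
  function has exactly one representative, and identity of meromorphic functions is equality
  of functions.
\<close>

datatype ext_complex = Fin complex | Infty

text \<open>
  The \<open>\<alpha>\<close>-points of \<open>f\<close>, each paired with its multiplicity. Poles have to be excluded in the
  finite case because of the dummy value. If \<open>f\<close> is constantly \<open>\<alpha>\<close>, the order is
  unspecified; the notion is meant for nonconstant \<open>f\<close> only.
\<close>
fun value_points :: "(complex \<Rightarrow> complex) \<Rightarrow> ext_complex \<Rightarrow> (complex \<times> nat) set" where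
  "value_points f (Fin \<alpha>) =
     {(z, k). \<not> is_pole f z \<and> f z - \<alpha> = 0 \<and> int k = zorder (\<lambda>w. f w - \<alpha>) z}"
| "value_points f Infty = {(z, k). is_pole f z \<and> int k = - zorder f z}"

text \<open>
  Since \<open>f\<close> has only one value at each point, a point occurs in the following union with at
  most one multiplicity, so the set of pairs is a set of points with multiplicities.
\<close>
definition E_pts :: "(complex \<Rightarrow> complex) \<Rightarrow> ext_complex set \<Rightarrow> (complex \<times> nat) set" where
  "E_pts f S = (\<Union>\<alpha>\<in>S. value_points f \<alpha>)"

definition share_CM ::
  "(complex \<Rightarrow> complex) \<Rightarrow> (complex \<Rightarrow> complex) \<Rightarrow> ext_complex set \<Rightarrow> bool" where
  "share_CM f g S \<longleftrightarrow> E_pts f S = E_pts g S"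

text \<open>
  The subtractions on natural numbers do not truncate, as \<open>i \<le> m\<close> and \<open>j \<le> n\<close>; moreover
  \<open>0 ^ 0 = 1\<close> holds in the library, as required when \<open>a = 0\<close>.
\<close>
definition Q_fun :: "nat \<Rightarrow> nat \<Rightarrow> complex \<Rightarrow> complex \<Rightarrow> complex \<Rightarrow> complex" where
  "Q_fun m n a b z =
     (\<Sum>i=0..m. \<Sum>j=0..n.
        of_nat (m choose i) * of_nat (n choose j) *
        ((-1) ^ (i + j) / of_nat (n + m + 1 - i - j)) *
        z ^ (n + m + 1 - i - j) * a ^ j * b ^ i)"

definition P_fun :: "nat \<Rightarrow> nat \<Rightarrow> complex \<Rightarrow> complex \<Rightarrow> complex \<Rightarrow> complex \<Rightarrow> complex" where
  "P_fun m n a b c z = Q_fun m n a b z + c"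

definition S2 :: "nat \<Rightarrow> nat \<Rightarrow> complex \<Rightarrow> complex \<Rightarrow> complex \<Rightarrow> complex set" where
  "S2 m n a b c = {z. P_fun m n a b c z = 0}"

end

theory Submission
  imports Defs "HOL-Computational_Algebra.Fundamental_Theorem_Algebra"
begin

text \<open>
  Since \<open>f\<close> and \<open>g\<close> have the same poles with the same multiplicities, they can be written as
  \<open>f = F / D\<close> and \<open>g = G / D\<close> with one entire denominator, where \<open>F, D\<close> have no common zero and
  neither have \<open>G, D\<close>. The polynomial \<open>P\<close> has derivative \<open>(z - a)^n (z - b)^m\<close> and degree
  \<open>q = m + n + 1\<close>; its \<open>q\<close> zeros are simple, as \<open>P a\<close> and \<open>P b\<close> are nonzero. The functions
  \<open>D^q P(f)\<close> and \<open>D^q P(g)\<close> are entire (locale constant \<open>hom\<close>), and sharing the zero set of \<open>P\<close>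
  means that they have the same zeros. Hence \<open>P(f) = \<phi> P(g)\<close> with an entire \<open>\<phi>\<close> that has no zeros
  (locale \<open>shared_pair\<close>).

  First, \<open>\<phi>\<close> is constant. Let \<open>H\<close> be the difference of the logarithmic derivatives of
  \<open>(1 / P(f))'\<close> and \<open>(1 / P(g))'\<close>. It vanishes at the common zeros of \<open>P(f)\<close> and \<open>P(g)\<close>,
  because those are simple zeros of \<open>P\<close> (\<open>K_divisible\<close>), it has at most simple poles, located at
  the \<open>a\<close>- and \<open>b\<close>-points and the ramification points of \<open>f\<close> and \<open>g\<close>, and by the lemma on the
  logarithmic derivative its proximity function is negligible (\<open>logderiv_K\<close>). If \<open>H\<close> were not identically
  zero, then this would bound the number of zeros of \<open>P(g)\<close> (\<open>K_estimate\<close>), whereas the second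
  main theorem for the targets \<open>a\<close>, \<open>b\<close>, \<open>\<infinity>\<close> and the zeros of \<open>P\<close> bounds it from below. In the sum
  of the two inequalities the ramification terms cancel, and what remains is
  \<open>(q - 8) (T(f) + T(g)) \<le> O(log)\<close>, which is absurd for \<open>q \<ge> 9\<close> (\<open>K_vanishes\<close>). So \<open>H = 0\<close>, that
  is \<open>1 / P(f) = c / P(g) + e\<close> with constants \<open>c, e\<close>; if \<open>e\<close> were nonzero, \<open>f\<close> and \<open>g\<close> would be entire and \<open>P(g)\<close> would
  omit a value that \<open>P\<close> takes at two points, against the little Picard theorem (\<open>phi_constant\<close>).

  It remains to exclude \<open>P(f) = A P(g)\<close> with \<open>A \<noteq> 1\<close>, and \<open>P(f) = P(g)\<close> with \<open>f \<noteq> g\<close>. In geometric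
  terms, the curve \<open>P(x) = A P(y)\<close> carries two regular differentials, and pulling them back along
  \<open>(f, g)\<close> gives entire functions whose size is bounded by the spherical derivatives of \<open>f\<close> and \<open>g\<close>.
  The logarithmic derivative lemma makes these functions small. For \<open>A \<noteq> 1\<close> their quotient is \<open>g\<close>
  (\<open>no_solution_scaled\<close>); for \<open>A = 1\<close> it is \<open>(f - a) / (g - a)\<close>, over which \<open>g\<close> is algebraic
  (\<open>no_solution_equal_values\<close>). In both cases \<open>g\<close> grows too slowly to be nonconstant.

  Growth is measured throughout by means of logarithms over circles. Jensen's inequality turns such a mean of an
  entire function into a count of its zeros, so counting functions do not occur. Exceptional
  sets of radii are avoided as well: all estimates are made at radii at which the total
  characteristic \<open>V\<close> does not double too fast, and such radii exist with \<open>V\<close> arbitrarily large, so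
  that an estimate \<open>V \<le> C (1 + ln V)\<close> at all of them is contradictory (\<open>growth_contradiction\<close>).
\<close>

section \<open>Means over circles\<close>

definition cmean :: "real \<Rightarrow> (complex \<Rightarrow> 'a::banach) \<Rightarrow> 'a" where
  "cmean r u = integral {0..1} (\<lambda>t. u (circlepath 0 r t))"

lemma circlepath_0: "circlepath 0 r t = of_real r * cis (2 * pi * t)"
  by (simp add: circlepath cis_conv_exp mult_ac)

lemma norm_circlepath [simp]: "0 \<le> r \<Longrightarrow> norm (circlepath 0 r t) = r"
  by (simp add: circlepath_0 norm_mult)

lemma cmean_integrable:
  fixes u :: "complex \<Rightarrow> 'a::banach"
  assumes "continuous_on (sphere 0 r) u" "0 \<le> r"
  shows "(\<lambda>t. u (circlepath 0 r t)) integrable_on {0..1}"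
proof (rule integrable_continuous_real)
  have "continuous_on {0..1} (u \<circ> circlepath 0 r)"
    using assms by (intro continuous_on_compose continuous_on_subset[OF assms(1)])
      (auto simp: circlepath_0 norm_mult intro!: continuous_intros)
  thus "continuous_on {0..1} (\<lambda>t. u (circlepath 0 r t))" by (simp add: o_def)
qed

lemma cmean_add:
  assumes "continuous_on (sphere 0 r) u" "continuous_on (sphere 0 r) v" "0 \<le> r"
  shows "cmean r (\<lambda>z. u z + v z) = cmean r u + cmean r v"
  unfolding cmean_def using assms by (intro integral_add cmean_integrable)

lemma cmean_diff:
  assumes "continuous_on (sphere 0 r) u" "continuous_on (sphere 0 r) v" "0 \<le> r"
  shows "cmean r (\<lambda>z. u z - v z) = cmean r u - cmean r v"
  unfolding cmean_def using assms by (intro integral_diff cmean_integrable)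

lemma cmean_const [simp]: "cmean r (\<lambda>z. c) = c"
  by (simp add: cmean_def)

lemma cmean_cmult: "cmean r (\<lambda>z. c * u z) = (c::real) * cmean r u"
  unfolding cmean_def by simp

lemma cmean_sum:
  assumes "\<And>i. i \<in> I \<Longrightarrow> continuous_on (sphere 0 r) (u i)" "0 \<le> r" "finite I"
  shows "cmean r (\<lambda>z. \<Sum>i\<in>I. u i z) = (\<Sum>i\<in>I. cmean r (u i))"
  unfolding cmean_def using assms by (intro integral_sum cmean_integrable) auto

lemma cmean_mono:
  fixes u v :: "complex \<Rightarrow> real"
  assumes "continuous_on (sphere 0 r) u" "continuous_on (sphere 0 r) v" "0 \<le> r"
    and "\<And>z. norm z = r \<Longrightarrow> u z \<le> v z"
  shows "cmean r u \<le> cmean r v"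
  unfolding cmean_def using assms by (intro integral_le cmean_integrable) auto

lemma cmean_cong:
  assumes "0 \<le> r" "\<And>z. norm z = r \<Longrightarrow> u z = v z"
  shows "cmean r u = cmean r v"
  unfolding cmean_def using assms by (intro integral_cong) auto

lemma cmean_Re:
  assumes "continuous_on (sphere 0 r) u" "0 \<le> r"
  shows "cmean r (\<lambda>z. Re (u z)) = Re (cmean r u)"
  using integral_linear[OF cmean_integrable[OF assms] bounded_linear_Re]
  by (simp add: cmean_def o_def)

lemma cmean_cnj:
  assumes "continuous_on (sphere 0 r) u" "0 \<le> r"
  shows "cmean r (\<lambda>z. cnj (u z)) = cnj (cmean r u)"
  using integral_linear[OF cmean_integrable[OF assms] bounded_linear_cnj]
  by (simp add: cmean_def o_def)

lemma norm_cmean_le: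
  fixes u :: "complex \<Rightarrow> complex"
  assumes "continuous_on (sphere 0 r) u" "continuous_on (sphere 0 r) v" "0 \<le> r"
    and "\<And>z. norm z = r \<Longrightarrow> norm (u z) \<le> v z"
  shows "norm (cmean r u) \<le> cmean r v"
  unfolding cmean_def using assms by (intro integral_norm_bound_integral cmean_integrable) auto

lemma contour_integral_circlepath_cmean:
  "contour_integral (circlepath 0 r) f = 2 * of_real pi * \<i> * cmean r (\<lambda>z. f z * z)"
proof -
  have "contour_integral (circlepath 0 r) f
      = integral {0..1} (\<lambda>t. (2 * of_real pi * \<i>) * (f (circlepath 0 r t) * circlepath 0 r t))"
    unfolding contour_integral_integral vector_derivative_circlepath
    by (intro integral_cong) (simp add: circlepath mult_ac)
  thus ?thesis by (simp add: cmean_def)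
qed

lemma cmean_holomorphic:
  assumes "k holomorphic_on ball 0 R" "0 < r" "r < R"
  shows "cmean r k = k 0"
proof -
  have "k holomorphic_on cball 0 r" by (rule holomorphic_on_subset[OF assms(1)]) (use assms in auto)
  hence "((\<lambda>u. k u / (u - 0)) has_contour_integral (2 * of_real pi * \<i> * k 0)) (circlepath 0 r)"
    by (rule Cauchy_integral_circlepath_simple) (use assms in auto)
  hence "2 * of_real pi * \<i> * k 0 = 2 * of_real pi * \<i> * cmean r (\<lambda>z. k z / z * z)"
    using contour_integral_circlepath_cmean contour_integral_unique by fastforce
  hence "k 0 = cmean r (\<lambda>z. k z / z * z)" by simp
  also have "\<dots> = cmean r k" by (rule cmean_cong) (use assms in auto)
  finally show ?thesis by simp
qed

text \<open>
  The derivative is expressed through the real part of \<open>k\<close> alone, as in the Schwarz formula: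
  Cauchy's formula for \<open>deriv k z\<close> involves \<open>k\<close>, and adding to it the same integral with \<open>cnj (k w)\<close>
  changes nothing, because the latter is the conjugate of an integral of a holomorphic function.
\<close>
lemma deriv_eq_cmean_Re:
  assumes "k holomorphic_on ball 0 R'" "0 < R" "R < R'" "norm z < R"
  shows "deriv k z = cmean R (\<lambda>w. of_real (2 * Re (k w)) * (w / (w - z)^2))"
proof -
  have hol: "k holomorphic_on cball 0 R" by (rule holomorphic_on_subset[OF assms(1)]) (use assms in auto)
  have cont: "continuous_on (sphere 0 R) k"
    by (rule continuous_on_subset[OF holomorphic_on_imp_continuous_on[OF assms(1)]]) (use assms in auto)
  have ne: "w \<noteq> z" if "norm w = R" for w using that assms by auto
  have "contour_integral (circlepath 0 R) (\<lambda>u. k u/(u-z)^2) = (2 * pi * \<i>) * deriv k z"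
    by (rule Cauchy_contour_integral_circlepath_2)
       (use hol assms in \<open>auto intro: holomorphic_on_imp_continuous_on holomorphic_on_subset\<close>)
  hence 1: "deriv k z = cmean R (\<lambda>w. k w * (w / (w-z)^2))"
    by (simp add: contour_integral_circlepath_cmean)
  have ne2: "of_real (R^2) - cnj z * w \<noteq> 0" if "norm w \<le> R" for w
  proof
    assume "of_real (R^2) - cnj z * w = 0"
    hence "norm (cnj z * w) = R^2" by (metis eq_iff_diff_eq_0 norm_of_real abs_of_nonneg zero_le_power2)
    moreover have "norm (cnj z * w) \<le> norm z * R" using that by (simp add: norm_mult mult_left_mono)
    moreover have "norm z * R < R * R" using assms by simp
    ultimately show False by (simp add: power2_eq_square)
  qed
  \<comment> \<open>On the circle, \<open>cnj w = R^2 / w\<close>, and \<open>cnj (?h w * w)\<close> is \<open>cnj (k w)\<close> times the kernel of Cauchy's formula.\<close>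
  let ?h = "\<lambda>w. k w * (of_real (R^2) / (of_real (R^2) - cnj z * w)^2)"
  have "(?h has_contour_integral 0) (circlepath 0 R)"
  proof (rule Cauchy_theorem_disc[where a = 0 and e = R and K = "{}"])
    show "continuous_on (cball 0 R) ?h"
      using holomorphic_on_imp_continuous_on[OF hol] ne2 by (auto intro!: continuous_intros)
    fix x :: complex assume x: "x \<in> ball 0 R - {}"
    have "?h holomorphic_on ball 0 R"
      using hol ne2 by (auto intro!: holomorphic_intros elim: holomorphic_on_subset)
    thus "?h field_differentiable at x" using x
      by (simp add: holomorphic_on_imp_differentiable_at)
  qed (use assms in \<open>auto simp: path_image_circlepath_nonneg\<close>)
  hence "contour_integral (circlepath 0 R) ?h = 0" by (rule contour_integral_unique)
  hence "cmean R (\<lambda>w. ?h w * w) = 0" by (simp add: contour_integral_circlepath_cmean)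
  hence "cnj (cmean R (\<lambda>w. ?h w * w)) = 0" by simp
  also have "cnj (cmean R (\<lambda>w. ?h w * w)) = cmean R (\<lambda>w. cnj (?h w * w))"
    by (rule cmean_cnj[symmetric]) (use cont ne2 assms in \<open>auto intro!: continuous_intros\<close>)
  also have "\<dots> = cmean R (\<lambda>w. cnj (k w) * (w / (w - z)^2))"
  proof (rule cmean_cong)
    fix w :: complex assume w: "norm w = R"
    have w0: "w \<noteq> 0" using w assms by auto
    have cw: "cnj w = of_real (R^2) / w"
      using w w0 by (simp add: field_simps complex_norm_square[symmetric])
    have "of_real (R^2) - z * cnj w = of_real (R^2) * (w - z) / w"
      using w0 by (simp add: cw field_simps)
    moreover have "of_real (R^2) \<noteq> (0::complex)" using assms by simp
    ultimately show "cnj (?h w * w) = cnj (k w) * (w / (w - z)^2)"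
      using ne[OF w] w0 by (simp add: cw power2_eq_square)
  qed (use assms in auto)
  finally have 2: "cmean R (\<lambda>w. cnj (k w) * (w / (w - z)^2)) = 0" by simp
  have "cmean R (\<lambda>w. k w * (w / (w - z)^2) + cnj (k w) * (w / (w - z)^2))
      = deriv k z + 0"
    by (subst cmean_add) (use 1 2 cont ne assms in \<open>auto intro!: continuous_intros\<close>)
  also have "(\<lambda>w. k w * (w / (w - z)^2) + cnj (k w) * (w / (w - z)^2))
      = (\<lambda>w. of_real (2 * Re (k w)) * (w / (w - z)^2))"
    by (auto simp: complex_add_cnj ring_distribs(2)[symmetric] simp del: times_divide_eq_right)
  finally show ?thesis by simp
qed

text \<open>
  If \<open>k\<close> is a logarithm of \<open>A / B\<close>, then \<open>Re k\<close> is the logarithm of an absolute value, so this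
  controls a logarithmic derivative by logarithmic means. It is the analytic core of the
  lemma on the logarithmic derivative.
\<close>
lemma norm_deriv_le_cmean_Re:
  assumes "k holomorphic_on ball 0 R'" "0 < R" "R < R'" "norm z < R"
  shows "norm (deriv k z) \<le> 2 * R / (R - norm z)^2 * cmean R (\<lambda>w. \<bar>Re (k w)\<bar>)"
proof -
  have cont: "continuous_on (sphere 0 R) k"
    by (rule continuous_on_subset[OF holomorphic_on_imp_continuous_on[OF assms(1)]]) (use assms in auto)
  have ne: "w \<noteq> z" if "norm w = R" for w using that assms by auto
  have "norm (deriv k z) \<le> cmean R (\<lambda>w. 2 * R / (R - norm z)^2 * \<bar>Re (k w)\<bar>)"
    unfolding deriv_eq_cmean_Re[OF assms]
  proof (rule norm_cmean_le)
    fix w :: complex assume w: "norm w = R"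
    have "R - norm z \<le> norm (w - z)" using norm_triangle_ineq2[of w z] w by simp
    hence "(R - norm z)^2 \<le> norm (w - z)^2" using assms by (intro power_mono) auto
    hence "R / norm (w - z)^2 \<le> R / (R - norm z)^2"
      using assms by (intro divide_left_mono) (auto intro!: mult_pos_pos simp: ne[OF w])
    hence "2 * \<bar>Re (k w)\<bar> * (R / norm (w - z)^2) \<le> 2 * \<bar>Re (k w)\<bar> * (R / (R - norm z)^2)"
      by (intro mult_left_mono) auto
    thus "norm (complex_of_real (2 * Re (k w)) * (w / (w - z)\<^sup>2)) \<le> 2 * R / (R - norm z)\<^sup>2 * \<bar>Re (k w)\<bar>"
      using w by (simp add: norm_mult norm_divide norm_power mult_ac)
  qed (use cont ne assms in \<open>auto intro!: continuous_intros\<close>)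
  thus ?thesis by (simp only: cmean_cmult)
qed

text \<open>
  A zero-free function on a disc has a holomorphic logarithm, to whose real part the mean value
  property applies.
\<close>
lemma cmean_ln_norm_nonzero:
  assumes "k holomorphic_on ball 0 R" "0 < r" "r < R" "\<And>z. norm z < R \<Longrightarrow> k z \<noteq> 0"
  shows "cmean r (\<lambda>z. ln (norm (k z))) = ln (norm (k 0))"
proof -
  obtain g where g: "g holomorphic_on ball 0 R" "\<And>x. x \<in> ball 0 R \<Longrightarrow> exp (g x) = k x"
    using holomorphic_logarithm_exists[of "ball 0 R" k 0] assms by auto
  have ln: "ln (norm (k z)) = Re (g z)" if "norm z < R" for z
    using g(2)[of z, symmetric] that by (simp add: norm_exp_eq_Re)
  have "continuous_on (sphere 0 r) g"
    by (rule continuous_on_subset[OF holomorphic_on_imp_continuous_on[OF g(1)]]) (use assms in auto)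
  have "cmean r (\<lambda>z. ln (norm (k z))) = cmean r (\<lambda>z. Re (g z))"
    by (rule cmean_cong) (use assms ln in auto)
  also have "\<dots> = Re (cmean r g)" by (rule cmean_Re) (fact | use assms in simp)+
  also have "\<dots> = ln (norm (k 0))"
    by (subst cmean_holomorphic[OF g(1)]) (use assms ln in auto)
  finally show ?thesis .
qed

text \<open>
  On the circle of radius \<open>r\<close>, \<open>\<bar>z - a\<bar>\<close> agrees with the absolute value of
  \<open>r - cnj a * z / r\<close> (reflection in the circle), and that function has no zero in a disc slightly larger than
  \<open>r\<close>.
\<close>
lemma cmean_ln_norm_linear:
  assumes "norm a < r"
  shows "cmean r (\<lambda>z. ln (norm (z - a))) = ln r"
proof -
  have r: "0 < r" using assms norm_ge_zero le_less_trans by blast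
  \<comment> \<open>\<open>R\<close> is the absolute value of the reflection of \<open>a\<close> in the circle; for \<open>a = 0\<close> any radius beyond \<open>r\<close> will do.\<close>
  define R where "R = (if a = 0 then r + 1 else r^2 / norm a)"
  have R: "r < R"
    using assms r by (auto simp: R_def field_simps power2_eq_square)
  have ne: "of_real r - cnj a * z / of_real r \<noteq> 0" if "norm z < R" for z
  proof
    assume "of_real r - cnj a * z / of_real r = 0"
    hence "cnj a * z = of_real (r^2)" using r by (simp add: field_simps power2_eq_square)
    hence "norm a * norm z = r^2" by (metis complex_mod_cnj norm_mult norm_of_real abs_of_nonneg zero_le_power2)
    thus False using that r by (auto simp: R_def field_simps split: if_splits)
  qed
  have "cmean r (\<lambda>z. ln (norm (z - a))) = cmean r (\<lambda>z. ln (norm (of_real r - cnj a * z / of_real r)))"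
  proof (rule cmean_cong)
    fix z :: complex assume z: "norm z = r"
    have z0: "z \<noteq> 0" using z r by auto
    have cz: "cnj z = of_real (r^2) / z"
      using z z0 by (simp add: field_simps complex_norm_square[symmetric])
    have "norm (of_real r - cnj a * z / of_real r) = norm (cnj (of_real r - cnj a * z / of_real r))"
      by (simp only: complex_mod_cnj)
    also have "cnj (of_real r - cnj a * z / of_real r) = of_real r / z * (z - a)"
      using r z0 by (simp add: cz field_simps power2_eq_square)
    also have "norm \<dots> = norm (z - a)" using z r by (simp add: norm_mult norm_divide)
    finally show "ln (norm (z - a)) = ln (norm (of_real r - cnj a * z / of_real r))" by simp
  qed (use r in auto)
  also have "\<dots> = ln (norm (of_real r - cnj a * 0 / of_real r))"
    by (rule cmean_ln_norm_nonzero[where R = R]) (use r R ne in \<open>auto intro!: holomorphic_intros\<close>)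
  finally show ?thesis using r by simp
qed

section \<open>The positive part of the logarithm\<close>

definition lnp :: "real \<Rightarrow> real" where "lnp x = ln (max 1 x)"

lemma lnp_nonneg [simp]: "0 \<le> lnp x" by (simp add: lnp_def)

lemma ln_le_lnp: "0 < x \<Longrightarrow> ln x \<le> lnp x" by (simp add: lnp_def)

lemma lnp_mono: "x \<le> y \<Longrightarrow> lnp x \<le> lnp y" by (simp add: lnp_def)

lemma lnp_eq_ln: "1 \<le> x \<Longrightarrow> lnp x = ln x" by (simp add: lnp_def)

lemma lnp_mult: "0 \<le> x \<Longrightarrow> 0 \<le> y \<Longrightarrow> lnp (x * y) \<le> lnp x + lnp y"
proof -
  assume a: "0 \<le> x" "0 \<le> y"
  have "max 1 (x * y) \<le> max 1 x * max 1 y"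
    using a mult_mono[of x "max 1 x" y "max 1 y"] mult_mono[of 1 "max 1 x" 1 "max 1 y"] by (simp add: max_def)
  hence "lnp (x * y) \<le> ln (max 1 x * max 1 y)" unfolding lnp_def by simp
  also have "\<dots> = lnp x + lnp y" unfolding lnp_def by (rule ln_mult_pos) (auto simp: max_def)
  finally show ?thesis .
qed

lemma lnp_add: "0 \<le> x \<Longrightarrow> 0 \<le> y \<Longrightarrow> lnp (x + y) \<le> lnp x + lnp y + ln 2"
proof -
  assume a: "0 \<le> x" "0 \<le> y"
  have "x + y \<le> 2 * max x y" "max x y \<le> max 1 x * max 1 y"
    using a mult_mono[of x "max 1 x" 1 "max 1 y"] mult_mono[of 1 "max 1 x" y "max 1 y"] by (auto simp: max_def)
  moreover have "1 \<le> max 1 x * max 1 y" using mult_mono[of 1 "max 1 x" 1 "max 1 y"] by simp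
  ultimately have "max 1 (x + y) \<le> 2 * (max 1 x * max 1 y)" by linarith
  hence "lnp (x + y) \<le> ln (2 * (max 1 x * max 1 y))" unfolding lnp_def by simp
  also have "\<dots> = lnp x + lnp y + ln 2" unfolding lnp_def using ln_mult_pos[of "max 1 x" "max 1 y"] ln_mult_pos[of 2 "max 1 x * max 1 y"] by simp
  finally show ?thesis .
qed

lemma lnp_sum:
  assumes "finite I" "\<And>i. i \<in> I \<Longrightarrow> 0 \<le> x i"
  shows "lnp (\<Sum>i\<in>I. x i) \<le> (\<Sum>i\<in>I. lnp (x i)) + card I * ln 2"
  using assms
proof (induction I rule: finite_induct)
  case empty thus ?case by (simp add: lnp_def)
next
  case (insert i I)
  have "lnp (x i + (\<Sum>i\<in>I. x i)) \<le> lnp (x i) + lnp (\<Sum>i\<in>I. x i) + ln 2"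
    using insert by (intro lnp_add sum_nonneg) auto
  thus ?case using insert by (simp add: algebra_simps)
qed

lemma continuous_on_lnp [continuous_intros]:
  "continuous_on S u \<Longrightarrow> continuous_on S (\<lambda>z. lnp (u z))"
  unfolding lnp_def by (intro continuous_intros) auto

text \<open>
  Each summand has real part at least \<open>1 / 2\<close> on the disc of radius \<open>r\<close>. Hence so does the sum, which
  is therefore free of zeros, and the mean of its logarithm is determined by its value \<open>card I\<close> at \<open>0\<close>.
\<close>
lemma cmean_lnp_sum_inverse:
  assumes r: "0 < r" and fin: "finite I" and c: "\<And>i. i \<in> I \<Longrightarrow> norm (c i) * r < 1"
  shows "cmean r (\<lambda>z. lnp (norm (\<Sum>i\<in>I. 1 / (1 - c i * z)))) \<le> ln (real (card I) + 1) + ln 2"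
proof (cases "I = {}")
  case True
  have "lnp 0 = 0" by (simp add: lnp_def)
  with True show ?thesis by simp
next
  case False
  define M where "M = Max (insert 0 ((\<lambda>i. norm (c i)) ` I))"
  have M: "0 \<le> M" "\<And>i. i \<in> I \<Longrightarrow> norm (c i) \<le> M" using fin by (auto simp: M_def)
  have Mr: "M * r < 1"
  proof -
    have "M \<in> insert 0 ((\<lambda>i. norm (c i)) ` I)" unfolding M_def by (rule Max_in) (use fin in auto)
    thus ?thesis using c by auto
  qed
  define R where "R = (if M = 0 then r + 1 else 1 / M)"
  have R: "r < R" using Mr M by (auto simp: R_def field_simps)
  have small: "norm (c i * z) < 1" if "i \<in> I" "norm z < R" for i z
  proof -
    have "norm (c i * z) \<le> M * norm z" using M that by (simp add: norm_mult mult_right_mono)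
    also have "\<dots> < 1" using that M by (auto simp: R_def field_simps split: if_splits)
    finally show ?thesis .
  qed
  let ?S = "\<lambda>z. \<Sum>i\<in>I. 1 / (1 - c i * z)"
  have half: "Re (1 / (1 - w)) \<ge> 1/2" if "norm w < 1" for w :: complex
  proof -
    have ne: "1 - w \<noteq> 0" using that by auto
    have "norm (1 - w)^2 \<le> 2 * Re (1 - w)"
    proof -
      have "(norm w)^2 \<le> 1" using that by (simp add: power_le_one)
      thus ?thesis unfolding cmod_power2 by (simp add: power2_eq_square algebra_simps)
    qed
    moreover have "Re (1 / (1 - w)) = Re (1 - w) / norm (1 - w)^2"
      by (simp add: Re_divide cmod_power2)
    moreover have "norm (1-w)^2 > 0" using ne by simp
    ultimately show ?thesis by (simp only: pos_le_divide_eq)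
  qed
  have ReS: "1/2 \<le> Re (?S z)" if "norm z < R" for z
  proof -
    have "(\<Sum>i\<in>I. 1/2) \<le> (\<Sum>i\<in>I. Re (1 / (1 - c i * z)))"
      by (intro sum_mono half) (use small that in auto)
    moreover have "1 \<le> card I" using False fin by (simp add: Suc_le_eq card_gt_0_iff)
    ultimately show ?thesis by (simp add: Re_sum)
  qed
  have S1: "1/2 \<le> norm (?S z)" if "norm z < R" for z
    using ReS[OF that] complex_Re_le_cmod[of "?S z"] by linarith
  have hol: "?S holomorphic_on ball 0 R"
  proof (intro holomorphic_intros)
    fix i z assume iz: "i \<in> I" "z \<in> ball (0::complex) R"
    have "norm (c i * z) < 1" using small[of i z] iz by auto
    thus "1 - c i * z \<noteq> 0" by auto
  qed
  have cont: "continuous_on (sphere 0 r) ?S"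
    by (rule continuous_on_subset[OF holomorphic_on_imp_continuous_on[OF hol]]) (use R in auto)
  have nz: "?S z \<noteq> 0" if "norm z < R" for z using S1[OF that] by auto
  have "cmean r (\<lambda>z. lnp (norm (?S z))) \<le> cmean r (\<lambda>z. ln (norm (?S z)) + ln 2)"
  proof (rule cmean_mono)
    fix z :: complex assume z: "norm z = r"
    have *: "1/2 \<le> norm (?S z)" using S1 z R by auto
    have "max 1 (norm (?S z)) \<le> norm (?S z) * 2" using * by linarith
    hence "lnp (norm (?S z)) \<le> ln (norm (?S z) * 2)" unfolding lnp_def by (intro ln_mono) auto
    also have "\<dots> = ln (norm (?S z)) + ln 2" by (rule ln_mult_pos) (use * in linarith, simp)
    finally show "lnp (norm (?S z)) \<le> ln (norm (?S z)) + ln 2" .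
  qed (use r R nz in \<open>auto intro!: continuous_intros cont\<close>)
  also have "\<dots> = cmean r (\<lambda>z. ln (norm (?S z))) + ln 2"
    by (subst cmean_add) (use r R nz in \<open>auto intro!: continuous_intros cont\<close>)
  also have "cmean r (\<lambda>z. ln (norm (?S z))) = ln (norm (?S 0))"
    by (rule cmean_ln_norm_nonzero[OF hol r R]) (use nz in auto)
  also have "norm (?S 0) = real (card I)" by simp
  also have "ln (real (card I)) \<le> ln (real (card I) + 1)" using False fin by (simp add: card_gt_0_iff)
  finally show ?thesis by simp
qed

section \<open>Entire functions that do not vanish identically\<close>

definition entire_nz :: "(complex \<Rightarrow> complex) \<Rightarrow> bool" where
  "entire_nz F \<longleftrightarrow> F holomorphic_on UNIV \<and> (\<exists>z. F z \<noteq> 0)"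

lemma entire_nzD [dest]: "entire_nz F \<Longrightarrow> F holomorphic_on UNIV"
  by (simp add: entire_nz_def)

lemma entire_on: "F holomorphic_on UNIV \<Longrightarrow> F holomorphic_on S"
  by (rule holomorphic_on_subset) auto

lemma entire_nz_on: "entire_nz F \<Longrightarrow> F holomorphic_on S"
  by (rule entire_on) auto

lemma entire_open_nz: "F holomorphic_on UNIV \<Longrightarrow> open (F -` (-{0}))"
  by (rule open_vimage) (auto intro: holomorphic_on_imp_continuous_on)

lemma entire_nz_const: "c \<noteq> 0 \<Longrightarrow> entire_nz (\<lambda>_. c)"
  by (simp add: entire_nz_def)

lemma entire_nz_islimpt:
  assumes "entire_nz G"
  shows "\<not> z islimpt {w. G w = 0}"
proof
  assume lim: "z islimpt {w. G w = 0}"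
  have "G w = 0" for w
    by (rule analytic_continuation[of G UNIV "{w. G w = 0}" z])
       (use assms lim in \<open>auto simp: entire_nz_def\<close>)
  thus False using assms by (auto simp: entire_nz_def)
qed

lemma entire_nz_eventually:
  assumes "entire_nz G"
  shows "eventually (\<lambda>w. G w \<noteq> 0) (at z)"
  using entire_nz_islimpt[OF assms, of z] by (simp add: islimpt_iff_eventually)

lemma isCont_eq_punctured:
  fixes F H :: "complex \<Rightarrow> complex"
  assumes "isCont F z" "isCont H z" "eventually (\<lambda>w. F w = H w) (at z)"
  shows "F z = H z"
proof (rule LIM_unique)
  show "F \<midarrow>z\<rightarrow> F z" using assms(1) by (simp add: isCont_def)
  show "F \<midarrow>z\<rightarrow> H z" using assms(2) tendsto_cong[OF assms(3)] by (simp add: isCont_def)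
qed

lemma entire_isCont: "F holomorphic_on UNIV \<Longrightarrow> isCont F z"
  using holomorphic_on_imp_continuous_on continuous_on_eq_continuous_at open_UNIV by blast

lemma entire_eq_offI:
  assumes "entire_nz G" "F holomorphic_on UNIV" "H holomorphic_on UNIV"
    and "\<And>w. G w \<noteq> 0 \<Longrightarrow> F w = H w"
  shows "F = H"
proof (rule ext)
  fix z
  have "isCont F z" "isCont H z"
    using assms(2,3) by (auto intro: entire_isCont)
  moreover have "eventually (\<lambda>w. F w = H w) (at z)"
    using entire_nz_eventually[OF assms(1), of z] by eventually_elim (use assms(4) in auto)
  ultimately show "F z = H z"
    by (rule isCont_eq_punctured)
qed

lemma entire_nz_mult:
  assumes "entire_nz F" "entire_nz G"
  shows "entire_nz (\<lambda>z. F z * G z)"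
proof -
  have "F = (\<lambda>_. 0)" if "\<forall>z. F z * G z = 0"
    by (rule entire_eq_offI[OF assms(2)]) (use assms that in auto)
  hence "\<exists>z. F z * G z \<noteq> 0" using assms(1) unfolding entire_nz_def by metis
  moreover have "(\<lambda>z. F z * G z) holomorphic_on UNIV"
    by (intro holomorphic_intros) (use assms in auto)
  ultimately show ?thesis unfolding entire_nz_def by blast
qed

lemma entire_nz_power: "entire_nz F \<Longrightarrow> entire_nz (\<lambda>z. F z ^ n)"
  by (induction n) (simp_all add: entire_nz_const entire_nz_mult)

lemma entire_nz_prod:
  assumes "finite I" "\<And>i. i \<in> I \<Longrightarrow> entire_nz (F i)"
  shows "entire_nz (\<lambda>z. \<Prod>i\<in>I. F i z)"
  using assms by (induction I rule: finite_induct) (simp_all add: entire_nz_const entire_nz_mult)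

section \<open>Division of entire functions\<close>

text \<open>
  The local quotients agree on overlaps, because the zeros of \<open>G\<close> are isolated, and so they glue. All the
  divisibility statements below reduce to this one by a local argument.
\<close>
lemma entire_divide_local:
  assumes G: "entire_nz G"
    and loc: "\<And>z. \<exists>e>0. \<exists>\<phi>. \<phi> holomorphic_on ball z e \<and> (\<forall>w\<in>ball z e. F w = \<phi> w * G w)"
  obtains \<phi> where "\<phi> holomorphic_on UNIV" "\<And>w. F w = \<phi> w * G w"
proof -
  obtain e P where e: "\<And>z. e z > 0" and P: "\<And>z. P z holomorphic_on ball z (e z)"
    "\<And>z w. w \<in> ball z (e z) \<Longrightarrow> F w = P z w * G w"
    using loc by metis
  define \<phi> where "\<phi> = (\<lambda>z. P z z)"
  have eq: "\<phi> w = P z w" if w: "w \<in> ball z (e z)" for w z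
  proof -
    have "isCont (P w) w" "isCont (P z) w"
      using holomorphic_on_imp_continuous_on[OF P(1)[of w]] holomorphic_on_imp_continuous_on[OF P(1)[of z]]
        e[of w] w by (auto simp: continuous_on_eq_continuous_at)
    moreover have "eventually (\<lambda>x. x \<in> ball z (e z) \<inter> ball w (e w)) (at w)"
      by (rule eventually_at_in_open') (use w e in auto)
    hence "eventually (\<lambda>x. P w x = P z x) (at w)"
      using entire_nz_eventually[OF G, of w]
    proof eventually_elim
      case (elim x)
      hence "P w x * G x = P z x * G x" using P(2)[of x z] P(2)[of x w] by simp
      thus ?case using elim by simp
    qed
    ultimately show ?thesis unfolding \<phi>_def
      by (rule isCont_eq_punctured)
  qed
  have "\<phi> holomorphic_on (\<Union>z. ball z (e z))"
  proof (rule holomorphic_on_UN_open)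
    fix z show "\<phi> holomorphic_on ball z (e z)"
      using holomorphic_transform[OF P(1)[of z], of \<phi>] eq by auto
  qed auto
  moreover have "(\<Union>z. ball z (e z)) = UNIV" using e by force
  moreover have "F w = \<phi> w * G w" for w using P(2)[of w w] e by (simp add: \<phi>_def)
  ultimately show ?thesis using that by simp
qed

text \<open>
  Where \<open>p\<close> is nonzero, \<open>K / p\<close> is a local quotient; where \<open>\<beta>\<close> is nonzero, \<open>M / \<beta>\<close> is one.
\<close>
lemma entire_divide_coprime:
  assumes "entire_nz p" and "K holomorphic_on UNIV" "\<beta> holomorphic_on UNIV" "M holomorphic_on UNIV"
    and "\<And>z. K z * \<beta> z = p z * M z" and cop: "\<And>z. p z \<noteq> 0 \<or> \<beta> z \<noteq> 0"
  obtains J where "J holomorphic_on UNIV" "\<And>z. K z = J z * p z"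
proof -
  have loc: "\<exists>e>0. \<exists>\<phi>. \<phi> holomorphic_on ball z e \<and> (\<forall>w\<in>ball z e. K w = \<phi> w * p w)" for z
  proof -
    have "open (p -` (-{0}))" "open (\<beta> -` (-{0}))"
      by (rule entire_open_nz; use assms(1,3) in blast)+
    from cop[of z] show ?thesis
    proof
      assume "p z \<noteq> 0"
      then obtain e where e: "e > 0" "ball z e \<subseteq> p -` (-{0})"
        using \<open>open (p -` (-{0}))\<close> openE by blast
      have "(\<lambda>w. K w / p w) holomorphic_on ball z e"
        by (intro holomorphic_intros entire_on[OF assms(2)] entire_nz_on[OF assms(1)]) (use e in auto)
      thus ?thesis using e by (intro exI[of _ e] conjI exI[of _ "\<lambda>w. K w / p w"]) auto
    next
      assume "\<beta> z \<noteq> 0"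
      then obtain e where e: "e > 0" "ball z e \<subseteq> \<beta> -` (-{0})"
        using \<open>open (\<beta> -` (-{0}))\<close> openE by blast
      have "(\<lambda>w. M w / \<beta> w) holomorphic_on ball z e"
        by (intro holomorphic_intros entire_on[OF assms(3)] entire_on[OF assms(4)]) (use e in auto)
      moreover have "K w = M w / \<beta> w * p w" if "w \<in> ball z e" for w
      proof -
        have "\<beta> w \<noteq> 0" using e that by auto
        thus ?thesis using assms(5)[of w] by (simp add: field_simps)
      qed
      ultimately show ?thesis using e by (intro exI[of _ e] conjI exI[of _ "\<lambda>w. M w / \<beta> w"]) auto
    qed
  qed
  show ?thesis using entire_divide_local[OF assms(1) loc] that by blast
qed

text \<open>
  Riemann's theorem on removable singularities, applied to \<open>F / G\<close> at each zero of \<open>G\<close>.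
\<close>
lemma entire_divide_bounded:
  assumes G: "entire_nz G" and F: "F holomorphic_on UNIV"
    and B: "continuous_on UNIV B" and bd: "\<And>z. G z \<noteq> 0 \<Longrightarrow> norm (F z) \<le> B z * norm (G z)"
  obtains \<phi> where "\<phi> holomorphic_on UNIV" "\<And>w. F w = \<phi> w * G w"
proof -
  have loc: "\<exists>e>0. \<exists>\<phi>. \<phi> holomorphic_on ball z e \<and> (\<forall>w\<in>ball z e. F w = \<phi> w * G w)" for z
  proof -
    obtain e where e: "e > 0" "\<And>w. w \<in> ball z e - {z} \<Longrightarrow> G w \<noteq> 0"
      using entire_nz_eventually[OF G, of z] by (auto simp: eventually_at dist_commute)
    have "isCont B z" using B by (simp add: continuous_on_eq_continuous_at)
    hence "eventually (\<lambda>w. B w < B z + 1) (at z)"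
      by (intro order_tendstoD[of B "B z"]) (auto simp: isCont_def)
    hence "eventually (\<lambda>w. norm (F w / G w) \<le> B z + 1) (at z)"
      using entire_nz_eventually[OF G, of z]
    proof eventually_elim
      case (elim w)
      have "norm (F w) \<le> (B z + 1) * norm (G w)"
        by (rule order_trans[OF bd[OF elim(2)]]) (use elim in \<open>auto intro: mult_right_mono\<close>)
      thus ?case using elim by (simp add: norm_divide pos_divide_le_eq)
    qed
    moreover have "(\<lambda>w. F w / G w) holomorphic_on ball z e - {z}"
      by (intro holomorphic_intros entire_on[OF F] entire_nz_on[OF G]) (use e in auto)
    ultimately obtain \<phi> where \<phi>: "\<phi> holomorphic_on ball z e" "\<forall>w\<in>ball z e - {z}. \<phi> w = F w / G w"
      using holomorphic_on_extend_bounded[of "\<lambda>w. F w / G w" "ball z e" z] e by auto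
    have *: "F w = \<phi> w * G w" if "w \<in> ball z e - {z}" for w using \<phi>(2) e(2)[OF that] that by simp
    have "isCont F z" "isCont G z" using F G by (auto intro: entire_isCont)
    moreover have "isCont \<phi> z"
      using holomorphic_on_imp_continuous_on[OF \<phi>(1)] e(1) by (auto simp: continuous_on_eq_continuous_at)
    ultimately have "isCont F z" "isCont (\<lambda>w. \<phi> w * G w) z" by (auto intro: continuous_intros)
    moreover have "eventually (\<lambda>w. F w = \<phi> w * G w) (at z)"
      using e(1) * by (auto simp: eventually_at dist_commute intro!: exI[of _ e])
    ultimately have "F z = \<phi> z * G z"
      by (rule isCont_eq_punctured[where H = "\<lambda>w. \<phi> w * G w"])
    with * e \<phi>(1) show ?thesis
      by (metis DiffI singletonD)
  qed
  show ?thesis using entire_divide_local[OF G loc] that by blast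
qed

lemma entire_nz_zorder:
  assumes "entire_nz F"
  shows "if F z = 0 then zorder F z > 0 else zorder F z = 0"
    and "\<exists>r>0. zor_poly F z holomorphic_on cball z r \<and>
      (\<forall>w\<in>cball z r. F w = zor_poly F z w * (w - z) ^ nat (zorder F z) \<and> zor_poly F z w \<noteq> 0)"
proof -
  have *: "F holomorphic_on UNIV" "open (UNIV :: complex set)" "connected (UNIV :: complex set)" "z \<in> UNIV" "\<exists>w\<in>UNIV. F w \<noteq> 0"
    using assms by (auto simp: entire_nz_def)
  show "if F z = 0 then zorder F z > 0 else zorder F z = 0" using zorder_exist_zero[OF *] by blast
  show "\<exists>r>0. zor_poly F z holomorphic_on cball z r \<and>
      (\<forall>w\<in>cball z r. F w = zor_poly F z w * (w - z) ^ nat (zorder F z) \<and> zor_poly F z w \<noteq> 0)"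
    using zorder_exist_zero[OF *] by blast
qed

lemma entire_divide_zorder:
  assumes F: "entire_nz F" and G: "entire_nz G"
    and z: "\<And>z. G z = 0 \<Longrightarrow> F z = 0 \<and> zorder G z \<le> zorder F z"
  obtains \<phi> where "\<phi> holomorphic_on UNIV" "\<And>w. F w = \<phi> w * G w"
proof -
  have loc: "\<exists>e>0. \<exists>\<phi>. \<phi> holomorphic_on ball z e \<and> (\<forall>w\<in>ball z e. F w = \<phi> w * G w)" for z
  proof -
    note F0 = entire_nz_zorder(1)[OF F, of z] and G0 = entire_nz_zorder(1)[OF G, of z]
    obtain r1 where r1: "r1 > 0" "zor_poly F z holomorphic_on cball z r1"
      "\<And>w. w \<in> cball z r1 \<Longrightarrow> F w = zor_poly F z w * (w - z) ^ nat (zorder F z)"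
      using entire_nz_zorder(2)[OF F, of z] by blast
    obtain r2 where r2: "r2 > 0" "zor_poly G z holomorphic_on cball z r2"
      "\<And>w. w \<in> cball z r2 \<Longrightarrow> G w = zor_poly G z w * (w - z) ^ nat (zorder G z) \<and> zor_poly G z w \<noteq> 0"
      using entire_nz_zorder(2)[OF G, of z] by blast
    have le: "zorder G z \<le> zorder F z"
      using z[of z] F0 G0 by (auto split: if_splits)
    hence nle: "nat (zorder G z) \<le> nat (zorder F z)" by simp
    let ?k = "nat (zorder F z) - nat (zorder G z)"
    define \<phi> where "\<phi> = (\<lambda>w. zor_poly F z w / zor_poly G z w * (w - z) ^ ?k)"
    have "\<phi> holomorphic_on ball z (min r1 r2)"
      unfolding \<phi>_def
      by (intro holomorphic_intros holomorphic_on_subset[OF r1(2)] holomorphic_on_subset[OF r2(2)])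
         (use r2(3) in auto)
    moreover have "F w = \<phi> w * G w" if "w \<in> ball z (min r1 r2)" for w
    proof -
      have *: "w \<in> cball z r1" "w \<in> cball z r2" using that by auto
      have "\<phi> w * G w = zor_poly F z w * ((w - z) ^ ?k * (w - z) ^ nat (zorder G z))"
        using r2(3)[OF *(2)] by (simp add: \<phi>_def)
      also have "\<dots> = F w" using r1(3)[OF *(1)] nle by (simp add: power_add[symmetric])
      finally show ?thesis by simp
    qed
    ultimately show ?thesis
      using r1(1) r2(1) by (intro exI[of _ "min r1 r2"]) auto
  qed
  show ?thesis using entire_divide_local[OF G loc] that by blast
qed

text \<open>
  Each function divides the other, and the two quotients are inverse to each other.
\<close>
lemma entire_divide_same_zeros:
  assumes F: "entire_nz F" and G: "entire_nz G"
    and z: "\<And>z. F z = 0 \<longleftrightarrow> G z = 0" "\<And>z. F z = 0 \<Longrightarrow> zorder F z = zorder G z"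
  obtains \<phi> where "\<phi> holomorphic_on UNIV" "\<And>w. \<phi> w \<noteq> 0" "\<And>w. F w = \<phi> w * G w"
proof -
  have 1: "F z = 0 \<and> zorder G z \<le> zorder F z" if "G z = 0" for z using z[of z] that by simp
  have 2: "G z = 0 \<and> zorder F z \<le> zorder G z" if "F z = 0" for z using z[of z] that by simp
  obtain \<phi> where \<phi>: "\<phi> holomorphic_on UNIV" "\<And>w. F w = \<phi> w * G w"
    using entire_divide_zorder[OF F G 1] by blast
  obtain \<xi> where \<xi>: "\<xi> holomorphic_on UNIV" "\<And>w. G w = \<xi> w * F w"
    using entire_divide_zorder[OF G F 2] by blast
  have "(\<lambda>w. \<xi> w * \<phi> w) = (\<lambda>_. 1)"
  proof (rule entire_eq_offI[OF G])
    fix w assume "G w \<noteq> 0"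
    moreover have "G w = \<xi> w * \<phi> w * G w"
      unfolding mult.assoc \<phi>(2)[of w, symmetric] by (rule \<xi>(2))
    ultimately show "\<xi> w * \<phi> w = 1" by simp
  qed (intro holomorphic_intros \<phi>(1) \<xi>(1))+
  from fun_cong[OF this] have "\<phi> w \<noteq> 0" for w by (metis mult_zero_right zero_neq_one)
  with \<phi> that show ?thesis by blast
qed

text \<open>
  Stated without the constant \<open>wronskian\<close>, since the derivative of \<open>F / G\<close> is all that matters: it
  vanishes near a point at which \<open>G\<close> is nonzero, and the identity theorem extends \<open>F = c G\<close> to the plane.
\<close>
lemma entire_wronskian_0:
  assumes "F holomorphic_on UNIV" and G: "entire_nz G"
    and W: "\<And>z. deriv F z * G z = F z * deriv G z"
  obtains c where "\<And>z. F z = c * G z"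
proof -
  obtain z0 where z0: "G z0 \<noteq> 0" using G unfolding entire_nz_def by blast
  have holG: "G holomorphic_on UNIV" using G by auto
  have "open (G -` (-{0}))"
    by (rule entire_open_nz[OF holG])
  then obtain e where e: "e > 0" "ball z0 e \<subseteq> G -` (-{0})"
    using z0 by (metis ComplI empty_iff insert_iff openE vimageI)
  have der: "((\<lambda>z. F z / G z) has_field_derivative 0) (at z)" if "z \<in> ball z0 e" for z
  proof -
    have nz: "G z \<noteq> 0" using e that by auto
    have "(F has_field_derivative deriv F z) (at z)" "(G has_field_derivative deriv G z) (at z)"
      by (rule holomorphic_derivI[OF _ open_UNIV]; use assms(1) holG in simp)+
    from DERIV_divide[OF this nz] show ?thesis using W[of z] by (simp add: mult_ac)
  qed
  have "(\<lambda>z. F z / G z) constant_on ball z0 e"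
    by (rule DERIV_zero_connected_constant_on[of "ball z0 e" "{}"])
       (use der e in \<open>auto intro!: continuous_at_imp_continuous_on DERIV_isCont\<close>)
  then obtain c where c: "\<And>z. z \<in> ball z0 e \<Longrightarrow> F z / G z = c" by (auto simp: constant_on_def)
  have "F z - c * G z = 0" for z
  proof (rule analytic_continuation[of "\<lambda>z. F z - c * G z" UNIV "ball z0 e" z0])
    show "z0 islimpt ball z0 e" using e(1) by (intro interior_limit_point) simp
    show "F z - c * G z = 0" if "z \<in> ball z0 e" for z
    proof -
      have "G z \<noteq> 0" using e that by auto
      thus ?thesis using c[OF that] by (simp add: field_simps)
    qed
    show "(\<lambda>z. F z - c * G z) holomorphic_on UNIV" by (intro holomorphic_intros assms(1) holG)
  qed auto
  hence "F z = c * G z" for z by simp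
  thus ?thesis using that by blast
qed

lemma entire_nz_finite_zeros: "entire_nz A \<Longrightarrow> finite {z \<in> cball 0 R. A z = 0}"
proof -
  assume A: "entire_nz A"
  show ?thesis
  proof (rule ccontr)
    assume "infinite {z \<in> cball 0 R. A z = 0}"
    then obtain x where "x islimpt {z \<in> cball 0 R. A z = 0}"
      using compact_cball[of "0::complex" R] unfolding compact_eq_Bolzano_Weierstrass by (metis (no_types, lifting) mem_Collect_eq subsetI)
    hence "x islimpt {z. A z = 0}" by (rule islimpt_subset) auto
    thus False using entire_nz_islimpt[OF A] by blast
  qed
qed

lemma entire_nz_split_zero:
  assumes A: "entire_nz A"
  obtains k A1 where "entire_nz A1" "A1 a \<noteq> 0" "\<And>z. A z = (z - a) ^ k * A1 z"
proof -
  define k where "k = nat (zorder A a)"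
  obtain r where r: "r > 0" "zor_poly A a holomorphic_on cball a r"
    "\<And>w. w \<in> cball a r \<Longrightarrow> A w = zor_poly A a w * (w - a) ^ k \<and> zor_poly A a w \<noteq> 0"
    unfolding k_def using entire_nz_zorder(2)[OF A, of a] by blast
  have nz: "entire_nz (\<lambda>z. (z - a) ^ k)"
    unfolding entire_nz_def by (intro conjI holomorphic_intros exI[of _ "a + 1"]) simp
  have holA: "A holomorphic_on UNIV" using A by auto
  have loc: "\<exists>e>0. \<exists>\<phi>. \<phi> holomorphic_on ball z e \<and> (\<forall>w\<in>ball z e. A w = \<phi> w * (w - a) ^ k)" for z
    proof (cases "z = a")
      case True
      thus ?thesis using r by (intro exI[of _ r] conjI exI[of _ "zor_poly A a"])
        (auto elim: holomorphic_on_subset)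
    next
      case False
      have ne: "w \<noteq> a" if "w \<in> ball z (dist z a)" for w using that by auto
      have "(\<lambda>w. A w / (w - a) ^ k) holomorphic_on ball z (dist z a)"
        by (intro holomorphic_intros entire_on[OF holA]) (use ne in auto)
      thus ?thesis using False ne
        by (intro exI[of _ "dist z a"] conjI exI[of _ "\<lambda>w. A w / (w - a) ^ k"]) auto
    qed

  obtain A1 where A1: "A1 holomorphic_on UNIV" "\<And>w. A w = A1 w * (w - a) ^ k"
    using entire_divide_local[OF nz loc] by blast
  have "A1 a \<noteq> 0"
  proof -
    have "A1 w = zor_poly A a w" if "w \<in> ball a r - {a}" for w
      using r(3)[of w] A1(2)[of w] that by auto
    hence ev: "eventually (\<lambda>w. A1 w = zor_poly A a w) (at a)"
      using r(1) by (auto simp: eventually_at dist_commute intro!: exI[of _ r])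
    have c1: "isCont A1 a" using A1(1) by (rule entire_isCont)
    have "zor_poly A a holomorphic_on ball a r" using r(2) by (rule holomorphic_on_subset) auto
    hence c2: "isCont (zor_poly A a) a"
      using holomorphic_on_imp_continuous_on[of "zor_poly A a" "ball a r"] r(1) by (auto simp: continuous_on_eq_continuous_at)
    from c1 c2 ev have "A1 a = zor_poly A a a" by (rule isCont_eq_punctured)
    thus ?thesis using r by auto
  qed
  with A1 that show ?thesis by (metis entire_nz_def mult.commute)
qed

lemma prod_lessThan_add: "(\<Prod>i<(k::nat) + n. f i) = (\<Prod>i<k. f i) * (\<Prod>i<n. f (k + i) :: 'a::comm_monoid_mult)"
  by (induction n) (auto simp: mult_ac)

text \<open>
  The zeros in a closed disc are split off one distinct zero at a time, by induction on their number;
  multiple zeros are repeated in the sequence \<open>a\<close>.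
\<close>
lemma entire_factor_zeros:
  assumes "entire_nz A"
  shows "\<exists>(n::nat) a G. entire_nz G \<and> (\<forall>i<n. A (a i) = 0 \<and> norm (a i) \<le> R) \<and>
      (\<forall>z. norm z \<le> R \<longrightarrow> G z \<noteq> 0) \<and> (\<forall>z. A z = (\<Prod>i<n. z - a i) * G z)"
proof -
  define N where "N = card {z \<in> cball 0 R. A z = 0}"
  have "\<exists>n a G. entire_nz G \<and> (\<forall>i<n. A (a i) = 0 \<and> norm (a i) \<le> R) \<and>
      (\<forall>z. norm z \<le> R \<longrightarrow> G z \<noteq> 0) \<and> (\<forall>z. A z = (\<Prod>i<(n::nat). z - a i) * G z)"
    using N_def assms
  proof (induction N arbitrary: A)
    case 0
    hence "{z \<in> cball 0 R. A z = 0} = {}" using entire_nz_finite_zeros[of A R] by simp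
    hence "\<forall>z. norm z \<le> R \<longrightarrow> A z \<noteq> 0" by auto
    with 0 show ?case by (intro exI[of _ 0] exI[of _ A]) auto
  next
    case (Suc N)
    have "{z \<in> cball 0 R. A z = 0} \<noteq> {}" using Suc.prems(1) by (metis Zero_not_Suc card.empty)
    then obtain b where b: "norm b \<le> R" "A b = 0" by auto
    obtain k A1 where A1: "entire_nz A1" "A1 b \<noteq> 0" "\<And>z. A z = (z - b) ^ k * A1 z"
      using entire_nz_split_zero[OF Suc.prems(2), of b] by blast
    have "k \<noteq> 0" using A1(2) A1(3)[of b] b(2) by (auto intro!: Nat.gr0I)
    have "{z \<in> cball 0 R. A1 z = 0} = {z \<in> cball 0 R. A z = 0} - {b}"
      using A1 \<open>k \<noteq> 0\<close> by auto
    hence "N = card {z \<in> cball 0 R. A1 z = 0}"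
      using Suc.prems(1) b entire_nz_finite_zeros[OF Suc.prems(2), of R] by (simp add: card_Diff_singleton)
    from Suc.IH[OF this A1(1)] obtain n a G where IH: "entire_nz G"
      "\<forall>i<n. A1 (a i) = 0 \<and> norm (a i) \<le> R" "\<forall>z. norm z \<le> R \<longrightarrow> G z \<noteq> 0"
      "\<forall>z. A1 z = (\<Prod>i<(n::nat). z - a i) * G z" by blast
    define a' where "a' = (\<lambda>i. if i < k then b else a (i - k))"
    have "(\<Prod>i<k+n. z - a' i) = (z - b) ^ k * (\<Prod>i<n. z - a i)" for z
      by (simp add: prod_lessThan_add a'_def)
    hence "\<forall>z. A z = (\<Prod>i<k+n. z - a' i) * G z" using IH(4) A1(3) by (simp add: mult_ac)
    moreover have "\<forall>i<k+n. A (a' i) = 0 \<and> norm (a' i) \<le> R"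
      using IH(2) b A1(3) by (auto simp: a'_def)
    ultimately show ?case using IH(1,3) by blast
  qed
  thus ?thesis .
qed

section \<open>Jensen's inequality and the number of zeros\<close>

abbreviation lmean :: "real \<Rightarrow> (complex \<Rightarrow> complex) \<Rightarrow> real" where
  "lmean r F \<equiv> cmean r (\<lambda>z. ln (norm (F z)))"

text \<open>
  The radii of circles through a zero. They form a countable set, so every interval contains
  radii outside it, and at these \<open>ln (norm (F z))\<close> is continuous on the circle. Estimates below hold
  off a countable set \<open>E\<close> of radii for this reason.
\<close>
definition zradii :: "(complex \<Rightarrow> complex) \<Rightarrow> real set" where
  "zradii F = norm ` {z. F z = 0}"

lemma zradii_notin: "r \<notin> zradii F \<Longrightarrow> norm z = r \<Longrightarrow> F z \<noteq> 0"
  by (auto simp: zradii_def)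

lemma countable_zradii: 
  assumes "entire_nz F" shows "countable (zradii F)"
proof -
  have "{z. F z = 0} = (\<Union>n::nat. {z \<in> cball 0 (real n). F z = 0})"
  proof safe
    fix x assume "F x = 0"
    obtain n where "norm x \<le> real n" using real_arch_simple by blast
    thus "x \<in> (\<Union>n::nat. {z \<in> cball 0 (real n). F z = 0})" using \<open>F x = 0\<close> by (intro UN_I[of n]) auto
  qed
  also have "countable \<dots>"
    by (rule countable_UN[OF countableI_type countable_finite[OF entire_nz_finite_zeros[OF assms]]])
  finally show ?thesis unfolding zradii_def by (rule countable_image)
qed

lemma good_radius:
  assumes "countable E" "a < (b::real)"
  obtains r where "a < r" "r < b" "r \<notin> E"
proof -
  have "\<not> {a<..<b} \<subseteq> E"
    using assms uncountable_open_interval[of a b] countable_subset by blast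
  then obtain r where "r \<in> {a<..<b}" "r \<notin> E" by blast
  thus ?thesis by (intro that[of r]) auto
qed

lemma continuous_on_ln_norm:
  assumes "F holomorphic_on UNIV" "\<And>z. z \<in> S \<Longrightarrow> F z \<noteq> 0"
  shows "continuous_on S (\<lambda>z. ln (norm (F z)))"
proof -
  have "continuous_on S F" using holomorphic_on_imp_continuous_on[OF entire_on[OF assms(1)]] .
  thus ?thesis by (intro continuous_intros) (use assms(2) in auto)
qed

lemma lmean_mult:
  assumes "F holomorphic_on UNIV" "G holomorphic_on UNIV" "0 \<le> r"
    and "\<And>z. norm z = r \<Longrightarrow> F z \<noteq> 0" "\<And>z. norm z = r \<Longrightarrow> G z \<noteq> 0"
  shows "lmean r (\<lambda>z. F z * G z) = lmean r F + lmean r G"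
proof -
  have "lmean r (\<lambda>z. F z * G z) = cmean r (\<lambda>z. ln (norm (F z)) + ln (norm (G z)))"
    by (rule cmean_cong) (use assms in \<open>auto simp: norm_mult ln_mult\<close>)
  also have "\<dots> = lmean r F + lmean r G"
    by (rule cmean_add) (use assms in \<open>auto intro!: continuous_on_ln_norm\<close>)
  finally show ?thesis .
qed

lemma lmean_linear_prod:
  assumes "\<And>i. i < n \<Longrightarrow> norm (a i) < r" "0 < r"
  shows "lmean r (\<lambda>z. \<Prod>i<n. z - a i) = real n * ln r"
  using assms(1)
proof (induction n)
  case (Suc n)
  have ne: "z \<noteq> a i" if "i < Suc n" "norm z = r" for i z using Suc.prems[OF that(1)] that(2) by auto
  have "lmean r (\<lambda>z. (\<Prod>i<n. z - a i) * (z - a n)) = lmean r (\<lambda>z. \<Prod>i<n. z - a i) + lmean r (\<lambda>z. z - a n)"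
    by (rule lmean_mult) (use ne assms(2) in \<open>auto intro!: holomorphic_intros\<close>)
  thus ?case using Suc cmean_ln_norm_linear[of "a n" r] by (simp add: algebra_simps)
qed simp

lemma entire_nz_nonzero_ball:
  assumes "entire_nz G" "\<And>z. norm z \<le> r \<Longrightarrow> G z \<noteq> 0"
  obtains R where "r < R" "\<And>z. norm z < R \<Longrightarrow> G z \<noteq> 0"
proof -
  define Z where "Z = insert (r+1) (norm ` {z \<in> cball 0 (r+1). G z = 0})"
  have fin: "finite Z" using entire_nz_finite_zeros[OF assms(1)] by (auto simp: Z_def)
  have "Min Z \<in> Z" by (rule Min_in) (use fin in \<open>auto simp: Z_def\<close>)
  hence 1: "r < Min Z" using assms(2) by (fastforce simp: Z_def not_le[symmetric])
  have 2: "G z \<noteq> 0" if "norm z < Min Z" for z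
  proof
    assume "G z = 0"
    have "Min Z \<le> r + 1" by (rule Min_le) (use fin in \<open>auto simp: Z_def\<close>)
    hence "norm z \<in> Z" using that \<open>G z = 0\<close> by (auto simp: Z_def)
    thus False using Min_le[OF fin, of "norm z"] that by simp
  qed
  show ?thesis by (rule that[OF 1 2])
qed

lemma lmean_nonzero:
  assumes "entire_nz G" "0 < r" "\<And>z. norm z \<le> r \<Longrightarrow> G z \<noteq> 0"
  shows "lmean r G = ln (norm (G 0))"
proof -
  obtain R where "r < R" "\<And>z. norm z < R \<Longrightarrow> G z \<noteq> 0"
    using entire_nz_nonzero_ball[OF assms(1,3)] by blast
  thus ?thesis using assms by (intro cmean_ln_norm_nonzero[where R = R] entire_nz_on)
qed

text \<open>
  Splitting off the zeros in the disc, each linear factor contributes \<open>ln r\<close> to the mean but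
  only \<open>ln (norm (a i)) \<le> ln r\<close> to the value at \<open>0\<close>.
\<close>
lemma jensen_ineq:
  assumes A: "entire_nz A" "A 0 \<noteq> 0" and r: "0 < r" "\<And>z. norm z = r \<Longrightarrow> A z \<noteq> 0"
  shows "ln (norm (A 0)) \<le> lmean r A"
proof -
  obtain n :: nat and a G where f': "entire_nz G" "\<forall>i<n. A (a i) = 0 \<and> norm (a i) \<le> r"
    "\<forall>z. norm z \<le> r \<longrightarrow> G z \<noteq> 0" "\<forall>z. A z = (\<Prod>i<n. z - a i) * G z"
    using entire_factor_zeros[OF A(1), of r] by blast
  note f = f'(1) f'(2-4)[rule_format]
  have lt: "norm (a i) < r" if "i < n" for i
    using f(2)[OF that] r(2)[of "a i"] by (metis order_le_less)
  have a0: "a i \<noteq> 0" if "i < n" for i using f(2)[OF that] A(2) by metis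
  have "lmean r A = lmean r (\<lambda>z. (\<Prod>i<n. z - a i) * G z)" by (simp only: f(4))
  also have "\<dots> = lmean r (\<lambda>z. \<Prod>i<n. z - a i) + lmean r G"
  proof (rule lmean_mult)
    show "(\<Prod>i<n. z - a i) \<noteq> 0" if "norm z = r" for z using lt that by (auto dest: less_imp_neq)
  qed (use f(1,3) r in \<open>auto intro!: holomorphic_intros\<close>)
  also have "\<dots> = real n * ln r + ln (norm (G 0))"
    using lmean_linear_prod[of n a r, OF lt r(1)] lmean_nonzero[OF f(1) r(1) f(3)] by simp
  finally have 1: "lmean r A = real n * ln r + ln (norm (G 0))" .
  have "ln (\<Prod>i<n. norm (a i)) = (\<Sum>i<n. ln (norm (a i)))"
    by (rule ln_prod) (use a0 in auto)
  hence "ln (norm (A 0)) = (\<Sum>i<n. ln (norm (a i))) + ln (norm (G 0))"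
    using a0 f(3)[of 0] r(1) unfolding f(4)[of 0] by (simp add: norm_mult ln_mult prod_norm[symmetric])
  moreover have "(\<Sum>i<n. ln (norm (a i))) \<le> (\<Sum>i<n. ln r)"
    by (intro sum_mono) (use lt a0 r in \<open>auto intro!: ln_mono less_imp_le\<close>)
  ultimately show ?thesis using 1 by simp
qed

lemma lmean_lower_bound:
  assumes "entire_nz A"
  obtains C where "0 \<le> C" "\<And>r. 1 \<le> r \<Longrightarrow> r \<notin> zradii A \<Longrightarrow> - C \<le> lmean r A"
proof -
  obtain k A1 where A1: "entire_nz A1" "A1 0 \<noteq> 0" "\<And>z. A z = (z - 0) ^ k * A1 z"
    using entire_nz_split_zero[OF assms, of 0] by blast
  show ?thesis
  proof (rule that[of "\<bar>ln (norm (A1 0))\<bar>"])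
    fix r :: real assume r: "1 \<le> r" "r \<notin> zradii A"
    have nz: "A1 z \<noteq> 0" if "norm z = r" for z
      using zradii_notin[OF r(2) that] A1(3)[of z] by auto
    have "lmean r A = cmean r (\<lambda>z. real k * ln r + ln (norm (A1 z)))"
      by (rule cmean_cong) (use r nz in \<open>auto simp: A1(3) norm_mult norm_power ln_mult ln_realpow\<close>)
    also have "\<dots> = real k * ln r + lmean r A1"
      by (subst cmean_add) (use r nz A1 in \<open>auto intro!: continuous_on_ln_norm\<close>)
    finally have "lmean r A = real k * ln r + lmean r A1" .
    moreover have "ln (norm (A1 0)) \<le> lmean r A1" by (rule jensen_ineq) (use A1 r nz in auto)
    moreover have "0 \<le> real k * ln r" using r by simp
    ultimately show "- \<bar>ln (norm (A1 0))\<bar> \<le> lmean r A" by linarith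
  qed simp
qed

text \<open>
  Jensen's inequality with room to spare: between the radii \<open>R\<close> and \<open>R'\<close> each zero contributes
  \<open>ln R' - ln R\<close> to the growth of the mean. The centre \<open>0\<close> may itself be a zero.
\<close>
lemma zero_count_le:
  assumes A: "\<And>z. A z = (\<Prod>i<(n::nat). z - a i) * G z" "entire_nz G"
    and a: "\<And>i. i < n \<Longrightarrow> norm (a i) < R" "\<And>z. norm z \<le> R \<Longrightarrow> G z \<noteq> 0"
    and R: "0 < R" "R < R'" "\<And>z. norm z = R' \<Longrightarrow> A z \<noteq> 0"
  shows "real n * (ln R' - ln R) \<le> lmean R' A - lmean R A"
proof -
  have 1: "lmean \<rho> A = real n * ln \<rho> + lmean \<rho> G" if "R \<le> \<rho>" "\<And>z. norm z = \<rho> \<Longrightarrow> G z \<noteq> 0" for \<rho>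
  proof -
    have lt: "norm (a i) < \<rho>" if "i < n" for i using a(1)[OF that] \<open>R \<le> \<rho>\<close> by simp
    have "lmean \<rho> A = lmean \<rho> (\<lambda>z. (\<Prod>i<n. z - a i) * G z)" using A by simp
    also have "\<dots> = lmean \<rho> (\<lambda>z. \<Prod>i<n. z - a i) + lmean \<rho> G"
      by (rule lmean_mult) (use A lt that R in \<open>auto intro!: holomorphic_intros\<close>)
    also have "\<dots> = real n * ln \<rho> + lmean \<rho> G"
      using lmean_linear_prod[of n a \<rho>] lt R that by simp
    finally show ?thesis .
  qed
  have G': "G z \<noteq> 0" if "norm z = R'" for z using R(3)[OF that] A(1)[of z] by auto
  have "lmean R G = ln (norm (G 0))" by (rule lmean_nonzero) (use A R a in auto)
  moreover have "ln (norm (G 0)) \<le> lmean R' G"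
    by (rule jensen_ineq) (use A R G' a(2)[of 0] in auto)
  ultimately show ?thesis using 1[of R] 1[of R'] a(2) G' R by (simp add: algebra_simps)
qed

section \<open>The lemma on the logarithmic derivative\<close>

text \<open>
  The poles inside and outside the circle are treated separately: by reflection in the circle, respectively
  by factoring out \<open>1 / z\<close>, both partial sums take the form of the lemma \<open>cmean_lnp_sum_inverse\<close>. The
  bound is logarithmic in the number of poles, whatever their distance from the circle.
\<close>
lemma cmean_lnp_sum_poles:
  assumes r: "1 \<le> r" and a: "\<And>i. i < n \<Longrightarrow> norm (a i) \<noteq> r"
  shows "cmean r (\<lambda>z. lnp (norm (\<Sum>i<(n::nat). 1 / (z - a i)))) \<le> 3 * ln (real n + 1) + 4 * ln 2"
proof -
  define I where "I = {i \<in> {..<n}. norm (a i) < r}"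
  define J where "J = {i \<in> {..<n}. r < norm (a i)}"
  have fin: "finite I" "finite J" by (auto simp: I_def J_def)
  have un: "{..<n} = I \<union> J" "I \<inter> J = {}" using a by (force simp: I_def J_def)+
  have card: "card I \<le> n" "card J \<le> n"
    using card_mono[of "{..<n}" I] card_mono[of "{..<n}" J] by (auto simp: I_def J_def)
  let ?SI = "\<lambda>z. \<Sum>i\<in>I. 1 / (1 - cnj (a i) / of_real (r^2) * z)"
  let ?SJ = "\<lambda>z. \<Sum>i\<in>J. 1 / (1 - 1 / a i * z)"
  have cI: "norm (cnj (a i) / of_real (r^2)) * r < 1" if "i \<in> I" for i
    using that r by (simp add: I_def norm_divide norm_mult power2_eq_square)
  have cJ: "norm (1 / a i) * r < 1" if "i \<in> J" for i
    using that r by (auto simp: J_def norm_divide divide_simps)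
  have nz: "1 - c * z \<noteq> 0" if "norm c * r < 1" "norm z = r" for c z :: complex
  proof
    assume "1 - c * z = 0" hence "norm (c * z) = 1" by simp
    thus False using that by (simp add: norm_mult)
  qed
  have pt: "lnp (norm (\<Sum>i<n. 1 / (z - a i))) \<le>
      lnp (norm (?SI z)) + (lnp (norm (?SJ z)) + (ln (real n + 1) + 2 * ln 2))"
    if z: "norm z = r" for z
  proof -
    have z0: "z \<noteq> 0" using z r by auto
    have cz: "cnj z = of_real (r^2) / z"
      using z z0 by (simp add: field_simps complex_norm_square[symmetric])
    have ne: "z \<noteq> a i" if "i < n" for i using a[OF that] z by auto
    have "(\<Sum>i<n. 1 / (z - a i)) = (\<Sum>i\<in>I. 1 / (z - a i)) + (\<Sum>i\<in>J. 1 / (z - a i))"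
      unfolding un(1) using fin un(2) by (rule sum.union_disjoint)
    also have "(\<Sum>i\<in>I. 1 / (z - a i)) = cnj (?SI z) / z"
      unfolding cnj_sum sum_divide_distrib
    proof (rule sum.cong)
      fix i assume i: "i \<in> I"
      hence "z - a i \<noteq> 0" using ne by (auto simp: I_def)
      moreover have "complex_of_real r \<noteq> 0" using r by simp
      moreover have "1 - a i / of_real (r^2) * cnj z = (z - a i) / z"
        using z0 r by (simp add: cz field_simps)
      ultimately show "1 / (z - a i) = cnj (1 / (1 - cnj (a i) / of_real (r^2) * z)) / z"
        using z0 by simp
    qed simp
    also have "(\<Sum>i\<in>J. 1 / (z - a i)) = (\<Sum>i\<in>J. (1 - 1 / (1 - 1 / a i * z)) / z)"
    proof (rule sum.cong)
      fix i assume i: "i \<in> J"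
      hence "z - a i \<noteq> 0" "a i \<noteq> 0" using ne r by (auto simp: J_def)
      thus "1 / (z - a i) = (1 - 1 / (1 - 1 / a i * z)) / z"
        using z0 nz[OF cJ[OF i] z] by (simp add: divide_simps)
    qed simp
    also have "\<dots> = (of_nat (card J) - ?SJ z) / z"
      by (simp add: sum_subtractf sum_divide_distrib[symmetric])
    finally have eq: "(\<Sum>i<n. 1 / (z - a i)) = (cnj (?SI z) + (of_nat (card J) - ?SJ z)) / z"
      by (simp add: add_divide_distrib)
    have "norm (\<Sum>i<n. 1 / (z - a i)) \<le> norm (cnj (?SI z) + (of_nat (card J) - ?SJ z))"
      unfolding eq norm_divide z using r by (simp add: divide_le_eq mult_le_cancel_left1)
    also have "\<dots> \<le> norm (?SI z) + (real n + norm (?SJ z))"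
      using norm_triangle_ineq[of "cnj (?SI z)" "of_nat (card J) - ?SJ z"]
        norm_triangle_ineq4[of "of_nat (card J)" "?SJ z"] card(2) norm_of_nat[of "card J", where ?'a = complex]
        complex_mod_cnj[of "?SI z"] of_nat_mono[of "card J" n, where ?'a = real] by linarith
    finally have "lnp (norm (\<Sum>i<n. 1 / (z - a i))) \<le> lnp (norm (?SI z) + (real n + norm (?SJ z)))"
      by (rule lnp_mono)
    also have "\<dots> \<le> lnp (norm (?SI z)) + lnp (real n + norm (?SJ z)) + ln 2" by (rule lnp_add) auto
    also have "lnp (real n + norm (?SJ z)) \<le> lnp (real n) + lnp (norm (?SJ z)) + ln 2"
      by (rule lnp_add) auto
    also have "lnp (real n) \<le> ln (real n + 1)" unfolding lnp_def by (intro ln_mono) auto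
    finally show ?thesis by simp
  qed
  have contI: "continuous_on (sphere 0 r) ?SI"
    by (intro continuous_intros) (use nz[OF cI] in auto)
  have contJ: "continuous_on (sphere 0 r) ?SJ"
    by (intro continuous_intros) (use nz[OF cJ] in auto)
  have "cmean r (\<lambda>z. lnp (norm (\<Sum>i<n. 1 / (z - a i)))) \<le>
      cmean r (\<lambda>z. lnp (norm (?SI z)) + (lnp (norm (?SJ z)) + (ln (real n + 1) + 2 * ln 2)))"
  proof (rule cmean_mono)
    show "continuous_on (sphere 0 r) (\<lambda>z. lnp (norm (\<Sum>i<n. 1 / (z - a i))))"
      by (intro continuous_intros) (use a in auto)
    show "continuous_on (sphere 0 r) (\<lambda>z. lnp (norm (?SI z)) + (lnp (norm (?SJ z)) + (ln (real n + 1) + 2 * ln 2)))"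
      by (intro continuous_on_add continuous_on_const continuous_on_lnp continuous_on_norm contI contJ)
  qed (use pt r in auto)
  also have "\<dots> = cmean r (\<lambda>z. lnp (norm (?SI z))) + (cmean r (\<lambda>z. lnp (norm (?SJ z))) + (ln (real n + 1) + 2 * ln 2))"
  proof -
    have l: "continuous_on (sphere 0 r) (\<lambda>z. lnp (norm (?SI z)))" "continuous_on (sphere 0 r) (\<lambda>z. lnp (norm (?SJ z)))"
      by (intro continuous_on_lnp continuous_on_norm contI contJ)+
    have r0: "0 \<le> r" using r by simp
    show ?thesis
      by (simp only: cmean_add[OF l(1) continuous_on_add[OF l(2) continuous_on_const] r0] cmean_add[OF l(2) continuous_on_const r0] cmean_const)
  qed
  also have "\<dots> \<le> (ln (real (card I) + 1) + ln 2) + ((ln (real (card J) + 1) + ln 2) + (ln (real n + 1) + 2 * ln 2))"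
    using cmean_lnp_sum_inverse[of r I "\<lambda>i. cnj (a i) / of_real (r^2)"] cmean_lnp_sum_inverse[of r J "\<lambda>i. 1 / a i"]
      cI cJ fin r by (intro add_mono) auto
  also have "\<dots> \<le> 3 * ln (real n + 1) + 4 * ln 2"
  proof -
    have "ln (real (card I) + 1) \<le> ln (real n + 1)" by (rule ln_mono) (use card in auto)
    moreover have "ln (real (card J) + 1) \<le> ln (real n + 1)" by (rule ln_mono) (use card in auto)
    ultimately show ?thesis by linarith
  qed
  finally show ?thesis .
qed

lemma logderiv_factored:
  assumes A: "\<And>z. A z = (\<Prod>i<(n::nat). z - a i) * G z" "G holomorphic_on UNIV" and nz: "A z \<noteq> 0"
  shows "deriv A z / A z = (\<Sum>i<n. 1 / (z - a i)) + deriv G z / G z"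
proof -
  have nzG: "G z \<noteq> 0" and nzp: "(\<Prod>i<n. z - a i) \<noteq> 0" using nz A(1)[of z] by auto
  have "((\<lambda>z. \<Prod>i<n. z - a i) has_field_derivative (\<Prod>i<n. z - a i) * (\<Sum>i<n. 1 / (z - a i))) (at z)"
    using nzp
  proof (induction n)
    case (Suc n)
    have nz': "(\<Prod>i<n. z - a i) \<noteq> 0" "z - a n \<noteq> 0" using Suc.prems by auto
    have "((\<lambda>z. (\<Prod>i<n. z - a i) * (z - a n)) has_field_derivative
       ((\<Prod>i<n. z - a i) * (\<Sum>i<n. 1 / (z - a i))) * (z - a n) + 1 * (\<Prod>i<n. z - a i)) (at z)"
      by (rule DERIV_mult[OF Suc.IH[OF nz'(1)]]) (auto intro!: derivative_eq_intros)
    moreover have "((\<Prod>i<n. z - a i) * (\<Sum>i<n. 1 / (z - a i))) * (z - a n) + 1 * (\<Prod>i<n. z - a i)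
        = ((\<Prod>i<n. z - a i) * (z - a n)) * ((\<Sum>i<n. 1 / (z - a i)) + 1 / (z - a n))"
      using nz'(2) by (simp add: algebra_simps add_divide_distrib[symmetric] diff_divide_distrib[symmetric])
        (simp add: divide_simps algebra_simps)
    ultimately show ?case by simp
  qed simp
  moreover have "(G has_field_derivative deriv G z) (at z)"
    using assms(2) by (intro holomorphic_derivI[OF _ open_UNIV]) auto
  ultimately have "((\<lambda>z. (\<Prod>i<n. z - a i) * G z) has_field_derivative
      ((\<Prod>i<n. z - a i) * (\<Sum>i<n. 1 / (z - a i))) * G z + deriv G z * (\<Prod>i<n. z - a i)) (at z)"
    by (rule DERIV_mult)
  hence "deriv A z = ((\<Prod>i<n. z - a i) * (\<Sum>i<n. 1 / (z - a i))) * G z + deriv G z * (\<Prod>i<n. z - a i)"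
    using A(1) DERIV_imp_deriv by (metis (no_types, lifting) ext)
  thus ?thesis using nzG nzp by (simp add: A(1) add_divide_distrib)
qed

text \<open>
  The function \<open>ln (norm (z - a)) - ln r\<close> has mean \<open>0\<close> and is bounded above by \<open>ln 2\<close>, so its
  absolute value has a mean of at most \<open>2 * ln 2\<close>.
\<close>
lemma cmean_abs_ln_linear:
  assumes "norm a < r"
  shows "cmean r (\<lambda>z. \<bar>ln (norm (z - a)) - ln r\<bar>) \<le> 2 * ln 2"
proof -
  have r: "0 < r" using assms norm_ge_zero le_less_trans by blast
  have ne: "z - a \<noteq> 0" if "norm z = r" for z using assms that by auto
  have cont: "continuous_on (sphere 0 r) (\<lambda>z. ln (norm (z - a)))"
    by (rule continuous_on_ln_norm) (use ne in \<open>auto intro!: holomorphic_intros\<close>)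
  have "cmean r (\<lambda>z. \<bar>ln (norm (z - a)) - ln r\<bar>) \<le> cmean r (\<lambda>z. (2 * ln 2 + ln r) - ln (norm (z - a)))"
  proof (rule cmean_mono)
    fix z :: complex assume z: "norm z = r"
    have "norm (z - a) \<le> r * 2" using norm_triangle_ineq4[of z a] z assms by simp
    hence "ln (norm (z - a)) \<le> ln (r * 2)" using ne[OF z] r by (intro ln_mono) auto
    also have "\<dots> = ln r + ln 2" using r by (simp add: ln_mult)
    finally have *: "ln (norm (z - a)) - ln r \<le> ln 2" by simp
    have "0 \<le> ln (2::real)" by simp
    thus "\<bar>ln (norm (z - a)) - ln r\<bar> \<le> (2 * ln 2 + ln r) - ln (norm (z - a))" using * by linarith
  qed (use r in \<open>auto intro!: continuous_intros cont\<close>)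
  also have "\<dots> = 2 * ln 2 + ln r - lmean r (\<lambda>z. z - a)"
    by (subst cmean_diff) (use r cont in auto)
  also have "\<dots> = 2 * ln 2" using cmean_ln_norm_linear[OF assms] by simp
  finally show ?thesis .
qed

lemma ln_diff_ge: "0 < a \<Longrightarrow> a < b \<Longrightarrow> (b - a) / b \<le> ln b - ln (a::real)"
proof -
  assume a: "0 < a" "a < b"
  have "ln (a / b) \<le> a / b - 1" by (rule ln_le_minus_one) (use a in auto)
  moreover have "ln (a / b) = ln a - ln b" using a by (simp add: ln_div)
  moreover have "(b - a) / b = 1 - a / b" using a by (simp add: field_simps)
  ultimately show ?thesis by linarith
qed

text \<open>
  The zero-free parts \<open>GA\<close> and \<open>GB\<close> have a quotient with a holomorphic logarithm, to which
  \<open>norm_deriv_le_cmean_Re\<close> applies. Up to the zeros that were split off, its real part is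
  \<open>ln (norm A) - ln (norm B)\<close>, and the absolute value of this is at most
  \<open>2 * ln (norm A + norm B) - ln (norm A) - ln (norm B)\<close>; the means of the last two terms are
  bounded below by Jensen's inequality.
\<close>
lemma logderiv_remainder_bound:
  assumes A: "entire_nz A" "\<And>z. A z = (\<Prod>i<(nA::nat). z - a i) * GA z" "entire_nz GA"
      "\<And>i. i < nA \<Longrightarrow> norm (a i) < R" "\<And>z. norm z \<le> R \<Longrightarrow> GA z \<noteq> 0"
    and B: "entire_nz B" "\<And>z. B z = (\<Prod>i<(nB::nat). z - b i) * GB z" "entire_nz GB"
      "\<And>i. i < nB \<Longrightarrow> norm (b i) < R" "\<And>z. norm z \<le> R \<Longrightarrow> GB z \<noteq> 0"
    and R: "0 < R" and z: "norm z < R"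
  shows "norm (deriv GA z / GA z - deriv GB z / GB z) \<le> 2 * R / (R - norm z)^2 *
    (2 * cmean R (\<lambda>z. ln (norm (A z) + norm (B z))) - lmean R A - lmean R B + 2 * ln 2 * (real nA + real nB))"
proof -
  have nzA: "A z \<noteq> 0" if "norm z = R" for z
    using A(4,5) that by (force simp: A(2))
  have nzB: "B z \<noteq> 0" if "norm z = R" for z
    using B(4,5) that by (force simp: B(2))
  obtain R1 where R1: "R < R1" "\<And>z. norm z < R1 \<Longrightarrow> GA z \<noteq> 0"
    using entire_nz_nonzero_ball[OF A(3,5)] by blast
  obtain R2 where R2: "R < R2" "\<And>z. norm z < R2 \<Longrightarrow> GB z \<noteq> 0"
    using entire_nz_nonzero_ball[OF B(3,5)] by blast
  define R3 where "R3 = min R1 R2"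
  have R3: "R < R3" "\<And>z. norm z < R3 \<Longrightarrow> GA z \<noteq> 0" "\<And>z. norm z < R3 \<Longrightarrow> GB z \<noteq> 0"
    using R1 R2 by (auto simp: R3_def)
  have hq: "(\<lambda>z. GA z / GB z) holomorphic_on ball 0 R3"
    by (intro holomorphic_intros entire_nz_on[OF A(3)] entire_nz_on[OF B(3)]) (use R3 in auto)
  obtain k where k: "k holomorphic_on ball 0 R3" "\<And>x. x \<in> ball 0 R3 \<Longrightarrow> exp (k x) = GA x / GB x"
    using holomorphic_logarithm_exists[OF _ _ hq, of 0] R3 R by auto
  \<comment> \<open>The constant \<open>c\<close> normalizes the linear factors \<open>z - a i\<close> to mean \<open>0\<close> on the circle of radius \<open>R\<close>.\<close>
  define c where "c = (real nA - real nB) * ln R"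
  define K where "K = (\<lambda>z. k z + of_real c)"
  have holK: "K holomorphic_on ball 0 R3" unfolding K_def by (intro holomorphic_intros k)
  have dK: "deriv K w = deriv GA w / GA w - deriv GB w / GB w" if w: "norm w < R3" for w
  proof -
    have ev: "eventually (\<lambda>x. x \<in> ball 0 R3) (nhds w)" using w by (intro eventually_nhds_in_open) auto
    have dk: "(k has_field_derivative deriv k w) (at w)"
      by (rule holomorphic_derivI[OF k(1) open_ball]) (use w in simp)
    have "((\<lambda>x. exp (k x)) has_field_derivative exp (k w) * deriv k w) (at w)"
      by (rule DERIV_chain2[OF DERIV_exp dk])
    moreover have "eventually (\<lambda>x. exp (k x) = GA x / GB x) (nhds w)"
      using ev by eventually_elim (use k(2) in auto)
    ultimately have "((\<lambda>x. GA x / GB x) has_field_derivative exp (k w) * deriv k w) (at w)"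
      by (simp add: DERIV_cong_ev[OF refl _ refl])
    moreover have "((\<lambda>x. GA x / GB x) has_field_derivative (deriv GA w * GB w - GA w * deriv GB w) / (GB w * GB w)) (at w)"
      using R3(3)[OF w] A(3) B(3) by (intro DERIV_divide holomorphic_derivI[OF _ open_UNIV]) auto
    ultimately have "exp (k w) * deriv k w = (deriv GA w * GB w - GA w * deriv GB w) / (GB w * GB w)"
      by (rule DERIV_unique)
    hence "GA w / GB w * deriv k w = (deriv GA w * GB w - GA w * deriv GB w) / (GB w * GB w)"
      using k(2)[of w] w by simp
    hence "deriv k w = deriv GA w / GA w - deriv GB w / GB w"
      using R3(2,3)[OF w] by (simp add: field_simps)
    moreover have "deriv K w = deriv k w"
      unfolding K_def by (rule DERIV_imp_deriv) (use dk in \<open>auto intro!: derivative_eq_intros\<close>)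
    ultimately show ?thesis by simp
  qed
  have ReK: "\<bar>Re (K w)\<bar> \<le> (2 * ln (norm (A w) + norm (B w)) - ln (norm (A w)) - ln (norm (B w)))
      + ((\<Sum>i<nA. \<bar>ln (norm (w - a i)) - ln R\<bar>) + (\<Sum>i<nB. \<bar>ln (norm (w - b i)) - ln R\<bar>))"
    if w: "norm w = R" for w
  proof -
    have wa: "w - a i \<noteq> 0" if "i < nA" for i using A(4)[OF that] w by auto
    have wb: "w - b i \<noteq> 0" if "i < nB" for i using B(4)[OF that] w by auto
    have "exp (Re (k w)) = norm (GA w / GB w)"
      using k(2)[of w] w R3(1) norm_exp_eq_Re[of "k w"] by simp
    hence "Re (k w) = ln (norm (GA w / GB w))" by (metis ln_exp)
    also have "\<dots> = ln (norm (GA w)) - ln (norm (GB w))"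
      using R3 w by (simp add: norm_divide ln_div)
    finally have 1: "Re (K w) = ln (norm (GA w)) - ln (norm (GB w)) + c" by (simp add: K_def)
    have "ln (\<Prod>i<nA. norm (w - a i)) = (\<Sum>i<nA. ln (norm (w - a i)))"
      by (rule ln_prod) (use wa in auto)
    hence 2: "ln (norm (A w)) = (\<Sum>i<nA. ln (norm (w - a i))) + ln (norm (GA w))"
      using wa R3 w by (simp add: A(2) norm_mult ln_mult prod_norm[symmetric])
    have "ln (\<Prod>i<nB. norm (w - b i)) = (\<Sum>i<nB. ln (norm (w - b i)))"
      by (rule ln_prod) (use wb in auto)
    hence 3: "ln (norm (B w)) = (\<Sum>i<nB. ln (norm (w - b i))) + ln (norm (GB w))"
      using wb R3 w by (simp add: B(2) norm_mult ln_mult prod_norm[symmetric])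
    have 4: "Re (K w) = ln (norm (A w)) - ln (norm (B w)) -
        (\<Sum>i<nA. ln (norm (w - a i)) - ln R) + (\<Sum>i<nB. ln (norm (w - b i)) - ln R)"
      using 1 2 3 by (simp add: c_def sum_subtractf algebra_simps)
    have 5: "ln (norm (A w)) \<le> ln (norm (A w) + norm (B w))" "ln (norm (B w)) \<le> ln (norm (A w) + norm (B w))"
      using nzA[OF w] nzB[OF w] by (auto intro!: ln_mono add_pos_pos)
    show ?thesis
      using 4 5 sum_abs[of "\<lambda>i. ln (norm (w - a i)) - ln R" "{..<nA}"]
        sum_abs[of "\<lambda>i. ln (norm (w - b i)) - ln R" "{..<nB}"] by linarith
  qed
  have cA: "continuous_on (sphere 0 R) (\<lambda>z. ln (norm (A z)))"
    by (rule continuous_on_ln_norm) (use A(1) nzA in auto)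
  have cB: "continuous_on (sphere 0 R) (\<lambda>z. ln (norm (B z)))"
    by (rule continuous_on_ln_norm) (use B(1) nzB in auto)
  note contA = holomorphic_on_imp_continuous_on[OF entire_nz_on[OF A(1)]]
    and contB = holomorphic_on_imp_continuous_on[OF entire_nz_on[OF B(1)]]
  have cAB: "continuous_on (sphere 0 R) (\<lambda>z. ln (norm (A z) + norm (B z)))"
    by (intro continuous_intros contA contB) (use nzA in \<open>auto simp: add_nonneg_eq_0_iff\<close>)
  have contK: "continuous_on (sphere 0 R) K"
    by (rule continuous_on_subset[OF holomorphic_on_imp_continuous_on[OF holK]]) (use R3 in auto)
  have ca: "continuous_on (sphere 0 R) (\<lambda>z. \<bar>ln (norm (z - a i)) - ln R\<bar>)" if "i < nA" for i
  proof -
    have "z - a i \<noteq> 0" if "norm z = R" for z using A(4)[OF \<open>i < nA\<close>] that by auto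
    thus ?thesis by (intro continuous_intros) auto
  qed
  have cb: "continuous_on (sphere 0 R) (\<lambda>z. \<bar>ln (norm (z - b i)) - ln R\<bar>)" if "i < nB" for i
  proof -
    have "z - b i \<noteq> 0" if "norm z = R" for z using B(4)[OF \<open>i < nB\<close>] that by auto
    thus ?thesis by (intro continuous_intros) auto
  qed
  have R0: "0 \<le> R" using R by simp
  have csa: "continuous_on (sphere 0 R) (\<lambda>z. \<Sum>i<nA. \<bar>ln (norm (z - a i)) - ln R\<bar>)"
    by (rule continuous_on_sum) (use ca in auto)
  have csb: "continuous_on (sphere 0 R) (\<lambda>z. \<Sum>i<nB. \<bar>ln (norm (z - b i)) - ln R\<bar>)"
    by (rule continuous_on_sum) (use cb in auto)
  have c1: "continuous_on (sphere 0 R) (\<lambda>z. 2 * ln (norm (A z) + norm (B z)) - ln (norm (A z)) - ln (norm (B z)))"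
    by (intro continuous_on_diff continuous_on_mult continuous_on_const cAB cA cB)
  have c2: "continuous_on (sphere 0 R) (\<lambda>z. 2 * ln (norm (A z) + norm (B z)) - ln (norm (A z)))"
    by (intro continuous_on_diff continuous_on_mult continuous_on_const cAB cA)
  have c3: "continuous_on (sphere 0 R) (\<lambda>z. 2 * ln (norm (A z) + norm (B z)))"
    by (intro continuous_on_mult continuous_on_const cAB)
  have "cmean R (\<lambda>w. \<bar>Re (K w)\<bar>) \<le> cmean R (\<lambda>w. (2 * ln (norm (A w) + norm (B w)) - ln (norm (A w)) - ln (norm (B w)))
      + ((\<Sum>i<nA. \<bar>ln (norm (w - a i)) - ln R\<bar>) + (\<Sum>i<nB. \<bar>ln (norm (w - b i)) - ln R\<bar>)))"
    by (rule cmean_mono) (use ReK R0 in \<open>auto intro!: continuous_intros contK c1 csa csb\<close>)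
  also have "\<dots> = 2 * cmean R (\<lambda>z. ln (norm (A z) + norm (B z))) - lmean R A - lmean R B
     + ((\<Sum>i<nA. cmean R (\<lambda>w. \<bar>ln (norm (w - a i)) - ln R\<bar>)) + (\<Sum>i<nB. cmean R (\<lambda>w. \<bar>ln (norm (w - b i)) - ln R\<bar>)))"
  proof -
    have sma: "cmean R (\<lambda>z. \<Sum>i<nA. \<bar>ln (norm (z - a i)) - ln R\<bar>) = (\<Sum>i<nA. cmean R (\<lambda>w. \<bar>ln (norm (w - a i)) - ln R\<bar>))"
      by (rule cmean_sum) (use ca R0 in auto)
    have smb: "cmean R (\<lambda>z. \<Sum>i<nB. \<bar>ln (norm (z - b i)) - ln R\<bar>) = (\<Sum>i<nB. cmean R (\<lambda>w. \<bar>ln (norm (w - b i)) - ln R\<bar>))"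
      by (rule cmean_sum) (use cb R0 in auto)
    show ?thesis
      by (simp only: cmean_add[OF c1 continuous_on_add[OF csa csb] R0] cmean_add[OF csa csb R0]
         cmean_diff[OF c2 cB R0] cmean_diff[OF c3 cA R0] cmean_cmult sma smb)
  qed
  also have "\<dots> \<le> 2 * cmean R (\<lambda>z. ln (norm (A z) + norm (B z))) - lmean R A - lmean R B
     + ((\<Sum>i<nA. 2 * ln 2) + (\<Sum>i<nB. 2 * ln 2))"
    by (intro add_left_mono add_mono sum_mono cmean_abs_ln_linear) (use A(4) B(4) in auto)
  also have "\<dots> = 2 * cmean R (\<lambda>z. ln (norm (A z) + norm (B z))) - lmean R A - lmean R B + 2 * ln 2 * (real nA + real nB)"
    by (simp add: algebra_simps)
  finally have M: "cmean R (\<lambda>w. \<bar>Re (K w)\<bar>) \<le> \<dots>" .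
  have "norm (deriv K z) \<le> 2 * R / (R - norm z)^2 * cmean R (\<lambda>w. \<bar>Re (K w)\<bar>)"
    by (rule norm_deriv_le_cmean_Re[OF holK R R3(1) z])
  also have "\<dots> \<le> 2 * R / (R - norm z)^2 * (2 * cmean R (\<lambda>z. ln (norm (A z) + norm (B z))) - lmean R A - lmean R B + 2 * ln 2 * (real nA + real nB))"
    by (intro mult_left_mono M) (use R in auto)
  finally show ?thesis using dK[of z] z R3(1) by simp
qed

text \<open>
  The lemma on the logarithmic derivative, for the quotient \<open>A / B\<close> and with \<open>U\<close> an upper bound for the
  characteristic on \<open>(r, R)\<close>. After splitting off the zeros in a disc of radius \<open>R1\<close> between \<open>r\<close>
  and \<open>R\<close>, the logarithmic derivative is a sum of simple poles, whose positive logarithm has a mean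
  that is logarithmic in the number of zeros, and a remainder that is polynomially bounded in \<open>U\<close>
  and \<open>R / (R - r)\<close>.
\<close>
theorem logarithmic_derivative:
  assumes A: "entire_nz A" and B: "entire_nz B" and E: "countable E" "zradii A \<subseteq> E" "zradii B \<subseteq> E"
  obtains C where "0 \<le> C" "\<And>r R U. 1 \<le> r \<Longrightarrow> r < R \<Longrightarrow> r \<notin> E \<Longrightarrow> 1 \<le> U \<Longrightarrow>
     (\<And>\<rho>. r < \<rho> \<Longrightarrow> \<rho> < R \<Longrightarrow> \<rho> \<notin> E \<Longrightarrow> cmean \<rho> (\<lambda>z. ln (norm (A z) + norm (B z))) \<le> U) \<Longrightarrow>
     cmean r (\<lambda>z. lnp (norm (deriv A z / A z - deriv B z / B z))) \<le> C * (1 + ln U + ln (R / (R - r)))"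
proof -
  obtain CA where CA: "0 \<le> CA" "\<And>r. 1 \<le> r \<Longrightarrow> r \<notin> zradii A \<Longrightarrow> - CA \<le> lmean r A"
    using lmean_lower_bound[OF A] by blast
  obtain CB where CB: "0 \<le> CB" "\<And>r. 1 \<le> r \<Longrightarrow> r \<notin> zradii B \<Longrightarrow> - CB \<le> lmean r B"
    using lmean_lower_bound[OF B] by blast
  define D where "D = 1 + CA + CB"
  have D: "1 \<le> D" using CA CB by (simp add: D_def)
  define C where "C = max 9 (12 * ln 2 + 6 * ln (5 * D) + ln (576 * D))"
  show ?thesis
  proof (rule that[of C])
    show "0 \<le> C" by (simp add: C_def)
    fix r R U :: real
    assume r: "1 \<le> r" "r < R" "r \<notin> E" and U: "1 \<le> U"
      and bd: "\<And>\<rho>. r < \<rho> \<Longrightarrow> \<rho> < R \<Longrightarrow> \<rho> \<notin> E \<Longrightarrow> cmean \<rho> (\<lambda>z. ln (norm (A z) + norm (B z))) \<le> U"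
    define \<delta> where "\<delta> = (R - r) / 4"
    have \<delta>: "0 < \<delta>" "R = r + 4 * \<delta>" using r by (auto simp: \<delta>_def field_simps)
    \<comment> \<open>Zeros are split off up to radius \<open>R1\<close> and counted with the help of the larger radius \<open>R2\<close>.\<close>
    obtain R1 where R1: "r + \<delta> < R1" "R1 < r + 2 * \<delta>" "R1 \<notin> E"
      using good_radius[OF E(1), of "r + \<delta>" "r + 2 * \<delta>"] \<delta> by auto
    obtain R2 where R2: "r + 3 * \<delta> < R2" "R2 < R" "R2 \<notin> E"
      using good_radius[OF E(1), of "r + 3 * \<delta>" R] \<delta> by auto
    define X where "X = R / (R - r)"
    have X: "1 \<le> X" using r by (simp add: X_def field_simps)
    define V where "V = D * U"
    have V: "1 \<le> V" "U + CA \<le> V" "U + CB \<le> V" "2 * U + CA + CB \<le> 2 * V"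
    proof -
      have "CA \<le> CA * U" "CB \<le> CB * U" using CA CB U by (auto simp: mult_le_cancel_left1)
      thus "1 \<le> V" "U + CA \<le> V" "U + CB \<le> V" "2 * U + CA + CB \<le> 2 * V"
        using U CA(1) CB(1) by (auto simp: V_def D_def algebra_simps)
    qed
    have fact: "\<exists>n a G. entire_nz G \<and> (\<forall>i<n. norm (a i) < R1) \<and> (\<forall>i<n. norm (a i) \<noteq> r) \<and>
        (\<forall>z. norm z \<le> R1 \<longrightarrow> G z \<noteq> 0) \<and> (\<forall>z. F z = (\<Prod>i<(n::nat). z - a i) * G z) \<and>
        real n \<le> 4 * V * X"
      if F: "entire_nz F" "zradii F \<subseteq> E" "- CF \<le> lmean R1 F" "lmean R2 F \<le> U" "U + CF \<le> V" for F CF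
    proof -
      obtain n :: nat and a G where f': "entire_nz G" "\<forall>i<n. F (a i) = 0 \<and> norm (a i) \<le> R1"
        "\<forall>z. norm z \<le> R1 \<longrightarrow> G z \<noteq> 0" "\<forall>z. F z = (\<Prod>i<n. z - a i) * G z"
        using entire_factor_zeros[OF F(1), of R1] by blast
      have ne: "norm (a i) \<noteq> \<rho>" if "i < n" "\<rho> \<notin> E" for i \<rho>
        using f'(2) that F(2) by (auto simp: zradii_def)
      have lt: "norm (a i) < R1" if "i < n" for i
        using f'(2) ne[OF that R1(3)] that by (metis order_le_less)
      have F2: "F z \<noteq> 0" if "norm z = R2" for z
        using that R2(3) F(2) by (intro zradii_notin[of R2]) auto
      have "real n * (ln R2 - ln R1) \<le> lmean R2 F - lmean R1 F"
        by (rule zero_count_le[where A = F and G = G and a = a and n = n]) (use f'(1,3,4) lt R1 R2 r \<delta> F2 in simp_all)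
      also have "\<dots> \<le> V" using F by linarith
      finally have "real n * (ln R2 - ln R1) \<le> V" .
      moreover have "\<delta> / R \<le> ln R2 - ln R1"
      proof -
        have "\<delta> / R \<le> \<delta> / R2" using R1 R2 r \<delta> by (intro divide_left_mono) auto
        also have "\<dots> \<le> (R2 - R1) / R2" using R1 R2 r \<delta> by (intro divide_right_mono) auto
        also have "\<dots> \<le> ln R2 - ln R1" by (rule ln_diff_ge) (use R1 R2 r \<delta> in auto)
        finally show ?thesis .
      qed
      ultimately have "real n * (\<delta> / R) \<le> V" by (meson mult_left_mono of_nat_0_le_iff order_trans)
      hence "real n \<le> V * (R / \<delta>)" using \<delta> r by (simp add: field_simps)
      also have "R / \<delta> = 4 * X" using \<delta>(1) by (simp add: X_def \<delta>_def)
      finally show ?thesis using f' lt ne[OF _ r(3)] by (intro exI[of _ n] exI[of _ a] exI[of _ G]) auto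
    qed
    have nzr: "A z \<noteq> 0" "B z \<noteq> 0" if "norm z = \<rho>" "\<rho> \<notin> E" for z \<rho>
      using that E by (auto simp: zradii_def)
    note contA = holomorphic_on_imp_continuous_on[OF entire_nz_on[OF A]]
      and contB = holomorphic_on_imp_continuous_on[OF entire_nz_on[OF B]]
    have cAB: "continuous_on (sphere 0 \<rho>) (\<lambda>z. ln (norm (A z) + norm (B z)))" if "\<rho> \<notin> E" for \<rho>
      by (intro continuous_intros contA contB) (use nzr[OF _ that] in \<open>auto simp: add_nonneg_eq_0_iff\<close>)
    have cAr: "continuous_on (sphere 0 \<rho>) (\<lambda>z. ln (norm (A z)))" "continuous_on (sphere 0 \<rho>) (\<lambda>z. ln (norm (B z)))" if "\<rho> \<notin> E" for \<rho>
      using A B nzr[OF _ that] by (auto intro!: continuous_on_ln_norm)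
    have leU: "lmean R2 A \<le> U" "lmean R2 B \<le> U"
    proof -
      have "lmean R2 A \<le> cmean R2 (\<lambda>z. ln (norm (A z) + norm (B z)))"
        by (rule cmean_mono[OF cAr(1)[OF R2(3)] cAB[OF R2(3)]])
           (use R2 r \<delta> nzr[OF _ R2(3)] in \<open>auto intro!: ln_mono add_pos_nonneg\<close>)
      moreover have "lmean R2 B \<le> cmean R2 (\<lambda>z. ln (norm (A z) + norm (B z)))"
        by (rule cmean_mono[OF cAr(2)[OF R2(3)] cAB[OF R2(3)]])
           (use R2 r \<delta> nzr[OF _ R2(3)] in \<open>auto intro!: ln_mono add_nonneg_pos\<close>)
      ultimately show "lmean R2 A \<le> U" "lmean R2 B \<le> U" using bd[of R2] R2 \<delta> by auto
    qed
    have lowA: "- CA \<le> lmean R1 A" by (rule CA(2)) (use R1 r \<delta> E in auto)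
    have lowB: "- CB \<le> lmean R1 B" by (rule CB(2)) (use R1 r \<delta> E in auto)
    obtain nA :: nat and a GA where fA: "entire_nz GA" "\<forall>i<nA. norm (a i) < R1" "\<forall>i<nA. norm (a i) \<noteq> r"
        "\<forall>z. norm z \<le> R1 \<longrightarrow> GA z \<noteq> 0" "\<forall>z. A z = (\<Prod>i<nA. z - a i) * GA z" "real nA \<le> 4 * V * X"
      using fact[OF A E(2) lowA leU(1) V(2)] by blast
    obtain nB :: nat and b GB where fB: "entire_nz GB" "\<forall>i<nB. norm (b i) < R1" "\<forall>i<nB. norm (b i) \<noteq> r"
        "\<forall>z. norm z \<le> R1 \<longrightarrow> GB z \<noteq> 0" "\<forall>z. B z = (\<Prod>i<nB. z - b i) * GB z" "real nB \<le> 4 * V * X"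
      using fact[OF B E(3) lowB leU(2) V(3)] by blast
    have VX: "1 \<le> V * X" using V X mult_mono[of 1 V 1 X] by simp
    let ?Q = "\<lambda>z. deriv GA z / GA z - deriv GB z / GB z"
    have Q: "norm (?Q z) \<le> 576 * V * X ^ 3" if z: "norm z = r" for z
    proof -
      have "norm (?Q z) \<le> 2 * R1 / (R1 - norm z)^2 *
         (2 * cmean R1 (\<lambda>z. ln (norm (A z) + norm (B z))) - lmean R1 A - lmean R1 B + 2 * ln 2 * (real nA + real nB))"
        by (rule logderiv_remainder_bound[OF A fA(5)[rule_format] fA(1) fA(2)[rule_format] fA(4)[rule_format]
              B fB(5)[rule_format] fB(1) fB(2)[rule_format] fB(4)[rule_format]])
           (use r R1 z \<delta> in auto)
      also have "\<dots> \<le> 2 * R1 / (R1 - norm z)^2 * (18 * (V * X))"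
      proof (intro mult_left_mono)
        have "ln (2::real) \<le> 1" using ln_le_minus_one[of 2] by simp
        hence "2 * ln 2 * (real nA + real nB) \<le> 2 * (real nA + real nB)" by (intro mult_right_mono) auto
        also have "\<dots> \<le> 16 * (V * X)" using fA(6) fB(6) by simp
        finally have 1: "2 * ln 2 * (real nA + real nB) \<le> 16 * (V * X)" .
        have "cmean R1 (\<lambda>z. ln (norm (A z) + norm (B z))) \<le> U" using bd[of R1] R1 \<delta> by auto
        hence "2 * cmean R1 (\<lambda>z. ln (norm (A z) + norm (B z))) - lmean R1 A - lmean R1 B \<le> 2 * V"
          using lowA lowB V(4) by linarith
        also have "\<dots> \<le> 2 * (V * X)" using V X by (simp add: mult_le_cancel_left1)
        finally show "2 * cmean R1 (\<lambda>z. ln (norm (A z) + norm (B z))) - lmean R1 A - lmean R1 B + 2 * ln 2 * (real nA + real nB)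
            \<le> 18 * (V * X)" using 1 by linarith
      qed (use R1 r \<delta> in auto)
      also have "\<dots> \<le> (32 * X^2) * (18 * (V * X))"
      proof (intro mult_right_mono)
        have "2 * R1 / (R1 - norm z)^2 \<le> 2 * R / \<delta>^2"
          using R1 R2 r \<delta> z by (intro frac_le power_mono) auto
        also have "\<dots> = 32 * (R / (R - r)^2)" using \<delta>(1) by (simp add: \<delta>_def field_simps power2_eq_square)
        also have "\<dots> \<le> 32 * X^2"
        proof -
          have "R \<le> R^2" using r by (simp add: power2_eq_square)
          thus ?thesis using r by (simp add: X_def power_divide divide_right_mono)
        qed
        finally show "2 * R1 / (R1 - norm z)^2 \<le> 32 * X^2" .
      qed (use VX in auto)
      also have "\<dots> = 576 * V * X ^ 3" by (simp add: power2_eq_square power3_eq_cube)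
      finally show ?thesis .
    qed
    let ?SA = "\<lambda>z. \<Sum>i<nA. 1 / (z - a i)" and ?SB = "\<lambda>z. \<Sum>i<nB. 1 / (z - b i)"
    have "1 \<le> X ^ 3" using X by simp
    have VX3: "1 \<le> 576 * V * X ^ 3" using V(1) \<open>1 \<le> X ^ 3\<close> mult_mono[of 1 V 1 "X^3"] by simp
    have pt: "lnp (norm (deriv A z / A z - deriv B z / B z)) \<le>
        lnp (norm (?SA z)) + (lnp (norm (?SB z)) + (ln (576 * V * X ^ 3) + 2 * ln 2))" if z: "norm z = r" for z
    proof -
      have "deriv A z / A z - deriv B z / B z = ?SA z + (?Q z - ?SB z)"
        by (simp add: logderiv_factored[OF fA(5)[rule_format] entire_nzD[OF fA(1)] nzr(1)[OF z r(3)]]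
            logderiv_factored[OF fB(5)[rule_format] entire_nzD[OF fB(1)] nzr(2)[OF z r(3)]])
      also have "norm \<dots> \<le> norm (?SA z) + (norm (?SB z) + norm (?Q z))"
        using norm_triangle_ineq[of "?SA z" "?Q z - ?SB z"] norm_triangle_ineq4[of "?Q z" "?SB z"] by simp
      finally have "lnp (norm (deriv A z / A z - deriv B z / B z)) \<le> lnp (norm (?SA z) + (norm (?SB z) + norm (?Q z)))"
        by (rule lnp_mono)
      also have "\<dots> \<le> lnp (norm (?SA z)) + lnp (norm (?SB z) + norm (?Q z)) + ln 2" by (rule lnp_add) auto
      also have "lnp (norm (?SB z) + norm (?Q z)) \<le> lnp (norm (?SB z)) + lnp (norm (?Q z)) + ln 2" by (rule lnp_add) auto
      also have "lnp (norm (?Q z)) \<le> lnp (576 * V * X ^ 3)" by (rule lnp_mono[OF Q[OF z]])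
      also have "\<dots> = ln (576 * V * X ^ 3)" by (rule lnp_eq_ln[OF VX3])
      finally show ?thesis by simp
    qed
    note dA = holomorphic_on_imp_continuous_on[OF entire_on[OF holomorphic_deriv[OF entire_nzD[OF A] open_UNIV]]]
      holomorphic_on_imp_continuous_on[OF entire_on[OF holomorphic_deriv[OF entire_nzD[OF B] open_UNIV]]]
    have cSA: "continuous_on (sphere 0 r) ?SA"
      by (intro continuous_intros) (use fA(3) in auto)
    have cSB: "continuous_on (sphere 0 r) ?SB"
      by (intro continuous_intros) (use fB(3) in auto)
    have "cmean r (\<lambda>z. lnp (norm (deriv A z / A z - deriv B z / B z))) \<le>
       cmean r (\<lambda>z. lnp (norm (?SA z)) + (lnp (norm (?SB z)) + (ln (576 * V * X ^ 3) + 2 * ln 2)))"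
    proof (rule cmean_mono)
      show "continuous_on (sphere 0 r) (\<lambda>z. lnp (norm (deriv A z / A z - deriv B z / B z)))"
        by (intro continuous_intros contA contB dA) (use nzr[OF _ r(3)] in auto)
      show "continuous_on (sphere 0 r) (\<lambda>z. lnp (norm (?SA z)) + (lnp (norm (?SB z)) + (ln (576 * V * X ^ 3) + 2 * ln 2)))"
        by (intro continuous_on_add continuous_on_const continuous_on_lnp continuous_on_norm cSA cSB)
    qed (use pt r in auto)
    also have "\<dots> = cmean r (\<lambda>z. lnp (norm (?SA z))) + (cmean r (\<lambda>z. lnp (norm (?SB z))) + (ln (576 * V * X ^ 3) + 2 * ln 2))"
    proof -
      have l: "continuous_on (sphere 0 r) (\<lambda>z. lnp (norm (?SA z)))" "continuous_on (sphere 0 r) (\<lambda>z. lnp (norm (?SB z)))"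
        by (intro continuous_on_lnp continuous_on_norm cSA cSB)+
      have r0: "0 \<le> r" using r by simp
      show ?thesis
        by (simp only: cmean_add[OF l(1) continuous_on_add[OF l(2) continuous_on_const] r0] cmean_add[OF l(2) continuous_on_const r0] cmean_const)
    qed
    also have "\<dots> \<le> (3 * ln (5 * (V * X)) + 4 * ln 2) + ((3 * ln (5 * (V * X)) + 4 * ln 2) + (ln (576 * V * X ^ 3) + 2 * ln 2))"
    proof -
      have "ln (real nA + 1) \<le> ln (5 * (V * X))" by (intro ln_mono) (use fA(6) VX in auto)
      moreover have "ln (real nB + 1) \<le> ln (5 * (V * X))" by (intro ln_mono) (use fB(6) VX in auto)
      ultimately show ?thesis
        using cmean_lnp_sum_poles[OF r(1), of nA a] cmean_lnp_sum_poles[OF r(1), of nB b] fA(3) fB(3) by auto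
    qed
    also have "\<dots> = 6 * ln (5 * D) + ln (576 * D) + 10 * ln 2 + 7 * ln U + 9 * ln X"
    proof -
      have p: "0 < D" "0 < U" "0 < X" using D U X by auto
      hence "ln (5 * (V * X)) = ln (5 * D) + ln U + ln X" unfolding V_def by (simp add: ln_mult)
      moreover have "ln (576 * V * X ^ 3) = ln (576 * D) + ln U + 3 * ln X"
        unfolding V_def using p by (simp add: ln_mult ln_realpow)
      ultimately show ?thesis by simp
    qed
    also have "\<dots> \<le> C + C * ln U + C * ln X"
    proof -
      have "7 * ln U \<le> C * ln U" "9 * ln X \<le> C * ln X"
        using U X by (auto intro!: mult_right_mono simp: C_def)
      moreover have "6 * ln (5 * D) + ln (576 * D) + 10 * ln 2 \<le> C"
        using ln_ge_zero[of "2::real"] unfolding C_def by linarith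
      ultimately show ?thesis by linarith
    qed
    finally show "cmean r (\<lambda>z. lnp (norm (deriv A z / A z - deriv B z / B z))) \<le> C * (1 + ln U + ln (R / (R - r)))"
      by (simp add: X_def algebra_simps)
  qed
qed

section \<open>Radii of controlled growth\<close>

text \<open>
  On \<open>(r, r + r / V r)\<close> the function \<open>V\<close> at most doubles. This interval is long enough for the
  logarithmic derivative lemma to lose only a multiple of \<open>ln (V r)\<close>.
\<close>
definition growth_radius :: "(real \<Rightarrow> real) \<Rightarrow> real set \<Rightarrow> real \<Rightarrow> bool" where
  "growth_radius V E r \<longleftrightarrow> 1 \<le> r \<and> r \<notin> E \<and> 1 \<le> V r \<and> (\<forall>\<rho>. r < \<rho> \<and> \<rho> < r + r / V r \<longrightarrow> V \<rho> \<le> 2 * V r)"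

lemma good_radius_near:
  fixes V :: "real \<Rightarrow> real"
  assumes cont: "continuous_on {1..} V" and E: "countable E" and \<rho>: "1 \<le> a" "a < \<rho>" "\<rho> < b" "L < V \<rho>"
  obtains r where "a < r" "r < b" "r \<notin> E" "L < V r"
proof -
  have "isCont V \<rho>"
    by (rule continuous_on_interior[OF cont]) (use \<rho> in \<open>auto simp: interior_real_atLeast\<close>)
  hence "eventually (\<lambda>x. L < V x) (at \<rho>)"
    using \<rho>(4) by (auto simp: isCont_def dest: order_tendstoD)
  then obtain e where e: "e > 0" "\<And>x. x \<noteq> \<rho> \<Longrightarrow> dist x \<rho> < e \<Longrightarrow> L < V x"
    by (auto simp: eventually_at)
  obtain r where r: "\<rho> < r" "r < min b (\<rho> + e)" "r \<notin> E"
    using good_radius[OF E, of \<rho> "min b (\<rho> + e)"] e(1) \<rho> by auto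
  show ?thesis by (rule that[of r]) (use r \<rho> e in \<open>auto simp: dist_real_def\<close>)
qed

text \<open>
  This is Borel's growth lemma. If no such radius existed, one could pass from a radius to a later one at which \<open>V\<close> has more than
  doubled; the increments are at most \<open>r / V r\<close>, so the radii converge while \<open>V\<close> tends to infinity.
\<close>
lemma exists_growth_radius:
  assumes cont: "continuous_on {1..} V" and E: "countable E"
    and unb: "\<And>K. \<exists>r>1. K < V r"
  shows "\<exists>r. growth_radius V E r \<and> K \<le> V r"
proof (rule ccontr)
  assume neg: "\<not> ?thesis"
  define K' where "K' = max 1 K"
  define P where "P = (\<lambda>r. 1 \<le> r \<and> r \<notin> E \<and> K' \<le> V r)"
  have step: "\<exists>r'. P r' \<and> r < r' \<and> r' < r + r / V r \<and> 2 * V r < V r'" if r: "P r" for r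
  proof -
    have "\<not> growth_radius V E r" using neg r by (auto simp: P_def K'_def)
    then obtain \<rho> where \<rho>: "r < \<rho>" "\<rho> < r + r / V r" "2 * V r < V \<rho>"
      using r by (auto simp: growth_radius_def P_def K'_def)
    obtain r' where r': "r < r'" "r' < r + r / V r" "r' \<notin> E" "2 * V r < V r'"
      using good_radius_near[OF cont E _ \<rho>] r unfolding P_def by blast
    thus ?thesis using r by (intro exI[of _ r']) (auto simp: P_def K'_def)
  qed
  obtain r1 where "1 < r1" "K' < V r1" using unb by blast
  then obtain r0 where r0: "P r0"
    using good_radius_near[OF cont E, of 1 r1 "r1 + 1" K'] unfolding P_def by (metis less_add_one less_eq_real_def order_refl)
  \<comment> \<open>\<open>V (s n) \<ge> 2 ^ n\<close>, so the relative increments of \<open>s\<close> are at most \<open>1 / 2 ^ n\<close> and \<open>s\<close> stays below \<open>r0 * exp 2\<close>.\<close>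
  define s where "s = rec_nat r0 (\<lambda>_ r. SOME r'. P r' \<and> r < r' \<and> r' < r + r / V r \<and> 2 * V r < V r')"
  have s0: "s 0 = r0" by (simp add: s_def)
  have sS: "s (Suc n) = (SOME r'. P r' \<and> s n < r' \<and> r' < s n + s n / V (s n) \<and> 2 * V (s n) < V r')" for n
    by (simp add: s_def)
  have Ps: "P (s n)" for n
  proof (induction n)
    case (Suc n)
    show ?case using someI_ex[OF step[OF Suc]] unfolding sS by blast
  qed (simp add: s0 r0)
  have ss: "s n < s (Suc n)" "s (Suc n) < s n + s n / V (s n)" "2 * V (s n) < V (s (Suc n))" for n
    using someI_ex[OF step[OF Ps[of n]]] unfolding sS by blast+
  have Vs: "2 ^ n \<le> V (s n)" for n
  proof (induction n)
    case 0 thus ?case using r0 by (simp add: s0 P_def K'_def)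
  next
    case (Suc n) thus ?case using ss(3)[of n] by simp
  qed
  have bound: "s n \<le> r0 * exp (2 - 2 / 2 ^ n)" for n
  proof (induction n)
    case 0 thus ?case by (simp add: s0)
  next
    case (Suc n)
    have pos: "0 < s n" using Ps[of n] by (simp add: P_def)
    have "s (Suc n) \<le> s n + s n / 2 ^ n"
      using ss(2)[of n] divide_left_mono[OF Vs[of n], of "s n"] pos Vs[of n]
      by (smt (verit) mult_pos_pos zero_less_power)
    also have "\<dots> = s n * (1 + 1 / 2 ^ n)" by (simp add: algebra_simps)
    also have "\<dots> \<le> s n * exp (1 / 2 ^ n)" using pos by (intro mult_left_mono exp_ge_add_one_self) auto
    also have "\<dots> \<le> r0 * exp (2 - 2 / 2 ^ n) * exp (1 / 2 ^ n)" by (intro mult_right_mono Suc) auto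
    also have "\<dots> = r0 * exp (2 - 2 / 2 ^ Suc n)" by (simp add: exp_add[symmetric] field_simps)
    finally show ?case .
  qed
  have r0': "1 \<le> r0" using r0 by (simp add: P_def)
  have le: "s n \<le> r0 * exp 2" for n
  proof -
    have "r0 * exp (2 - 2 / 2 ^ n) \<le> r0 * exp 2" using r0' by (intro mult_left_mono) auto
    thus ?thesis using bound[of n] by linarith
  qed
  have "compact (V ` {1..r0 * exp 2})"
    by (intro compact_continuous_image continuous_on_subset[OF cont]) auto
  hence "bdd_above (V ` {1..r0 * exp 2})" by (intro bounded_imp_bdd_above compact_imp_bounded)
  then obtain M where M: "\<And>x. x \<in> {1..r0 * exp 2} \<Longrightarrow> V x \<le> M" by (metis bdd_above.E imageI)
  obtain n where n: "M < 2 ^ n" using real_arch_pow[of 2 M] by auto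
  have "V (s n) \<le> M" by (rule M) (use le[of n] Ps[of n] in \<open>auto simp: P_def\<close>)
  thus False using Vs[of n] n by linarith
qed

lemma growth_contradiction:
  assumes cont: "continuous_on {1..} V" and E: "countable E"
    and unb: "\<And>K. \<exists>r>1. K < V r"
    and bd: "\<And>r. growth_radius V E r \<Longrightarrow> V r \<le> C * (1 + ln (V r))"
  shows False
proof -
  obtain r where r: "growth_radius V E r" "9 * C^2 + 1 \<le> V r"
    using exists_growth_radius[OF cont E unb] by blast
  define v where "v = sqrt (V r)"
  have V1: "1 \<le> V r" using r by (simp add: growth_radius_def)
  have v: "1 \<le> v" "V r = v^2" using V1 by (auto simp: v_def)
  have "ln (V r) = 2 * ln v" using v by (simp add: ln_realpow)
  also have "\<dots> \<le> 2 * v" using v ln_le_minus_one[of v] by simp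
  finally have l: "1 + ln (V r) \<le> 3 * v" using v by linarith
  have l0: "0 \<le> 1 + ln (V r)" using V1 by simp
  have "v^2 \<le> C * (1 + ln (V r))" using bd[OF r(1)] v by simp
  also have "\<dots> \<le> \<bar>C\<bar> * (1 + ln (V r))" using l0 by (intro mult_right_mono) auto
  also have "\<dots> \<le> \<bar>C\<bar> * (3 * v)" using l by (intro mult_left_mono) auto
  finally have "v * v \<le> (3 * \<bar>C\<bar>) * v" by (simp add: power2_eq_square mult_ac)
  hence "v \<le> 3 * \<bar>C\<bar>" using v by (simp add: mult_le_cancel_right)
  hence "v^2 \<le> (3 * \<bar>C\<bar>)^2" using v by (intro power_mono) auto
  hence "v^2 \<le> 9 * C^2" by (simp add: power_mult_distrib)
  thus False using r(2) v by simp
qed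

text \<open>
  At a growth radius of \<open>V\<close>, the errors in the logarithmic derivative lemma are logarithmic in \<open>V\<close>. The
  conclusion covers a whole interval of radii \<open>\<rho>\<close>, which allows the lemma to be applied twice in
  succession, as is needed when \<open>A\<close> and \<open>B\<close> contain derivatives themselves.
\<close>
lemma logderiv_growth:
  assumes A: "entire_nz A" and B: "entire_nz B" and E: "countable E" "zradii A \<subseteq> E" "zradii B \<subseteq> E"
    and \<theta>: "0 < \<theta>" "\<theta> < \<theta>'" "\<theta>' \<le> 1"
    and bd: "\<And>r \<rho>. growth_radius V E r \<Longrightarrow> r < \<rho> \<Longrightarrow> \<rho> < r + \<theta>' * r / V r \<Longrightarrow> \<rho> \<notin> E \<Longrightarrow>
       cmean \<rho> (\<lambda>z. ln (norm (A z) + norm (B z))) \<le> c * V r"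
  shows "\<exists>C\<ge>0. \<forall>r \<rho>. growth_radius V E r \<longrightarrow> r \<le> \<rho> \<longrightarrow> \<rho> < r + \<theta> * r / V r \<longrightarrow> \<rho> \<notin> E \<longrightarrow>
     cmean \<rho> (\<lambda>z. lnp (norm (deriv A z / A z - deriv B z / B z))) \<le> C * (1 + ln (V r))"
proof -
  obtain C where C: "0 \<le> C" "\<And>r R U. 1 \<le> r \<Longrightarrow> r < R \<Longrightarrow> r \<notin> E \<Longrightarrow> 1 \<le> U \<Longrightarrow>
     (\<And>\<rho>. r < \<rho> \<Longrightarrow> \<rho> < R \<Longrightarrow> \<rho> \<notin> E \<Longrightarrow> cmean \<rho> (\<lambda>z. ln (norm (A z) + norm (B z))) \<le> U) \<Longrightarrow>
     cmean r (\<lambda>z. lnp (norm (deriv A z / A z - deriv B z / B z))) \<le> C * (1 + ln U + ln (R / (R - r)))"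
    using logarithmic_derivative[OF A B E] by blast
  define c' where "c' = max 1 c"
  define k where "k = 2 / (\<theta>' - \<theta>)"
  have k: "2 \<le> k" using \<theta> by (simp add: k_def field_simps)
  define C' where "C' = C * (2 + ln c' + ln k)"
  show ?thesis
  proof (rule exI[of _ C'], intro conjI allI impI)
    have c': "1 \<le> c'" "c \<le> c'" by (auto simp: c'_def)
    show "0 \<le> C'" unfolding C'_def using C(1) c' k by (intro mult_nonneg_nonneg add_nonneg_nonneg) auto
    fix r \<rho> assume r: "growth_radius V E r" "r \<le> \<rho>" "\<rho> < r + \<theta> * r / V r" "\<rho> \<notin> E"
    have V: "1 \<le> V r" "1 \<le> r" using r(1) by (auto simp: growth_radius_def)
    define R where "R = r + \<theta>' * r / V r"
    have gap: "(\<theta>' - \<theta>) * r / V r < R - \<rho>"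
      using r(3) by (simp add: R_def algebra_simps diff_divide_distrib)
    have gap0: "0 < (\<theta>' - \<theta>) * r / V r" using \<theta> V by simp
    have "\<theta>' * r / V r \<le> 1 * r / 1"
      using \<theta> V by (intro frac_le mult_right_mono) auto
    hence R2: "R \<le> 2 * r" by (simp add: R_def)
    have "R / (R - \<rho>) \<le> (2 * r) / ((\<theta>' - \<theta>) * r / V r)"
      using R2 gap gap0 V by (intro frac_le) auto
    also have "\<dots> = k * V r" using V \<theta> by (simp add: k_def field_simps)
    finally have q: "R / (R - \<rho>) \<le> k * V r" .
    have q0: "0 < R / (R - \<rho>)" using gap gap0 r(2) V by (intro divide_pos_pos) linarith+
    have cV: "1 \<le> c' * V r" using c' V mult_mono[of 1 c' 1 "V r"] by simp
    have "cmean \<rho> (\<lambda>z. lnp (norm (deriv A z / A z - deriv B z / B z))) \<le> C * (1 + ln (c' * V r) + ln (R / (R - \<rho>)))"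
    proof (rule C(2))
      fix \<rho>' assume \<rho>': "\<rho> < \<rho>'" "\<rho>' < R" "\<rho>' \<notin> E"
      have "cmean \<rho>' (\<lambda>z. ln (norm (A z) + norm (B z))) \<le> c * V r"
        by (rule bd[OF r(1)]) (use \<rho>' r(2) in \<open>auto simp: R_def\<close>)
      also have "\<dots> \<le> c' * V r" using c' V by (intro mult_right_mono) auto
      finally show "cmean \<rho>' (\<lambda>z. ln (norm (A z) + norm (B z))) \<le> c' * V r" .
    qed (use r V cV gap gap0 in auto)
    also have "\<dots> \<le> C * (1 + (ln c' + ln (V r)) + (ln k + ln (V r)))"
    proof (intro mult_left_mono add_mono C(1) order_refl)
      show "ln (c' * V r) \<le> ln c' + ln (V r)" using c' V by (simp add: ln_mult)
      have "ln (R / (R - \<rho>)) \<le> ln (k * V r)" using q q0 by (intro ln_mono)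
      thus "ln (R / (R - \<rho>)) \<le> ln k + ln (V r)" using k V by (simp add: ln_mult)
    qed
    also have "\<dots> \<le> C * ((2 + ln c' + ln k) * (1 + ln (V r)))"
    proof (intro mult_left_mono C(1))
      have "0 \<le> ln c' * ln (V r)" "0 \<le> ln k * ln (V r)" using c' k V by auto
      thus "1 + (ln c' + ln (V r)) + (ln k + ln (V r)) \<le> (2 + ln c' + ln k) * (1 + ln (V r))"
        by (simp add: algebra_simps)
    qed
    finally show "cmean \<rho> (\<lambda>z. lnp (norm (deriv A z / A z - deriv B z / B z))) \<le> C' * (1 + ln (V r))"
      by (simp add: C'_def mult_ac)
  qed
qed

lemma continuous_on_cmean:
  fixes u :: "complex \<Rightarrow> real"
  assumes "continuous_on UNIV u"
  shows "continuous_on S (\<lambda>r. cmean r u)"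
proof -
  have "continuous_on (S \<times> cbox 0 1) (\<lambda>(r, t). u (circlepath 0 r t))"
    unfolding circlepath_0 case_prod_beta
    by (intro continuous_on_compose2[OF assms]) (auto intro!: continuous_intros)
  from integral_continuous_on_param[OF this] show ?thesis by (simp add: cmean_def)
qed

section \<open>Pairs of meromorphic functions with a common denominator\<close>

definition wronskian :: "(complex \<Rightarrow> complex) \<Rightarrow> (complex \<Rightarrow> complex) \<Rightarrow> complex \<Rightarrow> complex" where
  "wronskian F G z = deriv F z * G z - F z * deriv G z"

lemma entire_has_deriv: "F holomorphic_on UNIV \<Longrightarrow> (F has_field_derivative deriv F z) (at z)"
  by (rule holomorphic_derivI[OF _ open_UNIV]) auto

lemma entire_deriv: "F holomorphic_on UNIV \<Longrightarrow> deriv F holomorphic_on UNIV"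
  by (rule holomorphic_deriv) auto

lemma entire_continuous: "F holomorphic_on UNIV \<Longrightarrow> continuous_on S F"
  by (rule holomorphic_on_imp_continuous_on[OF entire_on])

lemma wronskian_hol: "F holomorphic_on UNIV \<Longrightarrow> G holomorphic_on UNIV \<Longrightarrow> wronskian F G holomorphic_on UNIV"
  unfolding wronskian_def by (intro holomorphic_intros entire_deriv) auto

lemma wronskian_minus:
  assumes "F holomorphic_on UNIV" "G holomorphic_on UNIV"
  shows "wronskian (\<lambda>z. F z - c * G z) G = wronskian F G"
proof
  fix z
  have D: "deriv (\<lambda>z. F z - c * G z) z = deriv F z - c * deriv G z"
    by (rule DERIV_imp_deriv) (auto intro!: derivative_eq_intros entire_has_deriv assms)
  show "wronskian (\<lambda>z. F z - c * G z) G z = wronskian F G z"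
    by (simp only: wronskian_def D) (simp add: algebra_simps)
qed

lemma logderiv_diff_wronskian:
  "F z \<noteq> 0 \<Longrightarrow> G z \<noteq> 0 \<Longrightarrow> deriv F z / F z - deriv G z / G z = wronskian F G z / (F z * G z)"
  by (simp add: wronskian_def field_simps)

text \<open>
  The meromorphic functions \<open>f / d\<close> and \<open>g / d\<close>, in lowest terms. The conditions on the
  Wronskians say that both are nonconstant.
\<close>
locale entire_pair =
  fixes d f g :: "complex \<Rightarrow> complex"
  assumes d: "entire_nz d" and f: "f holomorphic_on UNIV" and g: "g holomorphic_on UNIV"
    and cop_f: "\<And>z. d z \<noteq> 0 \<or> f z \<noteq> 0" and cop_g: "\<And>z. d z \<noteq> 0 \<or> g z \<noteq> 0"
    and Wf: "entire_nz (wronskian f d)" and Wg: "entire_nz (wronskian g d)"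
begin

lemma d_hol: "d holomorphic_on UNIV" using d by auto

lemma swap_pair: "entire_pair d g f"
  by unfold_locales (use d f g cop_f cop_g Wf Wg in auto)

text \<open>
  The mean of the logarithm of \<open>norm (d z) + norm (f z)\<close> is the characteristic of \<open>f / d\<close> up to a bounded term (in
  the sense of Cartan); \<open>V\<close> is that of the curve \<open>(d : f : g)\<close> and dominates both.
\<close>
definition size :: "complex \<Rightarrow> real" where "size z = norm (d z) + norm (f z) + norm (g z)"
definition V :: "real \<Rightarrow> real" where "V r = cmean r (\<lambda>z. ln (size z))"
text \<open>
  Up to bounded factors this is the spherical derivative of \<open>F / d\<close>. It is finite at the
  poles as well, and so it bounds entire functions everywhere.
\<close>
definition sph :: "(complex \<Rightarrow> complex) \<Rightarrow> complex \<Rightarrow> real" where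
  "sph F z = norm (wronskian F d z) / (norm (d z) + norm (F z))^2"

lemma size_pos: "0 < size z"
proof (cases "d z = 0")
  case True
  hence "0 < norm (f z)" using cop_f[of z] by simp
  thus ?thesis by (simp add: size_def add_nonneg_pos add_pos_nonneg)
qed (simp add: size_def add_pos_nonneg)

lemma df_pos: "0 < norm (d z) + norm (f z)" and dg_pos: "0 < norm (d z) + norm (g z)"
  using cop_f[of z] cop_g[of z] by (auto intro: add_pos_nonneg add_nonneg_pos)

lemma cont_d: "continuous_on S d" and cont_f: "continuous_on S f" and cont_g: "continuous_on S g"
  using entire_continuous d_hol f g by auto

lemma cont_ln_size: "continuous_on S (\<lambda>z. ln (size z))"
proof -
  have "continuous_on S size" unfolding size_def by (intro continuous_intros cont_d cont_f cont_g)
  thus ?thesis by (intro continuous_intros) (use size_pos in \<open>auto simp: less_imp_neq[symmetric]\<close>)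
qed

lemma cont_ln_df: "continuous_on S (\<lambda>z. ln (norm (d z) + norm (f z)))"
  by (intro continuous_intros cont_d cont_f) (use df_pos in \<open>auto simp: less_imp_neq[symmetric]\<close>)

lemma V_cont: "continuous_on S V"
  unfolding V_def by (intro continuous_on_cmean cont_ln_size)

lemma f_lin_nz: "entire_nz (\<lambda>z. f z - \<tau> * d z)"
proof (rule ccontr)
  assume "\<not> ?thesis"
  moreover have "(\<lambda>z. f z - \<tau> * d z) holomorphic_on UNIV" by (intro holomorphic_intros f d_hol)
  ultimately have "(\<lambda>z. f z - \<tau> * d z) = (\<lambda>_. 0)" by (auto simp: entire_nz_def)
  hence "wronskian f d = wronskian (\<lambda>_. 0) d" using wronskian_minus[OF f d_hol, of \<tau>] by metis
  hence "wronskian f d z = 0" for z by (simp add: wronskian_def)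
  thus False using Wf by (auto simp: entire_nz_def)
qed

lemma norm_f_lin_le: "norm (f z - \<tau> * d z) \<le> (1 + norm \<tau>) * (norm (d z) + norm (f z))"
proof -
  have "norm (f z - \<tau> * d z) \<le> norm (f z) + norm \<tau> * norm (d z)"
    using norm_triangle_ineq4[of "f z" "\<tau> * d z"] by (simp add: norm_mult)
  also have "\<dots> \<le> (1 + norm \<tau>) * (norm (d z) + norm (f z))"
    by (simp add: algebra_simps mult_nonneg_nonneg)
  finally show ?thesis .
qed

lemma df_le_size: "norm (d z) + norm (f z) \<le> size z" and dg_le_size: "norm (d z) + norm (g z) \<le> size z"
  by (auto simp: size_def)

lemma lmean_le_V:
  assumes "A holomorphic_on UNIV" "B holomorphic_on UNIV" "\<And>z. norm (A z) + norm (B z) \<le> K * size z ^ k"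
    "0 < K" "0 \<le> r" "\<And>z. norm z = r \<Longrightarrow> A z \<noteq> 0 \<or> B z \<noteq> 0"
  shows "cmean r (\<lambda>z. ln (norm (A z) + norm (B z))) \<le> ln K + real k * V r"
proof -
  have "cmean r (\<lambda>z. ln (norm (A z) + norm (B z))) \<le> cmean r (\<lambda>z. ln K + real k * ln (size z))"
  proof (rule cmean_mono)
    fix z :: complex assume z: "norm z = r"
    have "0 < norm (A z) + norm (B z)" using assms(6)[OF z] by (auto intro: add_pos_nonneg add_nonneg_pos)
    hence "ln (norm (A z) + norm (B z)) \<le> ln (K * size z ^ k)" by (intro ln_mono assms(3))
    also have "\<dots> = ln K + real k * ln (size z)" using assms(4) size_pos[of z] by (simp add: ln_mult ln_realpow)
    finally show "ln (norm (A z) + norm (B z)) \<le> ln K + real k * ln (size z)" .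
  next
    show "continuous_on (sphere 0 r) (\<lambda>z. ln (norm (A z) + norm (B z)))"
      by (intro continuous_intros entire_continuous assms) (use assms(6) in \<open>auto simp: add_nonneg_eq_0_iff\<close>)
    show "continuous_on (sphere 0 r) (\<lambda>z. ln K + real k * ln (size z))"
      by (intro continuous_intros cont_ln_size)
  qed (use assms in auto)
  also have "\<dots> = ln K + real k * V r"
  proof -
    have "continuous_on (sphere 0 r) (\<lambda>z. real k * ln (size z))" by (intro continuous_on_mult continuous_on_const cont_ln_size)
    thus ?thesis using assms(5) by (simp add: cmean_add[OF continuous_on_const] cmean_cmult V_def)
  qed
  finally show ?thesis .
qed

text \<open>
  Some function \<open>f - \<tau> d\<close> has a zero, hence a mean that grows at least like \<open>ln r\<close>.
\<close>
lemma V_unbounded: "\<exists>r>1. K < V r"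
proof -
  obtain z0 where z0: "d z0 \<noteq> 0" using d by (auto simp: entire_nz_def)
  define \<tau> where "\<tau> = f z0 / d z0"
  let ?A = "\<lambda>z. f z - \<tau> * d z"
  have A: "entire_nz ?A" by (rule f_lin_nz)
  have Az0: "?A z0 = 0" using z0 by (simp add: \<tau>_def)
  obtain R0 where R0: "norm z0 + 1 < R0" "R0 < norm z0 + 2" "R0 \<notin> zradii ?A"
    using good_radius[OF countable_zradii[OF A], of "norm z0 + 1" "norm z0 + 2"] by auto
  obtain n :: nat and a G where fa: "entire_nz G" "\<forall>i<n. ?A (a i) = 0 \<and> norm (a i) \<le> R0"
    "\<forall>z. norm z \<le> R0 \<longrightarrow> G z \<noteq> 0" "\<forall>z. ?A z = (\<Prod>i<n. z - a i) * G z"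
    using entire_factor_zeros[OF A, of R0] by blast
  have n: "1 \<le> n"
  proof (rule ccontr)
    assume "\<not> 1 \<le> n"
    hence "n = 0" by simp
    hence "?A z0 = G z0" using fa(4)[rule_format, of z0] by simp
    thus False using Az0 fa(3)[rule_format, of z0] R0(1) by simp
  qed
  have lt: "norm (a i) < R0" if "i < n" for i
    using fa(2) R0(3) that by (force simp: zradii_def order_le_less)
  define L where "L = \<bar>lmean R0 ?A\<bar> + \<bar>ln R0\<bar> + ln (1 + norm \<tau>) + \<bar>K\<bar> + 1"
  obtain R where R: "max R0 (exp L) < R" "R < max R0 (exp L) + 1" "R \<notin> zradii ?A"
    using good_radius[OF countable_zradii[OF A], of "max R0 (exp L)" "max R0 (exp L) + 1"] by auto
  have R': "R0 < R" "exp L < R" using R by auto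
  have Rnn: "0 \<le> R" using R'(1) R0(1) norm_ge_zero[of z0] by linarith
  have "real n * (ln R - ln R0) \<le> lmean R ?A - lmean R0 ?A"
    by (rule zero_count_le[OF fa(4)[rule_format] fa(1) lt fa(3)[rule_format]])
       (use R0 R' zradii_notin[OF R(3)] in \<open>auto intro: order_le_less_trans[OF norm_ge_zero[of z0]]\<close>)
  moreover have "ln R - ln R0 \<le> real n * (ln R - ln R0)"
  proof -
    have "ln R0 \<le> ln R" using R' R0(1) norm_ge_zero[of z0] by (intro ln_mono) linarith+
    thus ?thesis using n mult_right_mono[of 1 "real n" "ln R - ln R0"] by simp
  qed
  moreover have "L < ln R" using R'(2) by (metis exp_gt_zero exp_less_cancel_iff exp_ln order_less_trans)
  moreover have "lmean R ?A \<le> ln (1 + norm \<tau>) + real 1 * V R"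
  proof -
    have "cmean R (\<lambda>z. ln (norm (?A z) + norm ((\<lambda>_. 0 :: complex) z))) \<le> ln (1 + norm \<tau>) + real 1 * V R"
    proof (rule lmean_le_V)
      fix z
      have "norm (?A z) \<le> (1 + norm \<tau>) * (norm (d z) + norm (f z))" by (rule norm_f_lin_le)
      also have "\<dots> \<le> (1 + norm \<tau>) * size z" by (intro mult_left_mono df_le_size) auto
      finally show "norm (?A z) + norm (0 :: complex) \<le> (1 + norm \<tau>) * size z ^ 1" by simp
    qed (use A Rnn zradii_notin[OF R(3)] in \<open>auto simp: add_pos_nonneg\<close>)
    thus ?thesis by simp
  qed
  ultimately have "K < V R" unfolding L_def by linarith
  moreover have "1 < R" using R'(1) R0(1) norm_ge_zero[of z0] by linarith
  ultimately show ?thesis by blast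
qed

abbreviation growth :: "real set \<Rightarrow> real \<Rightarrow> bool" where "growth \<equiv> growth_radius V"

lemma no_slow_growth:
  assumes "countable E" "\<And>r. growth E r \<Longrightarrow> V r \<le> C * (1 + ln (V r))"
  shows False
  using growth_contradiction[OF V_cont assms(1) V_unbounded assms(2)] .

lemma logderiv_small:
  assumes A: "entire_nz A" and B: "entire_nz B" and E: "countable E" "zradii A \<subseteq> E" "zradii B \<subseteq> E"
    and bd: "\<And>z. norm (A z) + norm (B z) \<le> K * size z ^ k" "0 < K"
  shows "\<exists>C\<ge>0. \<forall>r \<rho>. growth E r \<longrightarrow> r \<le> \<rho> \<longrightarrow> \<rho> < r + 1/2 * r / V r \<longrightarrow> \<rho> \<notin> E \<longrightarrow>
     cmean \<rho> (\<lambda>z. lnp (norm (deriv A z / A z - deriv B z / B z))) \<le> C * (1 + ln (V r))"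
proof -
  have bd': "cmean \<rho> (\<lambda>z. ln (norm (A z) + norm (B z))) \<le> (\<bar>ln K\<bar> + 2 * real k) * V r"
    if r: "growth E r" "r < \<rho>" "\<rho> < r + 1 * r / V r" "\<rho> \<notin> E" for r \<rho>
  proof -
    have V: "1 \<le> V r" "1 \<le> r" "V \<rho> \<le> 2 * V r" using r by (auto simp: growth_radius_def)
    have "cmean \<rho> (\<lambda>z. ln (norm (A z) + norm (B z))) \<le> ln K + real k * V \<rho>"
      by (rule lmean_le_V) (use A B bd r V E zradii_notin[of \<rho> A] in auto)
    also have "\<dots> \<le> \<bar>ln K\<bar> * V r + real k * (2 * V r)"
    proof (intro add_mono mult_left_mono V)
      have "ln K \<le> \<bar>ln K\<bar> * 1" by simp
      also have "\<dots> \<le> \<bar>ln K\<bar> * V r" using V by (intro mult_left_mono) auto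
      finally show "ln K \<le> \<bar>ln K\<bar> * V r" .
    qed auto
    finally show ?thesis by (simp add: algebra_simps)
  qed
  show ?thesis
    by (rule logderiv_growth[OF A B E, of "1/2" 1 V "\<bar>ln K\<bar> + 2 * real k"]) (use bd' in auto)
qed

text \<open>
  Any representation \<open>X1 / X0\<close> of \<open>f / d\<close> by entire functions arises from \<open>(f, d)\<close> by multiplication
  with an entire function, whose logarithmic mean is bounded below. So \<open>(f, d)\<close>, being in lowest
  terms, gives the smallest characteristic.
\<close>
lemma characteristic_quotient_le:
  assumes X0: "entire_nz X0" and X1: "X1 holomorphic_on UNIV" and eq: "\<And>z. X0 z * f z = X1 z * d z"
    and E: "zradii X0 \<subseteq> E"
  shows "\<exists>C. \<forall>r\<ge>1. r \<notin> E \<longrightarrow> cmean r (\<lambda>z. ln (norm (d z) + norm (f z))) \<le> cmean r (\<lambda>z. ln (norm (X0 z) + norm (X1 z))) + C"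
proof -
  obtain \<xi> where c: "\<xi> holomorphic_on UNIV" "\<And>z. X0 z = \<xi> z * d z"
    using entire_divide_coprime[OF d entire_nzD[OF X0] f X1, of ] eq cop_f by (metis mult.commute)
  have X1eq: "X1 z = \<xi> z * f z" for z
  proof -
    have "X1 = (\<lambda>z. \<xi> z * f z)"
    proof (rule entire_eq_offI[OF d X1])
      fix w assume "d w \<noteq> 0"
      thus "X1 w = \<xi> w * f w" using eq[of w] c(2)[of w] by simp
    qed (intro holomorphic_intros c f)
    thus ?thesis by (rule fun_cong)
  qed
  have cnz: "entire_nz \<xi>" using X0 c unfolding entire_nz_def by auto
  obtain C where C: "0 \<le> C" "\<And>r. 1 \<le> r \<Longrightarrow> r \<notin> zradii \<xi> \<Longrightarrow> - C \<le> lmean r \<xi>"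
    using lmean_lower_bound[OF cnz] by blast
  show ?thesis
  proof (rule exI[of _ C], intro allI impI)
    fix r :: real assume r: "1 \<le> r" "r \<notin> E"
    have nz: "\<xi> z \<noteq> 0" if "norm z = r" for z
      using zradii_notin[of r X0 z] that r E c(2)[of z] by auto
    have "r \<notin> zradii \<xi>" using nz by (auto simp: zradii_def)
    hence low: "- C \<le> lmean r \<xi>" using C r by blast
    have "cmean r (\<lambda>z. ln (norm (X0 z) + norm (X1 z))) = cmean r (\<lambda>z. ln (norm (\<xi> z)) + ln (norm (d z) + norm (f z)))"
    proof (rule cmean_cong)
      fix z :: complex assume z: "norm z = r"
      have "norm (X0 z) + norm (X1 z) = norm (\<xi> z) * (norm (d z) + norm (f z))"
        by (simp add: c X1eq norm_mult algebra_simps)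
      thus "ln (norm (X0 z) + norm (X1 z)) = ln (norm (\<xi> z)) + ln (norm (d z) + norm (f z))"
        using nz[OF z] df_pos[of z] by (simp add: ln_mult)
    qed (use r in auto)
    also have "\<dots> = lmean r \<xi> + cmean r (\<lambda>z. ln (norm (d z) + norm (f z)))"
      by (rule cmean_add) (use r nz c cont_ln_df in \<open>auto intro!: continuous_on_ln_norm\<close>)
    finally show "cmean r (\<lambda>z. ln (norm (d z) + norm (f z))) \<le> cmean r (\<lambda>z. ln (norm (X0 z) + norm (X1 z))) + C"
      using low by linarith
  qed
qed

lemma sph_continuous: "continuous_on S (sph f)"
  unfolding sph_def
  by (intro continuous_intros cont_d cont_f entire_continuous wronskian_hol f d_hol)
     (use df_pos in \<open>auto simp: less_imp_neq[symmetric]\<close>)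

text \<open>
  The spherical derivative is at most the logarithmic derivative of \<open>f / d\<close>, since
  \<open>norm (f z) * norm (d z) \<le> (norm (d z) + norm (f z))^2\<close>.
\<close>
lemma sph_le_logderiv:
  assumes "f z \<noteq> 0" "d z \<noteq> 0"
  shows "sph f z \<le> norm (deriv f z / f z - deriv d z / d z)"
proof -
  have "norm (f z) * norm (d z) \<le> (norm (d z) + norm (f z))^2"
    by (simp add: power2_eq_square algebra_simps)
  hence "sph f z \<le> norm (wronskian f d z) / (norm (f z) * norm (d z))"
    unfolding sph_def using assms df_pos[of z] by (intro divide_left_mono) auto
  thus ?thesis using logderiv_diff_wronskian[of f z d] assms by (simp add: norm_divide norm_mult)
qed

text \<open>
  Together with the logarithmic derivative lemma, a pointwise bound by spherical derivatives makes an
  entire function negligible against \<open>V\<close>.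
\<close>
lemma small_of_spherical_bound:
  assumes X: "X holomorphic_on UNIV" and E: "countable E" "zradii f \<subseteq> E" "zradii g \<subseteq> E" "zradii d \<subseteq> E"
    and bd: "\<And>z. norm z \<notin> E \<Longrightarrow> norm (X z) \<le> K * (sph f z + sph g z)" "0 \<le> K"
  shows "\<exists>C. \<forall>r. growth E r \<longrightarrow> cmean r (\<lambda>z. lnp (norm (X z))) \<le> C * (1 + ln (V r))"
proof -
  interpret sw: entire_pair d g f by (rule swap_pair)
  have f': "entire_nz f" using f_lin_nz[of 0] by simp
  have g': "entire_nz g" using sw.f_lin_nz[of 0] by simp
  have b1: "norm (f z) + norm (d z) \<le> 1 * size z ^ 1" "norm (g z) + norm (d z) \<le> 1 * size z ^ 1" for z
    by (auto simp: size_def)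
  obtain C1 where C1: "C1 \<ge> 0" "\<forall>r \<rho>. growth E r \<longrightarrow> r \<le> \<rho> \<longrightarrow> \<rho> < r + 1/2 * r / V r \<longrightarrow> \<rho> \<notin> E \<longrightarrow>
     cmean \<rho> (\<lambda>z. lnp (norm (deriv f z / f z - deriv d z / d z))) \<le> C1 * (1 + ln (V r))"
    using logderiv_small[OF f' d E(1,2,4) b1(1)] by auto
  obtain C2 where C2: "C2 \<ge> 0" "\<forall>r \<rho>. growth E r \<longrightarrow> r \<le> \<rho> \<longrightarrow> \<rho> < r + 1/2 * r / V r \<longrightarrow> \<rho> \<notin> E \<longrightarrow>
     cmean \<rho> (\<lambda>z. lnp (norm (deriv g z / g z - deriv d z / d z))) \<le> C2 * (1 + ln (V r))"
    using logderiv_small[OF g' d E(1,3,4) b1(2)] by auto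
  show ?thesis
  proof (rule exI[of _ "lnp K + ln 2 + C1 + C2"], intro allI impI)
    fix r assume r: "growth E r"
    have r1: "1 \<le> r" "r \<notin> E" "1 \<le> V r" using r by (auto simp: growth_radius_def)
    let ?F = "\<lambda>z. norm (deriv f z / f z - deriv d z / d z)" and ?G = "\<lambda>z. norm (deriv g z / g z - deriv d z / d z)"
    have nz: "f z \<noteq> 0" "g z \<noteq> 0" "d z \<noteq> 0" if "norm z = r" for z
      using that r1 E by (auto simp: zradii_def)
    have cF: "continuous_on (sphere 0 r) (\<lambda>z. lnp (?F z))" and cG: "continuous_on (sphere 0 r) (\<lambda>z. lnp (?G z))"
      by (intro continuous_intros cont_d cont_f cont_g entire_continuous entire_deriv f g d_hol; use nz in force)+
    have "cmean r (\<lambda>z. lnp (norm (X z))) \<le> cmean r (\<lambda>z. (lnp K + ln 2) + (lnp (?F z) + lnp (?G z)))"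
    proof (rule cmean_mono)
      fix z :: complex assume z: "norm z = r"
      have "norm (X z) \<le> K * (sph f z + sph g z)" using bd(1) z r1 by auto
      also have "\<dots> \<le> K * (?F z + ?G z)"
        using sph_le_logderiv[of z] sw.sph_le_logderiv[of z] nz[OF z] bd(2) by (intro mult_left_mono add_mono) (auto simp: sph_def sw.sph_def)
      finally have "lnp (norm (X z)) \<le> lnp (K * (?F z + ?G z))" by (rule lnp_mono)
      also have "\<dots> \<le> lnp K + lnp (?F z + ?G z)" using bd(2) by (intro lnp_mult) auto
      also have "lnp (?F z + ?G z) \<le> lnp (?F z) + lnp (?G z) + ln 2" by (intro lnp_add) auto
      finally show "lnp (norm (X z)) \<le> (lnp K + ln 2) + (lnp (?F z) + lnp (?G z))" by simp
    next
      show "continuous_on (sphere 0 r) (\<lambda>z. lnp (norm (X z)))"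
        by (intro continuous_intros entire_continuous X)
      show "continuous_on (sphere 0 r) (\<lambda>z. (lnp K + ln 2) + (lnp (?F z) + lnp (?G z)))"
        by (intro continuous_on_add continuous_on_const cF cG)
    qed (use r1 in auto)
    also have "\<dots> = (lnp K + ln 2) + (cmean r (\<lambda>z. lnp (?F z)) + cmean r (\<lambda>z. lnp (?G z)))"
    proof -
      have r0: "0 \<le> r" using r1 by simp
      show ?thesis by (simp only: cmean_add[OF continuous_on_const continuous_on_add[OF cF cG] r0] cmean_add[OF cF cG r0] cmean_const)
    qed
    also have "\<dots> \<le> (lnp K + ln 2) + (C1 * (1 + ln (V r)) + C2 * (1 + ln (V r)))"
    proof -
      have "r < r + 1/2 * r / V r" using r1 by simp
      hence "cmean r (\<lambda>z. lnp (?F z)) \<le> C1 * (1 + ln (V r))" "cmean r (\<lambda>z. lnp (?G z)) \<le> C2 * (1 + ln (V r))"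
        using C1(2) C2(2) r r1 by blast+
      thus ?thesis by linarith
    qed
    also have "\<dots> \<le> (lnp K + ln 2) * (1 + ln (V r)) + (C1 * (1 + ln (V r)) + C2 * (1 + ln (V r)))"
    proof -
      have "0 \<le> (lnp K + ln 2) * ln (V r)" using r1 by (intro mult_nonneg_nonneg add_nonneg_nonneg) auto
      thus ?thesis by (simp add: algebra_simps)
    qed
    finally show "cmean r (\<lambda>z. lnp (norm (X z))) \<le> (lnp K + ln 2 + C1 + C2) * (1 + ln (V r))"
      by (simp add: algebra_simps)
  qed
qed

end

section \<open>Polynomials with exactly two critical points\<close>

lemma norm_diff_lower:
  fixes z \<tau> :: complex
  assumes "0 < \<delta>" "\<delta> \<le> norm (z - \<tau>)"
  shows "\<delta> / (1 + norm \<tau> + \<delta>) * (1 + norm z) \<le> norm (z - \<tau>)"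
proof -
  have "norm z \<le> norm \<tau> + norm (z - \<tau>)" using norm_triangle_ineq[of \<tau> "z - \<tau>"] by simp
  hence "\<delta> * (1 + norm z) \<le> \<delta> * (1 + norm \<tau> + norm (z - \<tau>))" using assms by (intro mult_left_mono) auto
  also have "\<dots> \<le> norm (z - \<tau>) * (1 + norm \<tau>) + \<delta> * norm (z - \<tau>)"
    using mult_right_mono[OF assms(2), of "1 + norm \<tau>"] by (simp add: algebra_simps)
  also have "\<dots> = norm (z - \<tau>) * (1 + norm \<tau> + \<delta>)" by (simp add: algebra_simps)
  finally show ?thesis using assms(1) by (simp add: field_simps add_pos_nonneg)
qed

lemma norm_diff_upper:
  fixes z \<tau> :: complex
  shows "norm (z - \<tau>) \<le> (1 + norm \<tau>) * (1 + norm z)"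
proof -
  have "0 \<le> norm \<tau> * norm z" by simp
  thus ?thesis using norm_triangle_ineq4[of z \<tau>] by (simp add: algebra_simps del: mult_nonneg_nonneg)
qed

lemma poly_upper: "\<exists>K\<ge>0. \<forall>z. norm (poly p (z::complex)) \<le> K * (1 + norm z) ^ degree p"
proof (rule exI[of _ "\<Sum>i\<le>degree p. norm (coeff p i)"], intro conjI allI sum_nonneg norm_ge_zero)
  fix z :: complex
  have "norm (poly p z) \<le> (\<Sum>i\<le>degree p. norm (coeff p i) * norm z ^ i)"
    unfolding poly_altdef by (rule order_trans[OF norm_sum]) (simp add: norm_mult norm_power)
  also have "\<dots> \<le> (\<Sum>i\<le>degree p. norm (coeff p i) * (1 + norm z) ^ degree p)"
  proof (intro sum_mono mult_left_mono)
    fix i assume "i \<in> {..degree p}"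
    have "norm z ^ i \<le> (1 + norm z) ^ i" by (intro power_mono) auto
    also have "\<dots> \<le> (1 + norm z) ^ degree p" using \<open>i \<in> _\<close> by (intro power_increasing) auto
    finally show "norm z ^ i \<le> (1 + norm z) ^ degree p" .
  qed auto
  finally show "norm (poly p z) \<le> (\<Sum>i\<le>degree p. norm (coeff p i)) * (1 + norm z) ^ degree p"
    by (simp add: sum_distrib_right)
qed

lemma prod_far_lower:
  fixes S :: "complex set"
  assumes "finite S" "0 < \<delta>"
  shows "\<exists>c>0. \<forall>z. (\<forall>\<tau>\<in>S. \<delta> \<le> norm (z - \<tau>)) \<longrightarrow> c * (1 + norm z) ^ card S \<le> (\<Prod>\<tau>\<in>S. norm (z - \<tau>))"
proof (rule exI[of _ "\<Prod>\<tau>\<in>S. \<delta> / (1 + norm \<tau> + \<delta>)"], intro conjI allI impI)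
  show "0 < (\<Prod>\<tau>\<in>S. \<delta> / (1 + norm \<tau> + \<delta>))"
    using assms(2) by (intro prod_pos) (auto intro!: divide_pos_pos add_pos_nonneg add_nonneg_pos)
  fix z assume z: "\<forall>\<tau>\<in>S. \<delta> \<le> norm (z - \<tau>)"
  have "(\<Prod>\<tau>\<in>S. \<delta> / (1 + norm \<tau> + \<delta>)) * (1 + norm z) ^ card S = (\<Prod>\<tau>\<in>S. \<delta> / (1 + norm \<tau> + \<delta>) * (1 + norm z))"
    by (simp only: prod.distrib prod_constant)
  also have "\<dots> \<le> (\<Prod>\<tau>\<in>S. norm (z - \<tau>))"
    using assms z by (intro prod_mono conjI norm_diff_lower) (auto intro!: mult_nonneg_nonneg divide_nonneg_nonneg add_nonneg_nonneg)
  finally show "(\<Prod>\<tau>\<in>S. \<delta> / (1 + norm \<tau> + \<delta>)) * (1 + norm z) ^ card S \<le> (\<Prod>\<tau>\<in>S. norm (z - \<tau>))" .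
qed

text \<open>
  A polynomial with only two critical points, at neither of which it vanishes; its zeros are
  therefore simple.
\<close>
locale crit_poly =
  fixes p :: "complex poly" and m n :: nat and a b :: complex
  assumes pderiv_p: "pderiv p = [:-a, 1:] ^ n * [:-b, 1:] ^ m"
    and ab: "a \<noteq> b" and m1: "2 \<le> m" and n1: "2 \<le> n"
    and pa: "poly p a \<noteq> 0" and pb: "poly p b \<noteq> 0"
begin

abbreviation "P \<equiv> poly p"
abbreviation "q \<equiv> m + n + 1"

lemma swap_crit: "crit_poly p n m b a"
  by unfold_locales (use pderiv_p ab m1 n1 pa pb in \<open>auto simp: mult_ac\<close>)

lemma degree_p: "degree p = q"
proof -
  have "degree (pderiv p) = n + m"
    unfolding pderiv_p by (subst degree_mult_eq) (auto simp: degree_power_eq)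
  moreover have "degree p \<noteq> 0"
  proof
    assume "degree p = 0"
    hence "pderiv p = 0" by (simp add: pderiv_eq_0_iff)
    thus False unfolding pderiv_p by simp
  qed
  ultimately show ?thesis by (simp add: degree_pderiv)
qed

lemma p_nz: "p \<noteq> 0" using degree_p by auto

lemma poly_pderiv_p: "poly (pderiv p) z = (z - a) ^ n * (z - b) ^ m"
  by (simp add: pderiv_p algebra_simps)

definition roots :: "complex set" where "roots = {z. P z = 0}"

lemma finite_roots: "finite roots" unfolding roots_def using poly_roots_finite[OF p_nz] by simp

lemma a_notin_roots: "a \<notin> roots" "b \<notin> roots" using pa pb by (auto simp: roots_def)

lemma rsquarefree_p: "rsquarefree p"
  unfolding rsquarefree_roots using poly_pderiv_p pa pb p_nz by auto

lemma P_factor: "P z = lead_coeff p * (\<Prod>\<tau>\<in>roots. z - \<tau>)"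
proof -
  from complex_poly_decompose_rsquarefree[OF rsquarefree_p]
  have "poly (smult (lead_coeff p) (\<Prod>z | poly p z = 0. [:-z, 1:])) z = P z" by simp
  thus ?thesis by (simp add: roots_def poly_prod)
qed

lemma card_roots: "card roots = q"
proof -
  have "degree (smult (lead_coeff p) (\<Prod>\<tau>\<in>roots. [:-\<tau>, 1:])) = q"
    using complex_poly_decompose_rsquarefree[OF rsquarefree_p] degree_p by (simp add: roots_def)
  moreover have "degree (\<Prod>\<tau>\<in>roots. [:-\<tau>, 1:]) = card roots"
    by (subst degree_prod_sum_eq) auto
  ultimately show ?thesis using p_nz by simp
qed

lemma P_growth_lower: "\<exists>K\<ge>0. \<forall>z. (1 + norm z) ^ q \<le> K * (1 + norm (P z))"
proof -
  obtain c where c: "0 < c" "\<And>z. (\<forall>\<tau>\<in>roots. 1 \<le> norm (z - \<tau>)) \<Longrightarrow> c * (1 + norm z) ^ card roots \<le> (\<Prod>\<tau>\<in>roots. norm (z - \<tau>))"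
    using prod_far_lower[OF finite_roots zero_less_one] by blast
  define M where "M = 2 + (\<Sum>\<tau>\<in>roots. norm \<tau>)"
  define l where "l = norm (lead_coeff p)"
  have l: "0 < l" using p_nz by (simp add: l_def)
  have M0: "0 \<le> M" by (simp add: M_def sum_nonneg add_nonneg_nonneg)
  show ?thesis
  proof (rule exI[of _ "M ^ q + 1 / (c * l)"], intro conjI allI)
    show "0 \<le> M ^ q + 1 / (c * l)" using M0 c l by simp
    fix z
    show "(1 + norm z) ^ q \<le> (M ^ q + 1 / (c * l)) * (1 + norm (P z))"
    proof (cases "\<forall>\<tau>\<in>roots. 1 \<le> norm (z - \<tau>)")
      case True
      have "l * (c * (1 + norm z) ^ q) \<le> l * (\<Prod>\<tau>\<in>roots. norm (z - \<tau>))"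
        using c(2)[OF True] card_roots l by (intro mult_left_mono) auto
      also have "\<dots> = norm (P z)" by (simp add: P_factor norm_mult l_def prod_norm)
      finally have "(1 + norm z) ^ q \<le> 1 / (c * l) * norm (P z)" using c l by (simp add: field_simps)
      also have "\<dots> \<le> (M ^ q + 1 / (c * l)) * (1 + norm (P z))"
        using M0 c l by (intro mult_mono) auto
      finally show ?thesis .
    next
      case False
      then obtain \<tau> where \<tau>: "\<tau> \<in> roots" "norm (z - \<tau>) < 1" by force
      have "norm z \<le> norm \<tau> + 1" using norm_triangle_ineq[of \<tau> "z - \<tau>"] \<tau> by simp
      moreover have "norm \<tau> \<le> (\<Sum>\<tau>\<in>roots. norm \<tau>)"
        using \<tau>(1) finite_roots by (intro member_le_sum) auto
      ultimately have "1 + norm z \<le> M" by (simp add: M_def)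
      hence "(1 + norm z) ^ q \<le> M ^ q" by (intro power_mono) auto
      also have "\<dots> = M ^ q * 1" by simp
      also have "\<dots> \<le> (M ^ q + 1 / (c * l)) * (1 + norm (P z))"
        using M0 c l by (intro mult_mono) auto
      finally show ?thesis .
    qed
  qed
qed

text \<open>
  Near infinity, \<open>norm (P z)\<close> is comparable to \<open>norm z ^ q\<close>, so \<open>x\<close> cannot be much larger than \<open>y\<close>.
\<close>
lemma comparable_of_scaled_values: "\<exists>L\<ge>1. \<forall>x y. P x = A * P y \<longrightarrow> 1 + norm x \<le> L * (1 + norm y)"
proof -
  obtain K1 where K1: "0 \<le> K1" "\<And>z. norm (P z) \<le> K1 * (1 + norm z) ^ q"
    using poly_upper[of p] degree_p by auto
  obtain K2 where K2: "0 \<le> K2" "\<And>z. (1 + norm z) ^ q \<le> K2 * (1 + norm (P z))"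
    using P_growth_lower by auto
  define L where "L = max 1 (K2 * (1 + norm A * K1))"
  have L: "1 \<le> L" by (simp add: L_def)
  have "1 + norm x \<le> L * (1 + norm y)" if "P x = A * P y" for x y
  proof -
    have Y: "1 \<le> (1 + norm y) ^ q" by (intro one_le_power) simp
    have "(1 + norm x) ^ q \<le> K2 * (1 + norm A * norm (P y))" using K2(2)[of x] that by (simp add: norm_mult)
    also have "\<dots> \<le> K2 * ((1 + norm y) ^ q + norm A * (K1 * (1 + norm y) ^ q))"
      using K1(2)[of y] K2(1) Y by (intro mult_left_mono add_mono) auto
    also have "\<dots> = (K2 * (1 + norm A * K1)) * (1 + norm y) ^ q" by (simp add: algebra_simps)
    also have "\<dots> \<le> L ^ q * (1 + norm y) ^ q"
    proof (intro mult_right_mono)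
      have "K2 * (1 + norm A * K1) \<le> L" by (simp add: L_def)
      also have "\<dots> \<le> L ^ q" using L by (intro self_le_power) auto
      finally show "K2 * (1 + norm A * K1) \<le> L ^ q" .
    qed auto
    also have "\<dots> = (L * (1 + norm y)) ^ q" by (simp add: power_mult_distrib)
    finally have "(1 + norm x) ^ Suc (m + n) \<le> (L * (1 + norm y)) ^ Suc (m + n)" by simp
    thus ?thesis by (rule power_le_imp_le_base) (use L in auto)
  qed
  with L show ?thesis by blast
qed

text \<open>
  The critical point \<open>a\<close> of order \<open>n\<close> is a zero of order \<open>n + 1\<close> of \<open>P - P a\<close>.
\<close>
lemma P_local_factor:
  "\<exists>e. (\<forall>z. P z - P a = (z - a) ^ (n + 1) * poly e z) \<and> poly e a \<noteq> 0"
proof -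
  define r where "r = p - [:P a:]"
  have dr: "pderiv r = pderiv p" by (simp add: r_def pderiv_diff)
  have pnz: "pderiv r \<noteq> 0" unfolding dr pderiv_p by simp
  have rnz: "r \<noteq> 0" using pnz by auto
  have "poly r a = 0" by (simp add: r_def)
  hence "order a r = Suc (order a (pderiv r))" by (rule order_pderiv[OF rnz])
  also have "order a (pderiv r) = n"
    unfolding dr pderiv_p using ab by (subst order_mult) (auto simp: order_power_n_n order_0I)
  finally have o: "order a r = n + 1" by simp
  obtain e where e: "r = [:-a, 1:] ^ order a r * e" "\<not> [:-a, 1:] dvd e"
    using order_decomp[OF rnz] by blast
  have "P z - P a = (z - a) ^ (n + 1) * poly e z" for z
  proof -
    have "P z - P a = poly r z" by (simp add: r_def)
    also have "\<dots> = (z - a) ^ (n + 1) * poly e z" by (subst e(1)) (simp add: o algebra_simps)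
    finally show ?thesis .
  qed
  moreover have "poly e a \<noteq> 0" using e(2) by (simp add: poly_eq_0_iff_dvd)
  ultimately show ?thesis by blast
qed

text \<open>
  If \<open>P a = P b\<close>, then \<open>P - P a\<close> would have \<open>(n + 1) + (m + 1)\<close> zeros, one more than its degree.
\<close>
lemma P_critical_values_distinct: "P a \<noteq> P b"
proof
  assume eq: "P a = P b"
  define r where "r = p - [:P a:]"
  have dr: "pderiv r = pderiv p" by (simp add: r_def pderiv_diff)
  have "degree (p + (- [:P a:])) = degree p" by (rule degree_add_eq_left) (simp add: degree_p)
  hence "degree r = q" unfolding r_def diff_conv_add_uminus degree_p .
  have rnz: "r \<noteq> 0" using \<open>degree r = q\<close> by auto
  obtain e1 where e1: "\<forall>z. P z - P a = (z - a) ^ (n + 1) * poly e1 z" using P_local_factor by blast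
  interpret sw: crit_poly p n m b a by (rule swap_crit)
  obtain e2 where e2: "\<forall>z. P z - P b = (z - b) ^ (m + 1) * poly e2 z" using sw.P_local_factor by blast
  have "r = [:-a, 1:] ^ (n + 1) * e1"
    by (rule poly_ext) (use e1 in \<open>simp add: r_def algebra_simps\<close>)
  hence r1: "r = [:-a, 1:] ^ (n + 1) * e1" .
  have "r = [:-b, 1:] ^ (m + 1) * e2"
    by (rule poly_ext) (use e2 eq in \<open>simp add: r_def algebra_simps\<close>)
  hence "[:-b, 1:] ^ (m + 1) dvd r" by (rule dvdI)
  hence "m + 1 \<le> order b r" using rnz unfolding order_divides by blast
  also have "order b r = order b ([:-a, 1:] ^ (n + 1)) + order b e1"
    using rnz unfolding r1 by (rule order_mult)
  also have "order b ([:-a, 1:] ^ (n + 1)) = 0" using ab by (intro order_0I) simp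
  also have "0 + order b e1 \<le> degree e1" using rnz r1 by (simp add: order_degree)
  finally have "m + 1 \<le> degree e1" .
  moreover have "degree r = (n + 1) + degree e1"
    using rnz degree_mult_eq[of "[:-a, 1:] ^ (n + 1)" e1] degree_linear_power[of "-a" "n + 1"]
    unfolding r1 by (metis mult_zero_left mult_zero_right)
  ultimately show False using \<open>degree r = q\<close> by simp
qed

end

section \<open>Regular differentials on the curve P(x) = A P(y)\<close>

context crit_poly
begin

text \<open>
  Continuity: near a point off the curve \<open>P x = A * P y\<close> there are no points of the curve.
\<close>
lemma separated:
  assumes "P s \<noteq> A * P t"
  shows "\<exists>\<delta>>0. \<forall>x y. norm (x - s) < \<delta> \<longrightarrow> norm (y - t) < \<delta> \<longrightarrow> P x \<noteq> A * P y"
proof -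
  define \<epsilon> where "\<epsilon> = norm (P s - A * P t) / (2 * (1 + norm A))"
  have \<epsilon>: "0 < \<epsilon>" using assms by (auto simp: \<epsilon>_def intro!: divide_pos_pos mult_pos_pos add_pos_nonneg)
  have "isCont P s" "isCont P t" by auto
  then obtain d1 d2 where d: "0 < d1" "\<And>x. norm (x - s) < d1 \<Longrightarrow> norm (P x - P s) < \<epsilon>"
      "0 < d2" "\<And>x. norm (x - t) < d2 \<Longrightarrow> norm (P x - P t) < \<epsilon>"
    unfolding continuous_at_eps_delta dist_norm using \<epsilon> by metis
  show ?thesis
  proof (rule exI[of _ "min d1 d2"], intro conjI allI impI)
    fix x y assume xy: "norm (x - s) < min d1 d2" "norm (y - t) < min d1 d2"
    show "P x \<noteq> A * P y"
    proof
      assume eq: "P x = A * P y"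
      have "P s - A * P t = (P s - P x) + A * (P y - P t)" using eq by (simp add: algebra_simps)
      hence "norm (P s - A * P t) \<le> norm (P s - P x) + norm A * norm (P y - P t)"
        by (metis norm_mult norm_triangle_ineq)
      also have "\<dots> \<le> \<epsilon> + norm A * \<epsilon>"
        using d(2)[of x] d(4)[of y] xy by (intro add_mono mult_left_mono) (auto simp: norm_minus_commute)
      also have "\<dots> = norm (P s - A * P t) / 2"
      proof -
        define u where "u = 1 + norm A"
        have "u \<noteq> 0" using norm_ge_zero[of A] unfolding u_def by linarith
        have "\<epsilon> + norm A * \<epsilon> = u * \<epsilon>" by (simp add: u_def algebra_simps)
        also have "\<dots> = norm (P s - A * P t) / 2"
          unfolding \<epsilon>_def u_def[symmetric] using \<open>u \<noteq> 0\<close> by simp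
        finally show ?thesis .
      qed
      finally show False using assms by simp
    qed
  qed (use d in auto)
qed

text \<open>
  Near \<open>(a, a)\<close> the curve \<open>P x = P y\<close> looks like \<open>(x - a)^(n + 1) = (y - a)^(n + 1)\<close>, so the two
  distances to \<open>a\<close> are comparable.
\<close>
lemma near_ratio:
  "\<exists>\<delta>>0. \<forall>x y. norm (x - a) < \<delta> \<longrightarrow> norm (y - a) < \<delta> \<longrightarrow> P x = P y \<longrightarrow> norm (x - a) \<le> 3 * norm (y - a)"
proof -
  obtain e where e: "\<And>z. P z - P a = (z - a) ^ (n + 1) * poly e z" "poly e a \<noteq> 0" using P_local_factor by blast
  define \<epsilon> where "\<epsilon> = norm (poly e a) / 2"
  have \<epsilon>: "0 < \<epsilon>" using e by (simp add: \<epsilon>_def)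
  have "isCont (poly e) a" by auto
  then obtain d where d: "0 < d" "\<And>x. norm (x - a) < d \<Longrightarrow> norm (poly e x - poly e a) < \<epsilon>"
    unfolding continuous_at_eps_delta dist_norm using \<epsilon> by metis
  have lo: "\<epsilon> \<le> norm (poly e x)" and hi: "norm (poly e x) \<le> 3 * \<epsilon>" if "norm (x - a) < d" for x
    using d(2)[OF that] norm_triangle_ineq2[of "poly e a" "poly e x"] norm_triangle_ineq2[of "poly e x" "poly e a"]
    by (auto simp: \<epsilon>_def norm_minus_commute)
  show ?thesis
  proof (rule exI[of _ d], intro conjI allI impI d)
    fix x y assume xy: "norm (x - a) < d" "norm (y - a) < d" "P x = P y"
    have "norm (x - a) ^ (n + 1) * \<epsilon> \<le> norm (x - a) ^ (n + 1) * norm (poly e x)"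
      using lo[OF xy(1)] by (intro mult_left_mono) auto
    also have "\<dots> = norm (P x - P a)" by (simp only: e norm_mult norm_power)
    also have "\<dots> = norm (y - a) ^ (n + 1) * norm (poly e y)" unfolding xy(3) by (simp only: e norm_mult norm_power)
    also have "\<dots> \<le> norm (y - a) ^ (n + 1) * (3 * \<epsilon>)" using hi[OF xy(2)] by (intro mult_left_mono) auto
    finally have "norm (x - a) ^ (n + 1) \<le> 3 * norm (y - a) ^ (n + 1)" using \<epsilon> by simp
    also have "\<dots> \<le> 3 ^ (n + 1) * norm (y - a) ^ (n + 1)"
      by (intro mult_right_mono self_le_power) auto
    finally have "norm (x - a) ^ Suc n \<le> (3 * norm (y - a)) ^ Suc n" by (simp only: power_mult_distrib Suc_eq_plus1)
    thus "norm (x - a) \<le> 3 * norm (y - a)" by (rule power_le_imp_le_base) auto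
  qed
qed

lemma pderiv_far:
  assumes "0 < \<delta>"
  shows "\<exists>c>0. \<forall>x. \<delta> \<le> norm (x - a) \<longrightarrow> \<delta> \<le> norm (x - b) \<longrightarrow> c \<le> norm ((x - a) ^ n * (x - b) ^ m)"
proof (rule exI[of _ "\<delta> ^ n * \<delta> ^ m"], intro conjI allI impI)
  fix x assume "\<delta> \<le> norm (x - a)" "\<delta> \<le> norm (x - b)"
  thus "\<delta> ^ n * \<delta> ^ m \<le> norm ((x - a) ^ n * (x - b) ^ m)"
    unfolding norm_mult norm_power using assms by (intro mult_mono power_mono) auto
qed (use assms in auto)

lemma scale_sq:
  assumes "0 \<le> u" "X \<le> M * Y" "0 < X" "0 < Y"
  shows "u / Y^2 \<le> M^2 * (u / X^2 :: real)"
proof -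
  have "X^2 \<le> (M * Y)^2" using assms by (intro power_mono) auto
  hence "u * X^2 \<le> u * (M^2 * Y^2)" using assms by (intro mult_left_mono) (auto simp: power_mult_distrib)
  thus ?thesis using assms by (simp add: field_simps)
qed

lemma power_ratio_le:
  assumes "1 \<le> Y" "i + 2 \<le> k"
  shows "Y ^ i / Y ^ k \<le> 1 / (Y::real)^2"
proof -
  have "Y ^ (i + 2) \<le> Y ^ k" by (rule power_increasing) (use assms in auto)
  hence "Y ^ i * Y^2 \<le> Y ^ k" by (simp only: power_add)
  thus ?thesis using assms(1) by (simp add: field_simps)
qed

text \<open>
  Here \<open>x'\<close> and \<open>y'\<close> stand for the derivatives of a pair of functions with \<open>P x = A * P y\<close>. The
  differential \<open>y^i dx / (y - a)^n\<close> is regular on that curve. Away from \<open>y = a\<close> it is bounded by \<open>dx\<close>; close to \<open>y = a\<close> the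
  point \<open>x\<close> is not critical, by the two conditions on \<open>A\<close>, and the differentiated equation trades
  \<open>dx / (y - a)^n\<close> for a bounded multiple of \<open>dy\<close>. At infinity \<open>y^i / (y - a)^n\<close> decays at least like \<open>1 / y^2\<close>,
  which is what the spherical metric asks for; with \<open>i \<le> 1\<close> this uses \<open>n \<ge> 3\<close>.
\<close>
lemma regular_differential_bound_scaled:
  assumes A: "P a \<noteq> A * P a" "P b \<noteq> A * P a" and n3: "3 \<le> n" and i: "i \<le> 1"
  shows "\<exists>K\<ge>0. \<forall>x y x' y'. P x = A * P y \<longrightarrow> y \<noteq> a \<longrightarrow> y \<noteq> b \<longrightarrow>
     (x - a) ^ n * (x - b) ^ m * x' = A * ((y - a) ^ n * (y - b) ^ m * y') \<longrightarrow>
     norm (y ^ i * x' / (y - a) ^ n) \<le> K * (norm x' / (1 + norm x)^2 + norm y' / (1 + norm y)^2)"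
proof -
  obtain d1 where d1: "0 < d1" "\<And>x y. norm (x - a) < d1 \<Longrightarrow> norm (y - a) < d1 \<Longrightarrow> P x \<noteq> A * P y"
    using separated[OF A(1)] by blast
  obtain d2 where d2: "0 < d2" "\<And>x y. norm (x - b) < d2 \<Longrightarrow> norm (y - a) < d2 \<Longrightarrow> P x \<noteq> A * P y"
    using separated[OF A(2)] by blast
  define \<delta> where "\<delta> = min d1 d2"
  have \<delta>: "0 < \<delta>" "\<delta> \<le> d1" "\<delta> \<le> d2" using d1 d2 by (auto simp: \<delta>_def)
  obtain L where L: "1 \<le> L" "\<And>x y. P x = A * P y \<Longrightarrow> 1 + norm x \<le> L * (1 + norm y)"
    using comparable_of_scaled_values[of A] by blast
  obtain c where c: "0 < c" "\<And>x. \<delta> \<le> norm (x - a) \<Longrightarrow> \<delta> \<le> norm (x - b) \<Longrightarrow> c \<le> norm ((x - a) ^ n * (x - b) ^ m)"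
    using pderiv_far[OF \<delta>(1)] by blast
  define k where "k = \<delta> / (1 + norm a + \<delta>)"
  have k: "0 < k" using \<delta> by (auto simp: k_def intro!: divide_pos_pos add_pos_pos add_pos_nonneg)
  define M where "M = 1 + norm a + \<delta>"
  have M: "1 \<le> M" using \<delta> by (simp add: M_def)
  define K1 where "K1 = 1 / k ^ n * L^2"
  define K2 where "K2 = norm A * M ^ i * ((1 + norm b) * M) ^ m / c * M^2"
  have K: "0 \<le> K1" "0 \<le> K2" using k c M by (auto simp: K1_def K2_def)
  show ?thesis
  proof (rule exI[of _ "K1 + K2"], intro conjI allI impI)
    show "0 \<le> K1 + K2" using K by simp
    fix x y x' y' assume xy: "P x = A * P y" "y \<noteq> a" "y \<noteq> b"
      and der: "(x - a) ^ n * (x - b) ^ m * x' = A * ((y - a) ^ n * (y - b) ^ m * y')"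
    define X where "X = 1 + norm x"
    define Y where "Y = 1 + norm y"
    let ?S = "norm x' / X^2 + norm y' / Y^2"
    have XY: "0 < X" "0 < Y" "1 \<le> Y" "norm y \<le> Y" by (auto simp: X_def Y_def intro: add_pos_nonneg)
    have XL: "X \<le> L * Y" using L(2)[OF xy(1)] by (simp add: X_def Y_def)
    have S: "norm x' / X^2 \<le> ?S" "norm y' / Y^2 \<le> ?S" "0 \<le> ?S" by auto
    have "norm (y ^ i * x' / (y - a) ^ n) \<le> K1 * ?S \<or> norm (y ^ i * x' / (y - a) ^ n) \<le> K2 * ?S"
    proof (cases "\<delta> \<le> norm (y - a)")
      case True
      have far: "k * Y \<le> norm (y - a)" unfolding k_def Y_def by (rule norm_diff_lower[OF \<delta>(1) True])
      have "norm (y ^ i * x' / (y - a) ^ n) = norm y ^ i * norm x' / norm (y - a) ^ n"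
        by (simp add: norm_mult norm_divide norm_power)
      also have "\<dots> \<le> (Y ^ i * norm x') / (k * Y) ^ n"
        using far k XY by (intro frac_le mult_right_mono power_mono mult_pos_pos zero_less_power) (auto simp: add_pos_nonneg)
      also have "\<dots> = 1 / k ^ n * norm x' * (Y ^ i / Y ^ n)" by (simp add: power_mult_distrib)
      also have "\<dots> \<le> 1 / k ^ n * norm x' * (1 / Y ^ 2)"
        by (intro mult_left_mono power_ratio_le) (use i n3 XY k in auto)
      also have "\<dots> = 1 / k ^ n * (norm x' / Y ^ 2)" by simp
      also have "\<dots> \<le> 1 / k ^ n * (L^2 * (norm x' / X^2))"
        using k XY XL by (intro mult_left_mono scale_sq) auto
      also have "\<dots> = K1 * (norm x' / X^2)" by (simp add: K1_def)
      also have "\<dots> \<le> K1 * ?S" using S K by (intro mult_left_mono) auto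
      finally show ?thesis by blast
    next
      case False
      have fx: "\<delta> \<le> norm (x - a)" "\<delta> \<le> norm (x - b)"
        using d1(2)[of x y] d2(2)[of x y] False \<delta> xy(1) by (force simp: not_le[symmetric])+
      let ?D = "(x - a) ^ n * (x - b) ^ m"
      have D: "c \<le> norm ?D" by (rule c(2)[OF fx])
      have D0: "?D \<noteq> 0" using fx \<delta>(1) by auto
      have YM: "Y \<le> M" using norm_triangle_ineq[of a "y - a"] False by (simp add: M_def Y_def)
      have "x' = A * ((y - a) ^ n * (y - b) ^ m * y') / ?D" using der D0 by (simp add: field_simps)
      hence "y ^ i * x' / (y - a) ^ n = A * y ^ i * (y - b) ^ m * y' / ?D" using xy(2) by simp
      hence "norm (y ^ i * x' / (y - a) ^ n) = norm A * norm y ^ i * norm (y - b) ^ m * norm y' / norm ?D"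
        by (simp only: norm_mult norm_divide norm_power)
      also have "\<dots> \<le> norm A * M ^ i * ((1 + norm b) * M) ^ m * norm y' / c"
      proof (intro frac_le mult_right_mono mult_mono power_mono D c(1))
        have "norm (y - b) \<le> (1 + norm b) * Y" unfolding Y_def by (rule norm_diff_upper)
        also have "\<dots> \<le> (1 + norm b) * M" using YM by (intro mult_left_mono) auto
        finally show "norm (y - b) \<le> (1 + norm b) * M" .
      qed (use YM M XY in auto)
      also have "\<dots> = norm A * M ^ i * ((1 + norm b) * M) ^ m / c * (norm y' / 1^2)" by simp
      also have "\<dots> \<le> norm A * M ^ i * ((1 + norm b) * M) ^ m / c * (M^2 * (norm y' / Y^2))"
        using c(1) M YM XY by (intro mult_left_mono scale_sq) auto
      also have "\<dots> = K2 * (norm y' / Y^2)" by (simp add: K2_def)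
      also have "\<dots> \<le> K2 * ?S" using S K by (intro mult_left_mono) auto
      finally show ?thesis by blast
    qed
    moreover have "K1 * ?S \<le> (K1 + K2) * ?S" "K2 * ?S \<le> (K1 + K2) * ?S"
      using K S(3) by (auto intro!: mult_right_mono)
    ultimately show "norm (y ^ i * x' / (y - a) ^ n) \<le> (K1 + K2) * (norm x' / (1 + norm x)^2 + norm y' / (1 + norm y)^2)"
      unfolding X_def[symmetric] Y_def[symmetric] by linarith
  qed
qed

text \<open>
  The same for the curve \<open>P x = P y\<close>, which now passes through the critical points \<open>(a, a)\<close> and
  \<open>(b, b)\<close>. There the factor \<open>(x - y)^2\<close> cancels the double poles in \<open>y\<close>, by \<open>near_ratio\<close>, and
  the factor \<open>(x - a)^j\<close> the remaining one. At infinity the differential is of order \<open>dx / x^2\<close>. Near \<open>y = a\<close> or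
  \<open>y = b\<close> with \<open>x\<close> not critical, \<open>dx\<close> is replaced by \<open>dy\<close>, and \<open>n \<ge> 2 + j\<close>, \<open>m \<ge> 2\<close> make up for
  the denominators.
\<close>
lemma regular_differential_bound_equal:
  assumes n3: "3 \<le> n" and j: "j \<le> 1"
  shows "\<exists>K\<ge>0. \<forall>x y x' y'. P x = P y \<longrightarrow> x \<noteq> a \<longrightarrow> x \<noteq> b \<longrightarrow> y \<noteq> a \<longrightarrow> y \<noteq> b \<longrightarrow>
     (x - a) ^ n * (x - b) ^ m * x' = (y - a) ^ n * (y - b) ^ m * y' \<longrightarrow>
     norm ((x - y)^2 * (x - a) ^ j * x' / ((y - a) ^ (2 + j) * (y - b)^2)) \<le> K * (norm x' / (1 + norm x)^2 + norm y' / (1 + norm y)^2)"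
proof -
  interpret sw: crit_poly p n m b a by (rule swap_crit)
  obtain d1 where d1: "0 < d1" "\<And>x y. norm (x - a) < d1 \<Longrightarrow> norm (y - b) < d1 \<Longrightarrow> P x \<noteq> P y"
    using separated[of a 1 b] P_critical_values_distinct by auto
  obtain d2 where d2: "0 < d2" "\<And>x y. norm (x - a) < d2 \<Longrightarrow> norm (y - a) < d2 \<Longrightarrow> P x = P y \<Longrightarrow> norm (x - a) \<le> 3 * norm (y - a)"
    using near_ratio by blast
  obtain d3 where d3: "0 < d3" "\<And>x y. norm (x - b) < d3 \<Longrightarrow> norm (y - b) < d3 \<Longrightarrow> P x = P y \<Longrightarrow> norm (x - b) \<le> 3 * norm (y - b)"
    using sw.near_ratio by blast
  define \<delta> where "\<delta> = min (min d1 d2) (min d3 (norm (a - b) / 2))"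
  have \<delta>: "0 < \<delta>" "\<delta> \<le> d1" "\<delta> \<le> d2" "\<delta> \<le> d3" "2 * \<delta> \<le> norm (a - b)"
    using d1 d2 d3 ab by (auto simp: \<delta>_def)
  obtain L where L: "1 \<le> L" "\<And>x y. P x = P y \<Longrightarrow> 1 + norm x \<le> L * (1 + norm y)"
    using comparable_of_scaled_values[of 1] by auto
  obtain c where c: "0 < c" "\<And>x. \<delta> \<le> norm (x - a) \<Longrightarrow> \<delta> \<le> norm (x - b) \<Longrightarrow> c \<le> norm ((x - a) ^ n * (x - b) ^ m)"
    using pderiv_far[OF \<delta>(1)] by blast
  define ka where "ka = \<delta> / (1 + norm a + \<delta>)"
  define kb where "kb = \<delta> / (1 + norm b + \<delta>)"
  have k: "0 < ka" "0 < kb" using \<delta> by (auto simp: ka_def kb_def intro!: divide_pos_pos add_pos_pos add_pos_nonneg)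
  define M where "M = L * (1 + norm a + norm b + \<delta>)"
  have "1 + norm a + norm b + \<delta> \<le> M"
    unfolding M_def using L(1) \<delta>(1) mult_right_mono[of 1 L "1 + norm a + norm b + \<delta>"] by simp
  hence M: "1 \<le> M" "1 + norm a + \<delta> \<le> M" "1 + norm b + \<delta> \<le> M"
    using \<delta>(1) norm_ge_zero[of a] norm_ge_zero[of b] by linarith+
  define Na where "Na = 1 + norm a"
  define Nb where "Nb = 1 + norm b"
  have N: "1 \<le> Na" "1 \<le> Nb" by (auto simp: Na_def Nb_def)
  define K1 where "K1 = (L + 1)^2 * (Na * L) ^ j / (ka ^ (2 + j) * kb^2) * L^2"
  define K2 where "K2 = 16 * 3 ^ j / \<delta>^2 * M^2"
  define K3 where "K3 = 16 * (Na * M) ^ j / \<delta> ^ (2 + j) * M^2"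
  define K4 where "K4 = (2 * M)^2 * (Na * M) ^ j * (Na * M) ^ (n - 2 - j) * (Nb * M) ^ (m - 2) / c * M^2"
  have K: "0 \<le> K1" "0 \<le> K2" "0 \<le> K3" "0 \<le> K4" using k c M \<delta> L N by (auto simp: K1_def K2_def K3_def K4_def)
  show ?thesis
  proof (rule exI[of _ "K1 + K2 + K3 + K4"], intro conjI allI impI)
    show "0 \<le> K1 + K2 + K3 + K4" using K by simp
    fix x y x' y' assume xy: "P x = P y" "x \<noteq> a" "x \<noteq> b" "y \<noteq> a" "y \<noteq> b"
      and der: "(x - a) ^ n * (x - b) ^ m * x' = (y - a) ^ n * (y - b) ^ m * y'"
    define X where "X = 1 + norm x"
    define Y where "Y = 1 + norm y"
    let ?S = "norm x' / X^2 + norm y' / Y^2"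
    have XY: "0 < X" "0 < Y" "1 \<le> Y" "norm y \<le> Y" by (auto simp: X_def Y_def intro: add_pos_nonneg)
    have XL: "X \<le> L * Y" using L(2)[OF xy(1)] by (simp add: X_def Y_def)
    have S: "norm x' / X^2 \<le> ?S" "norm y' / Y^2 \<le> ?S" "0 \<le> ?S" by auto
    let ?\<psi> = "(x - y)^2 * (x - a) ^ j * x' / ((y - a) ^ (2 + j) * (y - b)^2)"
    have psi: "norm ?\<psi> = norm (x - y)^2 * norm (x - a) ^ j * norm x' / (norm (y - a) ^ (2 + j) * norm (y - b)^2)"
      by (simp only: norm_mult norm_divide norm_power)
    have far: "\<delta> \<le> norm (w - b)" if "norm (w - a) < \<delta>" for w
      using norm_triangle_ineq[of "a - w" "w - b"] \<delta>(5) that by (simp add: norm_minus_commute)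
    have far': "\<delta> \<le> norm (w - a)" if "norm (w - b) < \<delta>" for w
      using far[of w] that by (meson not_le order_less_le_trans order_refl linorder_not_less)
    have xy_le: "norm (x - y) \<le> X + Y" using norm_triangle_ineq4[of x y] by (simp add: X_def Y_def)
    have bx: "norm x' = norm x' / 1^2" by simp
    \<comment> \<open>As \<open>P a \<noteq> P b\<close>, the pair \<open>(x, y)\<close> is never close to \<open>(a, b)\<close> or \<open>(b, a)\<close>.\<close>
    consider "\<delta> \<le> norm (y - a)" "\<delta> \<le> norm (y - b)"
      | "norm (y - a) < \<delta>" "norm (x - a) < \<delta>" | "norm (y - b) < \<delta>" "norm (x - b) < \<delta>"
      | "norm (y - a) < \<delta> \<or> norm (y - b) < \<delta>" "\<delta> \<le> norm (x - a)" "\<delta> \<le> norm (x - b)"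
      using d1(2)[of x y] d1(2)[of y x] xy(1) \<delta>(2) by (metis not_le order_less_le_trans)
    hence "norm ?\<psi> \<le> K1 * ?S \<or> norm ?\<psi> \<le> K2 * ?S \<or> norm ?\<psi> \<le> K3 * ?S \<or> norm ?\<psi> \<le> K4 * ?S"
    proof cases
      case 1
      have fa: "ka * Y \<le> norm (y - a)" unfolding ka_def Y_def by (rule norm_diff_lower[OF \<delta>(1) 1(1)])
      have fb: "kb * Y \<le> norm (y - b)" unfolding kb_def Y_def by (rule norm_diff_lower[OF \<delta>(1) 1(2)])
      have x1: "norm (x - y) \<le> (L + 1) * Y" using xy_le XL by (simp add: algebra_simps)
      have "norm (x - a) \<le> Na * X" unfolding Na_def X_def by (rule norm_diff_upper)
      also have "\<dots> \<le> Na * (L * Y)" using XL N by (intro mult_left_mono) auto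
      finally have x2: "norm (x - a) \<le> Na * L * Y" by simp
      have "norm ?\<psi> \<le> ((L + 1) * Y)^2 * (Na * L * Y) ^ j * norm x' / ((ka * Y) ^ (2 + j) * (kb * Y)^2)"
        unfolding psi using x1 x2 fa fb k XY L N
        by (intro frac_le mult_right_mono mult_mono power_mono mult_pos_pos zero_less_power mult_nonneg_nonneg zero_le_power) (auto simp: add_pos_nonneg)
      also have "\<dots> = (L + 1)^2 * (Na * L) ^ j / (ka ^ (2 + j) * kb^2) * (norm x' / Y^2)"
        using XY k by (simp add: power_mult_distrib power_add power2_eq_square field_simps)
      also have "\<dots> \<le> (L + 1)^2 * (Na * L) ^ j / (ka ^ (2 + j) * kb^2) * (L^2 * (norm x' / X^2))"
        using k XY L(1) XL N by (intro mult_left_mono scale_sq) auto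
      also have "\<dots> = K1 * (norm x' / X^2)" by (simp add: K1_def)
      also have "\<dots> \<le> K1 * ?S" using S K by (intro mult_left_mono) auto
      finally show ?thesis by blast
    next
      case 2
      have XM: "X \<le> M" using norm_triangle_ineq[of a "x - a"] 2 M by (simp add: X_def)
      have r: "norm (x - a) \<le> 3 * norm (y - a)" using d2(2)[of x y] 2 \<delta> xy(1) by simp
      have r2: "norm (x - y) \<le> 4 * norm (y - a)" using norm_triangle_ineq4[of "x - a" "y - a"] r by simp
      have r3: "\<delta> \<le> norm (y - b)" by (rule far[OF 2(1)])
      have ya: "0 < norm (y - a)" using xy by simp
      have "norm ?\<psi> \<le> (4 * norm (y - a))^2 * (3 * norm (y - a)) ^ j * norm x' / (norm (y - a) ^ (2 + j) * \<delta>^2)"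
        unfolding psi using r r2 r3 ya \<delta>(1)
        by (intro frac_le mult_right_mono mult_left_mono mult_mono power_mono mult_pos_pos zero_less_power mult_nonneg_nonneg zero_le_power) auto
      also have "\<dots> = 16 * 3 ^ j / \<delta>^2 * (norm x' / 1^2)"
        using ya \<delta>(1) by (simp add: power_mult_distrib power_add power2_eq_square field_simps)
      also have "\<dots> \<le> 16 * 3 ^ j / \<delta>^2 * (M^2 * (norm x' / X^2))"
        using XM XY \<delta>(1) by (intro mult_left_mono scale_sq) auto
      also have "\<dots> = K2 * (norm x' / X^2)" by (simp add: K2_def)
      also have "\<dots> \<le> K2 * ?S" using S K by (intro mult_left_mono) auto
      finally show ?thesis by blast
    next
      case 3
      have XM: "X \<le> M" using norm_triangle_ineq[of b "x - b"] 3 M by (simp add: X_def)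
      have r: "norm (x - b) \<le> 3 * norm (y - b)" using d3(2)[of x y] 3 \<delta> xy(1) by simp
      have r2: "norm (x - y) \<le> 4 * norm (y - b)" using norm_triangle_ineq4[of "x - b" "y - b"] r by simp
      have r3: "\<delta> \<le> norm (y - a)" by (rule far'[OF 3(1)])
      have "norm (x - a) \<le> Na * X" unfolding Na_def X_def by (rule norm_diff_upper)
      also have "\<dots> \<le> Na * M" using XM N by (intro mult_left_mono) auto
      finally have r4: "norm (x - a) \<le> Na * M" .
      have yb: "0 < norm (y - b)" using xy by simp
      have "norm ?\<psi> \<le> (4 * norm (y - b))^2 * (Na * M) ^ j * norm x' / (\<delta> ^ (2 + j) * norm (y - b)^2)"
        unfolding psi using r4 r2 r3 yb \<delta>(1) N M
        by (intro frac_le mult_right_mono mult_left_mono mult_mono power_mono mult_pos_pos zero_less_power mult_nonneg_nonneg zero_le_power) auto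
      also have "\<dots> = 16 * (Na * M) ^ j / \<delta> ^ (2 + j) * (norm x' / 1^2)"
        using yb \<delta>(1) by (simp add: power_mult_distrib power2_eq_square field_simps)
      also have "\<dots> \<le> 16 * (Na * M) ^ j / \<delta> ^ (2 + j) * (M^2 * (norm x' / X^2))"
        using XM XY \<delta>(1) N M by (intro mult_left_mono scale_sq) auto
      also have "\<dots> = K3 * (norm x' / X^2)" by (simp add: K3_def)
      also have "\<dots> \<le> K3 * ?S" using S K by (intro mult_left_mono) auto
      finally show ?thesis by blast
    next
      case 4
      have Y0: "Y \<le> 1 + norm a + norm b + \<delta>"
        using norm_triangle_ineq[of b "y - b"] norm_triangle_ineq[of a "y - a"] 4(1) norm_ge_zero[of a] norm_ge_zero[of b]
        by (auto simp: Y_def simp del: norm_ge_zero)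
      have "X \<le> L * Y" by (rule XL)
      also have "\<dots> \<le> M" unfolding M_def using Y0 L(1) by (intro mult_left_mono) auto
      finally have XM: "X \<le> M" .
      have YM: "Y \<le> M" using Y0 \<open>1 + norm a + norm b + \<delta> \<le> M\<close> by linarith
      let ?D = "(x - a) ^ n * (x - b) ^ m"
      have D: "c \<le> norm ?D" by (rule c(2)[OF 4(2,3)])
      have D0: "?D \<noteq> 0" using xy by simp
      have le: "norm (w - a) \<le> Na * M" "norm (w - b) \<le> Nb * M" if "1 + norm w \<le> M" for w
        using norm_diff_upper[of w a] norm_diff_upper[of w b] mult_left_mono[OF that, of Na] mult_left_mono[OF that, of Nb] N
        by (auto simp: Na_def Nb_def)
      have x': "x' = (y - a) ^ n * (y - b) ^ m * y' / ?D" using der D0 by (simp add: field_simps)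
      have e1: "2 + j + (n - 2 - j) = n" and e2: "2 + (m - 2) = m" using n3 j m1 by auto
      note sp = power_add[of "y - a" "2 + j" "n - 2 - j", unfolded e1] power_add[of "y - b" 2 "m - 2", unfolded e2]
      have "?\<psi> = (x - y)^2 * (x - a) ^ j * (y - a) ^ (n - 2 - j) * (y - b) ^ (m - 2) * y' / ?D"
        unfolding x' sp using xy by simp
      hence "norm ?\<psi> = norm (x - y)^2 * norm (x - a) ^ j * norm (y - a) ^ (n - 2 - j) * norm (y - b) ^ (m - 2) * norm y' / norm ?D"
        by (simp only: norm_mult norm_divide norm_power)
      also have "\<dots> \<le> (2 * M)^2 * (Na * M) ^ j * (Na * M) ^ (n - 2 - j) * (Nb * M) ^ (m - 2) * norm y' / c"
        by (intro frac_le mult_right_mono mult_mono power_mono D c(1) mult_nonneg_nonneg zero_le_power)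
           (use XM YM M N le(1)[OF XM[unfolded X_def]] le[OF YM[unfolded Y_def]] xy_le in auto)
      also have "\<dots> = (2 * M)^2 * (Na * M) ^ j * (Na * M) ^ (n - 2 - j) * (Nb * M) ^ (m - 2) / c * (norm y' / 1^2)" by simp
      also have "\<dots> \<le> (2 * M)^2 * (Na * M) ^ j * (Na * M) ^ (n - 2 - j) * (Nb * M) ^ (m - 2) / c * (M^2 * (norm y' / Y^2))"
        using c(1) M N YM XY by (intro mult_left_mono scale_sq) auto
      also have "\<dots> = K4 * (norm y' / Y^2)" by (simp add: K4_def)
      also have "\<dots> \<le> K4 * ?S" using S K by (intro mult_left_mono) auto
      finally show ?thesis by blast
    qed
    moreover have "K1 * ?S \<le> (K1 + K2 + K3 + K4) * ?S" "K2 * ?S \<le> (K1 + K2 + K3 + K4) * ?S"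
        "K3 * ?S \<le> (K1 + K2 + K3 + K4) * ?S" "K4 * ?S \<le> (K1 + K2 + K3 + K4) * ?S"
      using K S(3) by (auto intro!: mult_right_mono)
    ultimately show "norm ?\<psi> \<le> (K1 + K2 + K3 + K4) * (norm x' / (1 + norm x)^2 + norm y' / (1 + norm y)^2)"
      unfolding X_def[symmetric] Y_def[symmetric] by linarith
  qed
qed

end

section \<open>Excluding the functional equations P(f) = A P(g)\<close>

text \<open>
  Multiplying both functions by \<open>S\<close> makes the bound valid at the zeros of \<open>S\<close>, where it is not assumed.
\<close>
lemma entire_divide_bounded':
  assumes G: "entire_nz G" and F: "F holomorphic_on UNIV" and S: "entire_nz S"
    and B: "continuous_on UNIV B" and bd: "\<And>z. S z \<noteq> 0 \<Longrightarrow> norm (F z) \<le> B z * norm (G z)"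
  shows "\<exists>\<phi>. \<phi> holomorphic_on UNIV \<and> (\<forall>w. F w = \<phi> w * G w)"
proof -
  have SG: "entire_nz (\<lambda>z. G z * S z)" by (rule entire_nz_mult[OF G S])
  have SF: "(\<lambda>z. F z * S z) holomorphic_on UNIV" by (intro holomorphic_intros F entire_nzD[OF S])
  have bd': "norm (F z * S z) \<le> B z * norm (G z * S z)" if "G z * S z \<noteq> 0" for z
    using mult_right_mono[OF bd[of z], of "norm (S z)"] that by (simp add: norm_mult mult_ac)
  obtain \<phi> where \<phi>: "\<phi> holomorphic_on UNIV" "\<And>w. F w * S w = \<phi> w * (G w * S w)"
    using entire_divide_bounded[OF SG SF B bd'] by metis
  have "F = (\<lambda>w. \<phi> w * G w)"
  proof (rule entire_eq_offI[OF S F])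
    fix w assume "S w \<noteq> 0"
    thus "F w = \<phi> w * G w" using \<phi>(2)[of w] by simp
  qed (intro holomorphic_intros \<phi> entire_nzD[OF G])
  from fun_cong[OF this] show ?thesis using \<phi>(1) by blast
qed

text \<open>
  If \<open>s\<close> is a root of a polynomial with leading coefficient \<open>C K\<close>, then \<open>C K * s\<close> is a root of a
  monic polynomial in the same ring (multiply by \<open>C K ^ (K - 1)\<close>), and roots of monic polynomials are bounded by their
  coefficients.
\<close>
lemma top_coeff_bound:
  fixes C :: "nat \<Rightarrow> complex"
  assumes "(\<Sum>k\<le>K. C k * s ^ k) = 0" "1 \<le> K" "\<And>k. k \<le> K \<Longrightarrow> norm (C k) \<le> B" "1 \<le> B"
  shows "norm (C K * s) \<le> (real K + 1) * B ^ K"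
proof (cases "norm (C K * s) \<le> 1")
  case True
  have "1 * 1 \<le> (real K + 1) * B ^ K" using assms(4) by (intro mult_mono one_le_power) auto
  thus ?thesis using True by simp
next
  case False
  define Y where "Y = C K * s"
  have Y1: "1 < norm Y" using False by (simp add: Y_def)
  obtain K' where K': "K = Suc K'" using assms(2) by (cases K) auto
  have "C K * s ^ K = - (\<Sum>k\<le>K'. C k * s ^ k)"
  proof -
    have "(\<Sum>k\<le>K'. C k * s ^ k) + C K * s ^ K = 0" using assms(1) by (simp add: K')
    thus ?thesis by (metis add.commute eq_neg_iff_add_eq_0)
  qed
  hence "C K ^ K' * (C K * s ^ K) = - (\<Sum>k\<le>K'. C K ^ K' * (C k * s ^ k))"
    by (simp add: sum_distrib_left)
  moreover have "C K ^ K' * (C K * s ^ K) = Y ^ K" by (simp add: Y_def K' power_mult_distrib mult_ac)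
  moreover have "C K ^ K' * (C k * s ^ k) = C k * C K ^ (K' - k) * Y ^ k" if "k \<le> K'" for k
  proof -
    have "C K ^ K' = C K ^ (K' - k) * C K ^ k" using that by (simp flip: power_add)
    thus ?thesis by (simp add: Y_def power_mult_distrib mult_ac)
  qed
  ultimately have "Y ^ K = - (\<Sum>k\<le>K'. C k * C K ^ (K' - k) * Y ^ k)" by simp
  hence "norm Y ^ K = norm (\<Sum>k\<le>K'. C k * C K ^ (K' - k) * Y ^ k)" by (metis norm_minus_cancel norm_power)
  also have "\<dots> \<le> (\<Sum>k\<le>K'. B ^ K * norm Y ^ K')"
  proof (rule order_trans[OF norm_sum], rule sum_mono)
    fix k assume "k \<in> {..K'}"
    hence k: "k \<le> K'" by simp
    have "norm (C k * C K ^ (K' - k) * Y ^ k) = norm (C k) * norm (C K) ^ (K' - k) * norm Y ^ k"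
      by (simp add: norm_mult norm_power)
    also have "\<dots> \<le> B * B ^ (K' - k) * norm Y ^ K'"
      using assms(3)[of k] assms(3)[of K] assms(4) k K' Y1
      by (intro mult_mono power_mono power_increasing mult_nonneg_nonneg zero_le_power) auto
    also have "B * B ^ (K' - k) \<le> B ^ K"
      unfolding power_Suc[symmetric] by (rule power_increasing) (use K' assms(4) in auto)
    hence "B * B ^ (K' - k) * norm Y ^ K' \<le> B ^ K * norm Y ^ K'" by (intro mult_right_mono) auto
    finally show "norm (C k * C K ^ (K' - k) * Y ^ k) \<le> B ^ K * norm Y ^ K'" .
  qed
  also have "\<dots> = real K * B ^ K * norm Y ^ K'" by (simp add: K')
  finally have "norm Y * norm Y ^ K' \<le> (real K * B ^ K) * norm Y ^ K'" by (simp add: K')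
  moreover have "0 < norm Y ^ K'" using Y1 by (intro zero_less_power) linarith
  ultimately have "norm Y \<le> real K * B ^ K" by (rule mult_right_le_imp_le)
  also have "\<dots> \<le> (real K + 1) * B ^ K" using assms(4) by (intro mult_right_mono) auto
  finally show ?thesis by (simp add: Y_def)
qed

context crit_poly
begin

text \<open>
  The expansion of \<open>P\<close> at \<open>a\<close>. That none of its coefficients vanishes will show that an algebraic
  equation derived from it is not trivial.
\<close>
lemma P_expand:
  "\<exists>c. (\<forall>k\<le>m. c k \<noteq> 0) \<and> (\<forall>z. P z - P a = (\<Sum>k\<le>m. c k * (z - a) ^ (n + 1 + k)))"
proof -
  define c where "c = (\<lambda>k. of_nat (m choose k) * (a - b) ^ (m - k) / of_nat (n + 1 + k) :: complex)"
  have c: "c k \<noteq> 0" if "k \<le> m" for k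
    using that ab unfolding c_def by (auto simp del: of_nat_Suc of_nat_add)
  define F where "F = (\<lambda>z. P z - (\<Sum>k\<le>m. c k * (z - a) ^ (n + 1 + k)))"
  have "(F has_field_derivative 0) (at z)" for z
  proof -
    have "(F has_field_derivative (poly (pderiv p) z - (\<Sum>k\<le>m. c k * (of_nat (n + 1 + k) * (z - a) ^ (n + k))))) (at z)"
      unfolding F_def
    proof (intro DERIV_diff poly_DERIV DERIV_sum DERIV_cmult)
      fix k
      have "((\<lambda>z. (z - a) ^ (n + 1 + k)) has_field_derivative of_nat (n + 1 + k) * ((1 - 0) * (z - a) ^ (n + 1 + k - Suc 0))) (at z)"
        by (intro DERIV_power DERIV_diff DERIV_ident DERIV_const)
      thus "((\<lambda>z. (z - a) ^ (n + 1 + k)) has_field_derivative of_nat (n + 1 + k) * (z - a) ^ (n + k)) (at z)" by simp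
    qed
    moreover have "(\<Sum>k\<le>m. c k * (of_nat (n + 1 + k) * (z - a) ^ (n + k))) = (\<Sum>k\<le>m. (z - a) ^ n * (of_nat (m choose k) * (z - a) ^ k * (a - b) ^ (m - k)))"
    proof (rule sum.cong)
      fix k
      have "of_nat (n + 1 + k) \<noteq> (0 :: complex)" by (simp del: of_nat_Suc of_nat_add)
      thus "c k * (of_nat (n + 1 + k) * (z - a) ^ (n + k)) = (z - a) ^ n * (of_nat (m choose k) * (z - a) ^ k * (a - b) ^ (m - k))"
        unfolding c_def by (simp add: power_add mult_ac del: of_nat_Suc of_nat_add)
    qed simp
    moreover have "\<dots> = (z - a) ^ n * ((z - a) + (a - b)) ^ m" by (simp only: binomial_ring sum_distrib_left)
    moreover have "(z - a) ^ n * ((z - a) + (a - b)) ^ m = poly (pderiv p) z" by (simp add: poly_pderiv_p)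
    ultimately show ?thesis by simp
  qed
  hence "\<exists>k. \<forall>z. F z = k"
    using has_field_derivative_zero_constant[of UNIV F] by auto
  then obtain k where k: "\<And>z. F z = k" by blast
  have "k = P a" using k[of a] by (simp add: F_def)
  hence "P z - P a = (\<Sum>k\<le>m. c k * (z - a) ^ (n + 1 + k))" for z using k[of z] by (simp add: F_def algebra_simps)
  with c show ?thesis by blast
qed

end

text \<open>
  The polynomial \<open>p\<close> is evaluated at the meromorphic functions \<open>f / d\<close> and \<open>g / d\<close>.
\<close>
locale pair_poly = entire_pair d f g + crit_poly p m n a b
  for d f g :: "complex \<Rightarrow> complex" and p :: "complex poly" and m n :: nat and a b :: complex
begin

lemma swap_fg: "pair_poly d g f p m n a b"
  by (rule pair_poly.intro[OF swap_pair crit_poly_axioms])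

lemma swap_ab: "pair_poly d f g p n m b a"
  by (rule pair_poly.intro[OF entire_pair_axioms swap_crit])

text \<open>
  If \<open>g / d\<close> is a quotient of entire functions that are negligible against \<open>V\<close>, and \<open>f\<close> is
  controlled by \<open>g\<close>, then \<open>V\<close> would be bounded by its own logarithm.
\<close>
lemma no_small_representation:
  assumes E: "countable E" "zradii X0 \<subseteq> E" "zradii d \<subseteq> E"
    and X: "entire_nz X0" "X1 holomorphic_on UNIV" "\<And>z. X0 z * g z = X1 z * d z"
    and comp: "\<And>z. d z \<noteq> 0 \<Longrightarrow> norm (d z) + norm (f z) \<le> L * (norm (d z) + norm (g z))"
    and small: "\<And>r. growth E r \<Longrightarrow> cmean r (\<lambda>z. ln (norm (X0 z) + norm (X1 z))) \<le> C * (1 + ln (V r))"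
  shows False
proof -
  interpret sw: entire_pair d g f by (rule swap_pair)
  obtain C' where C': "\<And>r. 1 \<le> r \<Longrightarrow> r \<notin> E \<Longrightarrow>
      cmean r (\<lambda>z. ln (norm (d z) + norm (g z))) \<le> cmean r (\<lambda>z. ln (norm (X0 z) + norm (X1 z))) + C'"
    using sw.characteristic_quotient_le[OF X E(2)] by blast
  define K where "K = max 1 L + 1"
  have K: "1 \<le> K" by (simp add: K_def)
  show False
  proof (rule no_slow_growth[OF E(1)])
    fix r assume r: "growth E r"
    have r1: "1 \<le> r" "r \<notin> E" "1 \<le> V r" using r by (auto simp: growth_radius_def)
    have "V r \<le> cmean r (\<lambda>z. ln K + ln (norm (d z) + norm (g z)))"
      unfolding V_def
    proof (rule cmean_mono[OF cont_ln_size])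
      fix z :: complex assume z: "norm z = r"
      have dz: "d z \<noteq> 0" using z r1 E by (auto simp: zradii_def)
      have "size z \<le> (norm (d z) + norm (f z)) + (norm (d z) + norm (g z))" by (simp add: size_def)
      also have "\<dots> \<le> L * (norm (d z) + norm (g z)) + (norm (d z) + norm (g z))" using comp[OF dz] by simp
      also have "\<dots> = (L + 1) * (norm (d z) + norm (g z))" by (simp add: algebra_simps)
      also have "\<dots> \<le> K * (norm (d z) + norm (g z))" by (intro mult_right_mono) (auto simp: K_def)
      finally have "ln (size z) \<le> ln (K * (norm (d z) + norm (g z)))" using size_pos by (intro ln_mono)
      also have "\<dots> = ln K + ln (norm (d z) + norm (g z))" using K dg_pos[of z] by (intro ln_mult_pos) auto
      finally show "ln (size z) \<le> ln K + ln (norm (d z) + norm (g z))" .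
    qed (use r1 sw.cont_ln_df in \<open>auto intro!: continuous_on_add continuous_on_const\<close>)
    also have "\<dots> = ln K + cmean r (\<lambda>z. ln (norm (d z) + norm (g z)))"
      using r1 by (subst cmean_add[OF continuous_on_const sw.cont_ln_df]) auto
    also have "\<dots> \<le> ln K + (C * (1 + ln (V r)) + C')"
      using C'[OF r1(1,2)] small[OF r] by simp
    also have "\<dots> \<le> (C + (ln K + \<bar>C'\<bar>)) * (1 + ln (V r))"
    proof -
      have "0 \<le> (ln K + \<bar>C'\<bar>) * ln (V r)" using K r1 by (intro mult_nonneg_nonneg add_nonneg_nonneg) auto
      moreover have "C' \<le> \<bar>C'\<bar>" by simp
      ultimately show ?thesis unfolding ring_distribs by linarith
    qed
    finally show "V r \<le> (C + (ln K + \<bar>C'\<bar>)) * (1 + ln (V r))" .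
  qed
qed

lemma ln_sum_le_lnp:
  fixes X0 X1 :: "complex \<Rightarrow> complex"
  assumes "X0 holomorphic_on UNIV" "X1 holomorphic_on UNIV" "0 \<le> r" "\<And>z. norm z = r \<Longrightarrow> X0 z \<noteq> 0"
  shows "cmean r (\<lambda>z. ln (norm (X0 z) + norm (X1 z))) \<le> cmean r (\<lambda>z. lnp (norm (X0 z))) + (cmean r (\<lambda>z. lnp (norm (X1 z))) + ln 2)"
proof -
  have c: "continuous_on (sphere 0 r) (\<lambda>z. lnp (norm (X0 z)))" "continuous_on (sphere 0 r) (\<lambda>z. lnp (norm (X1 z)))"
    by (intro continuous_on_lnp continuous_on_norm entire_continuous assms)+
  have "cmean r (\<lambda>z. ln (norm (X0 z) + norm (X1 z))) \<le> cmean r (\<lambda>z. lnp (norm (X0 z)) + (lnp (norm (X1 z)) + ln 2))"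
  proof (rule cmean_mono)
    show "continuous_on (sphere 0 r) (\<lambda>z. ln (norm (X0 z) + norm (X1 z)))"
      by (intro continuous_intros entire_continuous assms) (use assms(4) in \<open>auto simp: add_nonneg_eq_0_iff\<close>)
    fix z :: complex assume "norm z = r"
    hence "0 < norm (X0 z) + norm (X1 z)" using assms(4) by (auto intro: add_pos_nonneg)
    hence "ln (norm (X0 z) + norm (X1 z)) \<le> lnp (norm (X0 z) + norm (X1 z))" by (rule ln_le_lnp)
    also have "\<dots> \<le> lnp (norm (X0 z)) + lnp (norm (X1 z)) + ln 2" by (rule lnp_add) auto
    finally show "ln (norm (X0 z) + norm (X1 z)) \<le> lnp (norm (X0 z)) + (lnp (norm (X1 z)) + ln 2)" by simp
  qed (use assms c in \<open>auto intro!: continuous_on_add continuous_on_const\<close>)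
  also have "\<dots> = cmean r (\<lambda>z. lnp (norm (X0 z))) + (cmean r (\<lambda>z. lnp (norm (X1 z))) + ln 2)"
    by (simp only: cmean_add[OF c(1) continuous_on_add[OF c(2) continuous_on_const] assms(3)]
        cmean_add[OF c(2) continuous_on_const assms(3)] cmean_const)
  finally show ?thesis .
qed

lemma quotient_deriv:
  assumes "F holomorphic_on UNIV" "d z \<noteq> 0"
  shows "((\<lambda>z. F z / d z) has_field_derivative wronskian F d z / d z ^ 2) (at z)"
  using DERIV_divide[OF entire_has_deriv[OF assms(1)] entire_has_deriv[OF d_hol] assms(2)]
  by (simp add: wronskian_def power2_eq_square)

lemma differential_relation:
  assumes rel: "\<And>z. d z \<noteq> 0 \<Longrightarrow> P (f z / d z) = A * P (g z / d z)" and z: "d z \<noteq> 0"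
  shows "(f z / d z - a) ^ n * (f z / d z - b) ^ m * (wronskian f d z / d z ^ 2) =
    A * ((g z / d z - a) ^ n * (g z / d z - b) ^ m * (wronskian g d z / d z ^ 2))"
proof -
  have 1: "((\<lambda>z. P (f z / d z)) has_field_derivative poly (pderiv p) (f z / d z) * (wronskian f d z / d z ^ 2)) (at z)"
    by (rule DERIV_chain2[OF poly_DERIV quotient_deriv[OF f z]])
  have 2: "((\<lambda>z. A * P (g z / d z)) has_field_derivative A * (poly (pderiv p) (g z / d z) * (wronskian g d z / d z ^ 2))) (at z)"
    by (intro DERIV_cmult DERIV_chain2[OF poly_DERIV quotient_deriv[OF g z]])
  have "eventually (\<lambda>w. d w \<noteq> 0) (nhds z)"
    using entire_open_nz[OF d_hol] z by (auto simp: eventually_nhds)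
  hence "eventually (\<lambda>w. P (f w / d w) = A * P (g w / d w)) (nhds z)"
    by eventually_elim (use rel in auto)
  with 1 have "((\<lambda>z. A * P (g z / d z)) has_field_derivative poly (pderiv p) (f z / d z) * (wronskian f d z / d z ^ 2)) (at z)"
    by (simp add: DERIV_cong_ev[OF refl _ refl])
  from DERIV_unique[OF this 2] show ?thesis by (simp add: poly_pderiv_p)
qed

lemma sph_affine: "d z \<noteq> 0 \<Longrightarrow> sph F z = norm (wronskian F d z / d z ^ 2) / (1 + norm (F z / d z))^2"
proof -
  assume "d z \<noteq> 0"
  hence "norm (d z) + norm (F z) = norm (d z) * (1 + norm (F z / d z))" by (simp add: norm_divide field_simps)
  thus ?thesis unfolding sph_def by (simp add: norm_divide norm_power power_mult_distrib)
qed

lemma comparable_pair: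
  assumes rel: "\<And>z. d z \<noteq> 0 \<Longrightarrow> P (f z / d z) = A * P (g z / d z)"
  shows "\<exists>L. \<forall>z. d z \<noteq> 0 \<longrightarrow> norm (d z) + norm (f z) \<le> L * (norm (d z) + norm (g z))"
proof -
  obtain L where L: "1 \<le> L" "\<And>x y. P x = A * P y \<Longrightarrow> 1 + norm x \<le> L * (1 + norm y)" using comparable_of_scaled_values[of A] by blast
  show ?thesis
  proof (rule exI[of _ L], intro allI impI)
    fix z assume z: "d z \<noteq> 0"
    have "norm (d z) * (1 + norm (f z / d z)) \<le> norm (d z) * (L * (1 + norm (g z / d z)))"
      by (intro mult_left_mono L(2) rel z) auto
    also have "\<dots> = L * (norm (d z) * (1 + norm (g z / d z)))" by simp
    finally show "norm (d z) + norm (f z) \<le> L * (norm (d z) + norm (g z))"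
      using z by (simp add: norm_divide distrib_left)
  qed
qed

text \<open>
  An expression \<open>N / D\<close> that is bounded by the spherical derivatives has no poles, and so it is an entire
  function; by \<open>small_of_spherical_bound\<close> it is negligible.
\<close>
lemma small_quotient:
  assumes N: "N holomorphic_on UNIV" and D: "entire_nz D" and S: "entire_nz S" and K: "0 \<le> K"
    and bd: "\<And>z. S z \<noteq> 0 \<Longrightarrow> norm (N z) \<le> K * (sph f z + sph g z) * norm (D z)"
  shows "\<exists>\<phi>. \<phi> holomorphic_on UNIV \<and> (\<forall>w. N w = \<phi> w * D w) \<and>
    (\<forall>E. countable E \<longrightarrow> zradii f \<union> zradii g \<union> zradii d \<union> zradii S \<union> zradii D \<subseteq> E \<longrightarrow>
      (\<exists>C. \<forall>r. growth E r \<longrightarrow> cmean r (\<lambda>z. lnp (norm (\<phi> z))) \<le> C * (1 + ln (V r))))"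
proof -
  interpret sw: entire_pair d g f by (rule swap_pair)
  have cont: "continuous_on UNIV (\<lambda>z. K * (sph f z + sph g z))"
    by (intro continuous_on_mult continuous_on_const continuous_on_add sph_continuous sw.sph_continuous)
  obtain \<phi> where \<phi>: "\<phi> holomorphic_on UNIV" "\<forall>w. N w = \<phi> w * D w"
    using entire_divide_bounded'[OF D N S cont bd] by blast
  have le: "norm (\<phi> w) \<le> K * (sph f w + sph g w)" if "S w \<noteq> 0" "D w \<noteq> 0" for w
    using bd[OF that(1)] \<phi>(2) that(2) by (simp add: norm_mult mult_le_cancel_right)
  have "\<exists>C. \<forall>r. growth E r \<longrightarrow> cmean r (\<lambda>z. lnp (norm (\<phi> z))) \<le> C * (1 + ln (V r))"
    if E: "countable E" "zradii f \<union> zradii g \<union> zradii d \<union> zradii S \<union> zradii D \<subseteq> E" for E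
  proof (rule small_of_spherical_bound[OF \<phi>(1) E(1) _ _ _ _ K])
    show "norm (\<phi> z) \<le> K * (sph f z + sph g z)" if "norm z \<notin> E" for z
      using that E(2) by (intro le) (auto simp: zradii_def)
  qed (use E in auto)
  with \<phi> show ?thesis by blast
qed

text \<open>
  The two differentials \<open>dx / (y - a)^n\<close> and \<open>y dx / (y - a)^n\<close>, pulled back along \<open>(f / d, g / d)\<close>,
  become negligible entire functions \<open>X0\<close> and \<open>X1\<close> with \<open>X1 / X0 = g / d\<close>.
\<close>
lemma no_solution_scaled:
  assumes rel: "\<And>z. d z \<noteq> 0 \<Longrightarrow> P (f z / d z) = A * P (g z / d z)"
    and A: "A \<noteq> 1" "P b \<noteq> A * P a" and n3: "3 \<le> n"
  shows False
proof -
  interpret sw: entire_pair d g f by (rule swap_pair)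
  have A1: "P a \<noteq> A * P a" using A(1) pa by simp
  let ?ga = "\<lambda>z. g z - a * d z" and ?gb = "\<lambda>z. g z - b * d z"
  define S where "S = (\<lambda>z. d z * (?ga z * ?gb z))"
  have S: "entire_nz S" unfolding S_def by (intro entire_nz_mult d sw.f_lin_nz)
  define D where "D = (\<lambda>z. ?ga z ^ n)"
  have D: "entire_nz D" unfolding D_def by (rule entire_nz_power[OF sw.f_lin_nz])
  define N where "N = (\<lambda>i z. wronskian f d z * d z ^ (n - 2 - i) * g z ^ i)"
  have Nhol: "N i holomorphic_on UNIV" for i unfolding N_def by (intro holomorphic_intros wronskian_hol f g d_hol)
  have bd: "\<exists>K\<ge>0. \<forall>z. S z \<noteq> 0 \<longrightarrow> norm (N i z) \<le> K * (sph f z + sph g z) * norm (D z)" if i: "i \<le> 1" for i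
  proof -
    obtain K where K: "0 \<le> K" "\<And>x y x' y'. P x = A * P y \<Longrightarrow> y \<noteq> a \<Longrightarrow> y \<noteq> b \<Longrightarrow>
     (x - a) ^ n * (x - b) ^ m * x' = A * ((y - a) ^ n * (y - b) ^ m * y') \<Longrightarrow>
     norm (y ^ i * x' / (y - a) ^ n) \<le> K * (norm x' / (1 + norm x)^2 + norm y' / (1 + norm y)^2)"
      using regular_differential_bound_scaled[OF A1 A(2) n3 i] by metis
    have "norm (N i z) \<le> K * (sph f z + sph g z) * norm (D z)" if "S z \<noteq> 0" for z
    proof -
      have nz: "d z \<noteq> 0" "?ga z \<noteq> 0" "?gb z \<noteq> 0" using that by (auto simp: S_def)
      have y: "g z / d z \<noteq> a" "g z / d z \<noteq> b" using nz by (auto simp: field_simps)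
      have "norm ((g z / d z) ^ i * (wronskian f d z / d z ^ 2) / (g z / d z - a) ^ n) \<le> K * (sph f z + sph g z)"
        unfolding sph_affine[OF nz(1)]
        by (rule K(2)[OF rel[OF nz(1)] y differential_relation[OF rel nz(1)]])
      moreover have "(g z / d z) ^ i * (wronskian f d z / d z ^ 2) / (g z / d z - a) ^ n = N i z / D z"
      proof -
        have "g z / d z - a = ?ga z / d z" using nz by (simp add: field_simps)
        moreover have "d z ^ n = d z ^ i * d z ^ 2 * d z ^ (n - 2 - i)"
        proof -
          have e: "i + 2 + (n - 2 - i) = n" using i n3 by simp
          show ?thesis using power_add[of "d z" "i + 2" "n - 2 - i", unfolded e] by (simp only: power_add)
        qed
        ultimately show ?thesis using nz by (simp add: N_def D_def power_divide)
      qed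
      ultimately have "norm (N i z / D z) \<le> K * (sph f z + sph g z)" by simp
      thus ?thesis using nz(2) by (simp add: norm_divide pos_divide_le_eq D_def)
    qed
    with K(1) show ?thesis by blast
  qed
  have div: "\<exists>\<phi>. \<phi> holomorphic_on UNIV \<and> (\<forall>w. N i w = \<phi> w * D w) \<and>
    (\<forall>E. countable E \<longrightarrow> zradii f \<union> zradii g \<union> zradii d \<union> zradii S \<union> zradii D \<subseteq> E \<longrightarrow>
      (\<exists>C. \<forall>r. growth E r \<longrightarrow> cmean r (\<lambda>z. lnp (norm (\<phi> z))) \<le> C * (1 + ln (V r))))" if i: "i \<le> 1" for i
    using bd[OF i] small_quotient[OF Nhol D S] by blast
  obtain X0 where X0: "X0 holomorphic_on UNIV" "\<forall>w. N 0 w = X0 w * D w"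
     "\<forall>E. countable E \<longrightarrow> zradii f \<union> zradii g \<union> zradii d \<union> zradii S \<union> zradii D \<subseteq> E \<longrightarrow>
      (\<exists>C. \<forall>r. growth E r \<longrightarrow> cmean r (\<lambda>z. lnp (norm (X0 z))) \<le> C * (1 + ln (V r)))"
    using div[of 0] by auto
  obtain X1 where X1: "X1 holomorphic_on UNIV" "\<forall>w. N 1 w = X1 w * D w"
     "\<forall>E. countable E \<longrightarrow> zradii f \<union> zradii g \<union> zradii d \<union> zradii S \<union> zradii D \<subseteq> E \<longrightarrow>
      (\<exists>C. \<forall>r. growth E r \<longrightarrow> cmean r (\<lambda>z. lnp (norm (X1 z))) \<le> C * (1 + ln (V r)))"
    using div[of 1] by auto
  have "entire_nz (N 0)" unfolding N_def using entire_nz_mult[OF Wf entire_nz_power[OF d, of "n-2"]] by simp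
  hence X0nz: "entire_nz X0" using X0(1,2) unfolding entire_nz_def by auto
  have X0eq: "X0 z * g z = X1 z * d z" for z
  proof -
    have "(\<lambda>z. X0 z * g z) = (\<lambda>z. X1 z * d z)"
    proof (rule entire_eq_offI[OF D])
      fix w assume nz: "D w \<noteq> 0"
      have "n - 2 = Suc (n - 2 - 1)" using n3 by simp
      hence pw: "d w ^ (n - 2 - 0) = d w * d w ^ (n - 2 - 1)" by (metis diff_zero power_Suc)
      have "N 0 w * g w = N 1 w * d w" unfolding N_def pw by (simp add: mult_ac)
      hence "(X0 w * g w) * D w = (X1 w * d w) * D w" using X0(2) X1(2) by (simp add: mult_ac)
      thus "X0 w * g w = X1 w * d w" using mult_right_cancel[OF nz] by blast
    qed (intro holomorphic_intros X0 X1 g d_hol)+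
    thus ?thesis by (rule fun_cong)
  qed
  have f': "entire_nz f" using f_lin_nz[of 0] by simp
  have g': "entire_nz g" using sw.f_lin_nz[of 0] by simp
  define E where "E = zradii f \<union> zradii g \<union> zradii d \<union> zradii S \<union> zradii D \<union> zradii X0"
  have E: "countable E" unfolding E_def by (intro countable_Un countable_zradii f' g' d S D X0nz)
  have Esub: "zradii f \<union> zradii g \<union> zradii d \<union> zradii S \<union> zradii D \<subseteq> E" unfolding E_def by blast
  obtain C0 where C0: "\<And>r. growth E r \<Longrightarrow> cmean r (\<lambda>z. lnp (norm (X0 z))) \<le> C0 * (1 + ln (V r))"
    using X0(3) E Esub by metis
  obtain C1 where C1: "\<And>r. growth E r \<Longrightarrow> cmean r (\<lambda>z. lnp (norm (X1 z))) \<le> C1 * (1 + ln (V r))"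
    using X1(3) E Esub by metis
  obtain L where L: "\<And>z. d z \<noteq> 0 \<Longrightarrow> norm (d z) + norm (f z) \<le> L * (norm (d z) + norm (g z))"
    using comparable_pair[OF rel] by blast
  show False
  proof (rule no_small_representation[OF E _ _ X0nz X1(1) X0eq L])
    fix r assume r: "growth E r"
    have r1: "1 \<le> r" "r \<notin> E" "1 \<le> V r" using r by (auto simp: growth_radius_def)
    have "cmean r (\<lambda>z. ln (norm (X0 z) + norm (X1 z))) \<le> cmean r (\<lambda>z. lnp (norm (X0 z))) + (cmean r (\<lambda>z. lnp (norm (X1 z))) + ln 2)"
      by (rule ln_sum_le_lnp) (use X0 X1 r1 in \<open>auto simp: E_def zradii_def\<close>)
    also have "\<dots> \<le> (C0 + C1 + ln 2) * (1 + ln (V r))"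
    proof -
      have "0 \<le> ln 2 * ln (V r)" using r1 by simp
      thus ?thesis using C0[OF r] C1[OF r] unfolding ring_distribs by linarith
    qed
    finally show "cmean r (\<lambda>z. ln (norm (X0 z) + norm (X1 z))) \<le> (C0 + C1 + ln 2) * (1 + ln (V r))" .
  qed (auto simp: E_def)
qed

text \<open>
  The two differentials for \<open>j = 0, 1\<close> yield negligible entire functions \<open>X0, X1\<close> whose quotient is
  \<open>u = (f - a d) / (g - a d)\<close>. Put \<open>s = g / d - a\<close>. By the expansion of \<open>P\<close> at \<open>a\<close>, the equation
  \<open>P (a + u s) = P (a + s)\<close> becomes, after division by \<open>(u - 1) * s^(n + 1)\<close>, an algebraic equation of degree at most \<open>m\<close>
  for \<open>s\<close> with coefficients that are polynomials in \<open>X0\<close> and \<open>X1\<close>. So \<open>s\<close> is a quotient of negligible functions too.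
\<close>
lemma no_solution_equal_values:
  assumes rel: "\<And>z. d z \<noteq> 0 \<Longrightarrow> P (f z / d z) = P (g z / d z)"
    and fg: "entire_nz (\<lambda>z. f z - g z)" and n3: "3 \<le> n"
  shows False
proof -
  interpret sw: entire_pair d g f by (rule swap_pair)
  let ?fa = "\<lambda>z. f z - a * d z" and ?fb = "\<lambda>z. f z - b * d z"
  let ?ga = "\<lambda>z. g z - a * d z" and ?gb = "\<lambda>z. g z - b * d z"
  define S where "S = (\<lambda>z. d z * (?fa z * ?fb z) * (?ga z * ?gb z))"
  have S: "entire_nz S" unfolding S_def by (intro entire_nz_mult d f_lin_nz sw.f_lin_nz)
  define D where "D = (\<lambda>j z. ?ga z ^ (2 + j) * ?gb z ^ 2)"
  have D: "entire_nz (D j)" for j unfolding D_def by (intro entire_nz_mult entire_nz_power sw.f_lin_nz)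
  define N where "N = (\<lambda>j z. (f z - g z)^2 * wronskian f d z * ?fa z ^ j)"
  have Nhol: "N i holomorphic_on UNIV" for i unfolding N_def by (intro holomorphic_intros wronskian_hol f g d_hol)
  have bd: "\<exists>K\<ge>0. \<forall>z. S z \<noteq> 0 \<longrightarrow> norm (N j z) \<le> K * (sph f z + sph g z) * norm (D j z)" if j: "j \<le> 1" for j
  proof -
    obtain K where K: "0 \<le> K" "\<And>x y x' y'. P x = P y \<Longrightarrow> x \<noteq> a \<Longrightarrow> x \<noteq> b \<Longrightarrow> y \<noteq> a \<Longrightarrow> y \<noteq> b \<Longrightarrow>
     (x - a) ^ n * (x - b) ^ m * x' = (y - a) ^ n * (y - b) ^ m * y' \<Longrightarrow>
     norm ((x - y)^2 * (x - a) ^ j * x' / ((y - a) ^ (2 + j) * (y - b)^2)) \<le> K * (norm x' / (1 + norm x)^2 + norm y' / (1 + norm y)^2)"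
      using regular_differential_bound_equal[OF n3 j] by metis
    have "norm (N j z) \<le> K * (sph f z + sph g z) * norm (D j z)" if "S z \<noteq> 0" for z
    proof -
      have nz: "d z \<noteq> 0" "?ga z \<noteq> 0" "?gb z \<noteq> 0" "?fa z \<noteq> 0" "?fb z \<noteq> 0" using that by (auto simp: S_def)
      have y: "f z / d z \<noteq> a" "f z / d z \<noteq> b" "g z / d z \<noteq> a" "g z / d z \<noteq> b" using nz by (auto simp: field_simps)
      let ?\<psi> = "(f z / d z - g z / d z)^2 * (f z / d z - a) ^ j * (wronskian f d z / d z ^ 2) / ((g z / d z - a) ^ (2 + j) * (g z / d z - b)^2)"
      have der: "(f z / d z - a) ^ n * (f z / d z - b) ^ m * (wronskian f d z / d z ^ 2) =
          (g z / d z - a) ^ n * (g z / d z - b) ^ m * (wronskian g d z / d z ^ 2)"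
        using differential_relation[where A = 1, OF _ nz(1)] rel by simp
      have "norm ?\<psi> \<le> K * (sph f z + sph g z)"
        unfolding sph_affine[OF nz(1)] by (rule K(2)[OF rel[OF nz(1)] y der])
      moreover have "?\<psi> = N j z / D j z"
      proof -
        have e: "f z / d z - a = ?fa z / d z" "g z / d z - a = ?ga z / d z" "g z / d z - b = ?gb z / d z"
           "f z / d z - g z / d z = (f z - g z) / d z"
          using nz by (auto simp: field_simps)
        show ?thesis unfolding e N_def D_def using nz by (simp add: power_divide power_add power2_eq_square)
      qed
      ultimately have "norm (N j z / D j z) \<le> K * (sph f z + sph g z)" by simp
      thus ?thesis using nz(2,3) by (simp add: norm_divide pos_divide_le_eq D_def)
    qed
    with K(1) show ?thesis by blast
  qed
  have div: "\<exists>\<phi>. \<phi> holomorphic_on UNIV \<and> (\<forall>w. N j w = \<phi> w * D j w) \<and>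
    (\<forall>E. countable E \<longrightarrow> zradii f \<union> zradii g \<union> zradii d \<union> zradii S \<union> zradii (D j) \<subseteq> E \<longrightarrow>
      (\<exists>C. \<forall>r. growth E r \<longrightarrow> cmean r (\<lambda>z. lnp (norm (\<phi> z))) \<le> C * (1 + ln (V r))))" if j: "j \<le> 1" for j
    using bd[OF j] small_quotient[OF Nhol D S] by blast
  obtain X0 where X0: "X0 holomorphic_on UNIV" "\<forall>w. N 0 w = X0 w * D 0 w"
     "\<forall>E. countable E \<longrightarrow> zradii f \<union> zradii g \<union> zradii d \<union> zradii S \<union> zradii (D 0) \<subseteq> E \<longrightarrow>
      (\<exists>C. \<forall>r. growth E r \<longrightarrow> cmean r (\<lambda>z. lnp (norm (X0 z))) \<le> C * (1 + ln (V r)))"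
    using div[of 0] by auto
  obtain X1 where X1: "X1 holomorphic_on UNIV" "\<forall>w. N 1 w = X1 w * D 1 w"
     "\<forall>E. countable E \<longrightarrow> zradii f \<union> zradii g \<union> zradii d \<union> zradii S \<union> zradii (D 1) \<subseteq> E \<longrightarrow>
      (\<exists>C. \<forall>r. growth E r \<longrightarrow> cmean r (\<lambda>z. lnp (norm (X1 z))) \<le> C * (1 + ln (V r)))"
    using div[of 1] by auto
  have "entire_nz (N 0)" unfolding N_def using entire_nz_mult[OF entire_nz_power[OF fg, of 2] Wf] by simp
  hence X0nz: "entire_nz X0" using X0(1,2) unfolding entire_nz_def by auto
  \<comment> \<open>In affine terms, \<open>X1 / X0 = (f - a) / (g - a)\<close>.\<close>
  have X1eq: "X1 w * ?ga w = X0 w * ?fa w" if "S w \<noteq> 0" for w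
  proof -
    have nz: "D 0 w \<noteq> 0" using that by (auto simp: S_def D_def)
    have "(X1 w * ?ga w) * D 0 w = N 1 w" using X1(2) by (simp add: D_def power3_eq_cube power2_eq_square mult_ac)
    also have "\<dots> = N 0 w * ?fa w" by (simp add: N_def)
    also have "\<dots> = (X0 w * ?fa w) * D 0 w" using X0(2) by simp
    finally show ?thesis using mult_right_cancel[OF nz] by blast
  qed
  obtain c where c: "\<forall>k\<le>m. c k \<noteq> 0" "\<forall>z. P z - P a = (\<Sum>k\<le>m. c k * (z - a) ^ (n + 1 + k))"
    using P_expand by blast
  \<comment> \<open>\<open>\<Phi> k\<close> is the homogenized quotient \<open>(u^(n + 1 + k) - 1) / (u - 1)\<close> at \<open>u = X1 / X0\<close>.\<close>
  define \<Phi> where "\<Phi> = (\<lambda>k z. \<Sum>i\<le>n + k. X1 z ^ i * X0 z ^ (n + k - i))"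
  define C where "C = (\<lambda>k z. c k * \<Phi> k z * X0 z ^ (m - k))"
  define s where "s = (\<lambda>z. ?ga z / d z)"
  have Chol: "C k holomorphic_on UNIV" for k unfolding C_def \<Phi>_def by (intro holomorphic_intros X0 X1)
  have key: "(\<Sum>k\<le>m. C k z * s z ^ k) = 0" if z: "S z \<noteq> 0" "f z - g z \<noteq> 0" for z
  proof -
    have nz: "d z \<noteq> 0" "?ga z \<noteq> 0" using z by (auto simp: S_def)
    define u where "u = ?fa z / ?ga z"
    have s0: "s z \<noteq> 0" using nz by (simp add: s_def)
    have us: "f z / d z - a = u * s z" "g z / d z - a = s z" using nz by (simp_all add: u_def s_def field_simps)
    have u1: "u \<noteq> 1" using nz z(2) by (simp add: u_def)
    have Xu: "X1 z = u * X0 z" using X1eq[OF z(1)] nz by (simp add: u_def field_simps)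
    have "(\<Sum>k\<le>m. c k * (u * s z) ^ (n + 1 + k)) = (\<Sum>k\<le>m. c k * s z ^ (n + 1 + k))"
      using c(2)[rule_format, of "f z / d z"] c(2)[rule_format, of "g z / d z"] rel[OF nz(1)] unfolding us by simp
    hence "(\<Sum>k\<le>m. c k * (u ^ (n + 1 + k) - 1) * s z ^ (n + 1 + k)) = 0"
      by (simp add: power_mult_distrib algebra_simps sum_subtractf)
    also have "(\<Sum>k\<le>m. c k * (u ^ (n + 1 + k) - 1) * s z ^ (n + 1 + k)) =
       ((u - 1) * s z ^ (n + 1)) * (\<Sum>k\<le>m. c k * (\<Sum>i\<le>n + k. u ^ i) * s z ^ k)"
      unfolding sum_distrib_left[where f = "\<lambda>k. c k * (\<Sum>i\<le>n + k. u ^ i) * s z ^ k"]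
    proof (rule sum.cong)
      fix k
      have "u ^ (n + 1 + k) - 1 = (u - 1) * (\<Sum>i<n + 1 + k. u ^ i)" by (rule power_diff_1_eq)
      also have "{..<n + 1 + k} = {..n + k}" by auto
      finally show "c k * (u ^ (n + 1 + k) - 1) * s z ^ (n + 1 + k) =
          (u - 1) * s z ^ (n + 1) * (c k * (\<Sum>i\<le>n + k. u ^ i) * s z ^ k)"
        by (simp add: power_add mult_ac)
    qed simp
    finally have 0: "(\<Sum>k\<le>m. c k * (\<Sum>i\<le>n + k. u ^ i) * s z ^ k) = 0" using u1 s0 by simp
    have "\<Phi> k z * X0 z ^ (m - k) = (\<Sum>i\<le>n + k. u ^ i) * X0 z ^ (n + m)" if "k \<le> m" for k
      unfolding \<Phi>_def sum_distrib_right
    proof (rule sum.cong)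
      fix i assume "i \<in> {..n + k}"
      hence e: "i + (n + k - i) + (m - k) = n + m" using that by simp
      have "X0 z ^ (n + m) = X0 z ^ i * X0 z ^ (n + k - i) * X0 z ^ (m - k)"
        unfolding power_add[symmetric] e ..
      thus "X1 z ^ i * X0 z ^ (n + k - i) * X0 z ^ (m - k) = u ^ i * X0 z ^ (n + m)"
        by (simp add: Xu power_mult_distrib mult_ac)
    qed simp
    hence "(\<Sum>k\<le>m. C k z * s z ^ k) = (\<Sum>k\<le>m. X0 z ^ (n + m) * (c k * (\<Sum>i\<le>n + k. u ^ i) * s z ^ k))"
      by (intro sum.cong) (simp_all add: C_def mult_ac)
    also have "\<dots> = 0" unfolding sum_distrib_left[symmetric] 0 by simp
    finally show ?thesis .
  qed
  \<comment> \<open>Consecutive quotients \<open>\<Phi> m\<close> and \<open>\<Phi> (m - 1)\<close> have no common zero \<open>u\<close>, so one of the two top coefficients survives; as \<open>m \<ge> 2\<close>, the degree stays positive.\<close>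
  have top: "\<exists>K. 1 \<le> K \<and> K \<le> m \<and> entire_nz (C K) \<and> (\<forall>k z. K < k \<longrightarrow> k \<le> m \<longrightarrow> C k z = 0)"
  proof (cases "entire_nz (C m)")
    case True thus ?thesis using m1 by (intro exI[of _ m]) auto
  next
    case False
    hence Cm: "C m z = 0" for z using Chol[of m] by (auto simp: entire_nz_def)
    obtain m' where m': "m = Suc m'" using m1 by (cases m) auto
    have "entire_nz (C m')"
    proof (rule ccontr)
      assume "\<not> entire_nz (C m')"
      hence Cm': "C m' z = 0" for z using Chol[of m'] by (auto simp: entire_nz_def)
      obtain z where z: "X0 z \<noteq> 0" using X0nz by (auto simp: entire_nz_def)
      have "\<Phi> m z = 0" using Cm[of z] c(1) by (simp add: C_def)
      moreover have "\<Phi> m' z = 0" using Cm'[of z] c(1) z m' by (simp add: C_def)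
      moreover have "\<Phi> m z = X0 z ^ (n + m) + X1 z * \<Phi> m' z"
      proof -
        have "{..n + m} = insert 0 (Suc ` {..n + m'})" by (simp only: m' add_Suc_right atMost_Suc_eq_insert_0)
        hence "\<Phi> m z = X0 z ^ (n + m) + (\<Sum>i\<in>Suc ` {..n + m'}. X1 z ^ i * X0 z ^ (n + m - i))"
          by (simp add: \<Phi>_def)
        also have "(\<Sum>i\<in>Suc ` {..n + m'}. X1 z ^ i * X0 z ^ (n + m - i)) = X1 z * \<Phi> m' z"
          by (subst sum.reindex) (auto simp: \<Phi>_def m' sum_distrib_left mult_ac)
        finally show ?thesis .
      qed
      ultimately show False using z by simp
    qed
    moreover have "\<forall>k z. m' < k \<longrightarrow> k \<le> m \<longrightarrow> C k z = 0" using Cm m' by (metis le_antisym Suc_leI)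
    ultimately show ?thesis using m1 m' by (intro exI[of _ m']) auto
  qed
  then obtain K where K: "1 \<le> K" "K \<le> m" "entire_nz (C K)" "\<And>k z. K < k \<Longrightarrow> k \<le> m \<Longrightarrow> C k z = 0" by blast
  have key': "(\<Sum>k\<le>K. C k z * s z ^ k) = 0" if "S z \<noteq> 0" "f z - g z \<noteq> 0" for z
  proof -
    have "(\<Sum>k\<le>m. C k z * s z ^ k) = (\<Sum>k\<le>K. C k z * s z ^ k)"
      by (rule sum.mono_neutral_right) (use K in auto)
    thus ?thesis using key[OF that] by simp
  qed
  define M where "M = (\<lambda>z. 1 + norm (X0 z) + norm (X1 z))"
  have M1: "1 \<le> M z" "norm (X0 z) \<le> M z" "norm (X1 z) \<le> M z" for z by (auto simp: M_def)
  define B where "B = 1 + (\<Sum>k\<le>m. norm (c k) * real (n + k + 1))"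
  have B1: "1 \<le> B" by (simp add: B_def sum_nonneg)
  have CB: "norm (C k z) \<le> B * M z ^ (n + m)" if "k \<le> m" for k z
  proof -
    have "norm (\<Phi> k z) \<le> (\<Sum>i\<le>n + k. M z ^ (n + k))"
      unfolding \<Phi>_def
    proof (rule order_trans[OF norm_sum], rule sum_mono)
      fix i assume "i \<in> {..n + k}"
      have "norm (X1 z ^ i * X0 z ^ (n + k - i)) \<le> M z ^ i * M z ^ (n + k - i)"
        unfolding norm_mult norm_power using M1[of z] by (intro mult_mono power_mono) auto
      also have "\<dots> = M z ^ (n + k)" using \<open>i \<in> _\<close> by (simp flip: power_add)
      finally show "norm (X1 z ^ i * X0 z ^ (n + k - i)) \<le> M z ^ (n + k)" .
    qed
    hence Ph: "norm (\<Phi> k z) \<le> real (n + k + 1) * M z ^ (n + k)" by simp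
    have "norm (C k z) = norm (c k) * norm (\<Phi> k z) * norm (X0 z) ^ (m - k)"
      by (simp add: C_def norm_mult norm_power)
    also have "\<dots> \<le> norm (c k) * (real (n + k + 1) * M z ^ (n + k)) * M z ^ (m - k)"
      using M1[of z] by (intro mult_mono mult_left_mono Ph power_mono) auto
    also have "\<dots> = (norm (c k) * real (n + k + 1)) * M z ^ (n + m)"
    proof -
      have e: "n + k + (m - k) = n + m" using that by simp
      show ?thesis using power_add[of "M z" "n + k" "m - k", unfolded e] by (simp only: mult_ac)
    qed
    also have "\<dots> \<le> B * M z ^ (n + m)"
    proof (intro mult_right_mono)
      have "norm (c k) * real (n + k + 1) \<le> (\<Sum>k\<le>m. norm (c k) * real (n + k + 1))"
        using that by (intro member_le_sum) auto
      thus "norm (c k) * real (n + k + 1) \<le> B" by (simp add: B_def)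
    qed (use M1[of z] in auto)
    finally show ?thesis .
  qed
  have BM1: "1 \<le> B * M z ^ (n + m)" for z
    using mult_mono[of 1 B 1 "M z ^ (n + m)"] B1 one_le_power[OF M1(1)[of z], of "n + m"] by simp
  define G where "G = (\<lambda>z. (real K + 1) * (B * M z ^ (n + m)) ^ K)"
  define S' where "S' = (\<lambda>z. S z * (f z - g z))"
  have S': "entire_nz S'" unfolding S'_def by (rule entire_nz_mult[OF S fg])
  have Gcont: "continuous_on T G" for T
    unfolding G_def M_def by (intro continuous_intros entire_continuous X0 X1)
  have CKs: "norm (C K z * s z) \<le> G z" if "S' z \<noteq> 0" for z
    unfolding G_def
    by (rule top_coeff_bound[where C = "\<lambda>k. C k z"]) (use key'[of z] that K CB BM1 in \<open>auto simp: S'_def\<close>)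
  have Fhol: "(\<lambda>z. C K z * ?ga z) holomorphic_on UNIV" by (intro holomorphic_intros Chol g d_hol)
  have Fbd: "norm (C K z * ?ga z) \<le> G z * norm (d z)" if "S' z \<noteq> 0" for z
  proof -
    have dz: "d z \<noteq> 0" using that by (auto simp: S'_def S_def)
    have "norm (C K z * ?ga z) = norm (C K z * s z) * norm (d z)" using dz by (simp add: s_def norm_mult norm_divide)
    also have "\<dots> \<le> G z * norm (d z)" by (intro mult_right_mono CKs that) auto
    finally show ?thesis .
  qed
  obtain Y where Y: "Y holomorphic_on UNIV" "\<forall>w. C K w * ?ga w = Y w * d w"
    using entire_divide_bounded'[OF d Fhol S' Gcont Fbd] by blast
  define Z where "Z = (\<lambda>z. Y z + a * C K z)"
  have Zhol: "Z holomorphic_on UNIV" unfolding Z_def by (intro holomorphic_intros Y Chol)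
  have Zeq: "C K z * g z = Z z * d z" for z using Y(2)[rule_format, of z] by (simp add: Z_def algebra_simps)
  have f': "entire_nz f" using f_lin_nz[of 0] by simp
  have g': "entire_nz g" using sw.f_lin_nz[of 0] by simp
  define E where "E = zradii f \<union> zradii g \<union> zradii d \<union> zradii S \<union> zradii (D 0) \<union> zradii (D 1) \<union> zradii (C K) \<union> zradii S'"
  have E: "countable E" unfolding E_def by (intro countable_Un countable_zradii f' g' d S D K S')
  obtain C0 where C0: "\<And>r. growth E r \<Longrightarrow> cmean r (\<lambda>z. lnp (norm (X0 z))) \<le> C0 * (1 + ln (V r))"
    using X0(3)[rule_format, OF E] unfolding E_def by blast
  obtain C1 where C1: "\<And>r. growth E r \<Longrightarrow> cmean r (\<lambda>z. lnp (norm (X1 z))) \<le> C1 * (1 + ln (V r))"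
    using X1(3)[rule_format, OF E] unfolding E_def by blast
  obtain L where L: "\<And>z. d z \<noteq> 0 \<Longrightarrow> norm (d z) + norm (f z) \<le> L * (norm (d z) + norm (g z))"
    using comparable_pair[where A = 1] rel by auto
  \<comment> \<open>\<open>(C K, Z)\<close> represents \<open>g / d\<close> and is polynomially bounded in \<open>X0\<close> and \<open>X1\<close>.\<close>
  define J where "J = (n + m) * K + (n + m)"
  define H where "H = (real K + 1) * B ^ K + (1 + norm a) * B"
  have H1: "1 \<le> H"
  proof -
    have "1 * 1 \<le> (1 + norm a) * B" using B1 by (intro mult_mono) auto
    moreover have "0 \<le> (real K + 1) * B ^ K" using B1 by simp
    ultimately show ?thesis by (simp add: H_def)
  qed
  have tot: "norm (C K z) + norm (Z z) \<le> H * M z ^ J" if z: "S' z \<noteq> 0" for z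
  proof -
    have dz: "d z \<noteq> 0" using z by (auto simp: S'_def S_def)
    have "Y z = C K z * s z" using Y(2)[rule_format, of z] dz by (simp add: s_def field_simps)
    hence "norm (Y z) \<le> G z" using CKs[OF z] by simp
    also have "G z = (real K + 1) * B ^ K * M z ^ ((n + m) * K)"
      by (simp add: G_def power_mult_distrib power_mult)
    also have "\<dots> \<le> (real K + 1) * B ^ K * M z ^ J"
      using M1(1)[of z] B1 by (intro mult_left_mono power_increasing) (auto simp: J_def)
    finally have y: "norm (Y z) \<le> (real K + 1) * B ^ K * M z ^ J" .
    have "norm (C K z) \<le> B * M z ^ (n + m)" by (rule CB[OF K(2)])
    also have "\<dots> \<le> B * M z ^ J"
      using M1(1)[of z] B1 by (intro mult_left_mono power_increasing) (auto simp: J_def)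
    finally have ck: "norm (C K z) \<le> B * M z ^ J" .
    have "norm (C K z) + norm (Z z) \<le> norm (C K z) + (norm (Y z) + norm a * norm (C K z))"
      unfolding Z_def using norm_triangle_ineq[of "Y z" "a * C K z"] by (simp add: norm_mult)
    also have "\<dots> \<le> B * M z ^ J + ((real K + 1) * B ^ K * M z ^ J + norm a * (B * M z ^ J))"
      by (intro add_mono mult_left_mono y ck) auto
    also have "\<dots> = H * M z ^ J" by (simp add: H_def algebra_simps)
    finally show ?thesis .
  qed
  show False
  proof (rule no_small_representation[OF E _ _ K(3) Zhol Zeq L])
    fix r assume r: "growth E r"
    have r1: "1 \<le> r" "r \<notin> E" "1 \<le> V r" using r by (auto simp: growth_radius_def)
    have nz: "S' z \<noteq> 0" "C K z \<noteq> 0" if "norm z = r" for z using r1 that by (auto simp: E_def zradii_def)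
    let ?l0 = "\<lambda>z. lnp (norm (X0 z))" and ?l1 = "\<lambda>z. lnp (norm (X1 z))"
    have c0: "continuous_on (sphere 0 r) ?l0" and c1: "continuous_on (sphere 0 r) ?l1"
      by (intro continuous_on_lnp continuous_on_norm entire_continuous X0 X1)+
    have c01: "continuous_on (sphere 0 r) (\<lambda>z. real J * (?l0 z + ?l1 z))"
      by (intro continuous_on_mult continuous_on_add continuous_on_const c0 c1)
    define k where "k = ln H + real J * (2 * ln 2)"
    have k0: "0 \<le> k" using H1 by (simp add: k_def)
    have "cmean r (\<lambda>z. ln (norm (C K z) + norm (Z z))) \<le> cmean r (\<lambda>z. k + real J * (?l0 z + ?l1 z))"
    proof (rule cmean_mono)
      show "continuous_on (sphere 0 r) (\<lambda>z. ln (norm (C K z) + norm (Z z)))"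
        by (intro continuous_intros entire_continuous Chol Zhol) (use nz in \<open>auto simp: add_nonneg_eq_0_iff\<close>)
      show "continuous_on (sphere 0 r) (\<lambda>z. k + real J * (?l0 z + ?l1 z))"
        by (intro continuous_on_add continuous_on_const c01)
      fix z :: complex assume z: "norm z = r"
      have "0 < norm (C K z) + norm (Z z)" using nz(2)[OF z] by (simp add: add_pos_nonneg)
      hence "ln (norm (C K z) + norm (Z z)) \<le> ln (H * M z ^ J)" by (intro ln_mono tot nz(1)[OF z])
      also have "\<dots> = ln H + real J * ln (M z)" using H1 M1(1)[of z] by (simp add: ln_mult ln_realpow)
      also have "ln (M z) = lnp (1 + (norm (X0 z) + norm (X1 z)))"
        using M1(1)[of z] by (simp add: M_def lnp_eq_ln add.assoc)
      also have "real J * \<dots> \<le> real J * (2 * ln 2 + (?l0 z + ?l1 z))"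
      proof (intro mult_left_mono)
        have "lnp (1 + (norm (X0 z) + norm (X1 z))) \<le> lnp 1 + lnp (norm (X0 z) + norm (X1 z)) + ln 2" by (rule lnp_add) auto
        moreover have "lnp (norm (X0 z) + norm (X1 z)) \<le> ?l0 z + ?l1 z + ln 2" by (rule lnp_add) auto
        moreover have "lnp 1 = 0" by (simp add: lnp_def)
        ultimately show "lnp (1 + (norm (X0 z) + norm (X1 z))) \<le> 2 * ln 2 + (?l0 z + ?l1 z)" by linarith
      qed auto
      finally show "ln (norm (C K z) + norm (Z z)) \<le> k + real J * (?l0 z + ?l1 z)" by (simp add: k_def algebra_simps)
    qed (use r1 in auto)
    also have "\<dots> = k + real J * (cmean r ?l0 + cmean r ?l1)"
    proof -
      have r0: "0 \<le> r" using r1 by simp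
      show ?thesis by (simp only: cmean_add[OF continuous_on_const c01 r0] cmean_cmult cmean_add[OF c0 c1 r0] cmean_const)
    qed
    also have "\<dots> \<le> k + real J * (C0 * (1 + ln (V r)) + C1 * (1 + ln (V r)))"
      by (intro add_left_mono mult_left_mono add_mono C0 C1 r) auto
    also have "\<dots> \<le> (k + real J * (C0 + C1)) * (1 + ln (V r))"
    proof -
      have "0 \<le> k * ln (V r)" using r1 k0 by simp
      thus ?thesis by (simp add: algebra_simps)
    qed
    finally show "cmean r (\<lambda>z. ln (norm (C K z) + norm (Z z))) \<le> (k + real J * (C0 + C1)) * (1 + ln (V r))" .
  qed (auto simp: E_def)
qed

end

section \<open>A second main theorem with ramification\<close>

text \<open>
  A point \<open>x\<close> is close to at most one element of \<open>Z\<close>, so at least one of the products on the right omits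
  all small factors.
\<close>
lemma partial_fraction_lower:
  fixes Z :: "complex set"
  assumes Z: "finite Z" "Z \<noteq> {}"
  shows "\<exists>C\<ge>0. \<forall>x. (1 + norm x) ^ (card Z - 1) \<le> C * (\<Sum>\<tau>\<in>Z. \<Prod>\<sigma>\<in>Z - {\<tau>}. norm (x - \<sigma>))"
proof -
  define D where "D = insert 1 ((\<lambda>(\<sigma>, \<tau>). dist \<sigma> \<tau>) ` {x \<in> Z \<times> Z. fst x \<noteq> snd x})"
  have finD: "finite D" unfolding D_def by (intro finite.insertI finite_imageI finite_Collect_conjI finite_cartesian_product Z disjI1) (use Z in auto)
  define \<delta> where "\<delta> = Min D / 2"
  have "Min D \<in> D" by (rule Min_in[OF finD]) (auto simp: D_def)
  hence \<delta>: "0 < \<delta>" by (auto simp: D_def \<delta>_def)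
  have sep: "2 * \<delta> \<le> dist \<sigma> \<tau>" if "\<sigma> \<in> Z" "\<tau> \<in> Z" "\<sigma> \<noteq> \<tau>" for \<sigma> \<tau>
  proof -
    have "dist \<sigma> \<tau> \<in> D" unfolding D_def by (intro insertI2 image_eqI[of _ _ "(\<sigma>, \<tau>)"]) (use that in auto)
    thus ?thesis using Min_le[OF finD] by (simp add: \<delta>_def)
  qed
  have "\<forall>\<tau>\<in>Z. \<exists>c>0. \<forall>z. (\<forall>\<sigma>\<in>Z - {\<tau>}. \<delta> \<le> norm (z - \<sigma>)) \<longrightarrow> c * (1 + norm z) ^ card (Z - {\<tau>}) \<le> (\<Prod>\<sigma>\<in>Z - {\<tau>}. norm (z - \<sigma>))"
    using prod_far_lower[OF _ \<delta>] Z(1) by blast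
  then obtain c where c: "\<And>\<tau>. \<tau> \<in> Z \<Longrightarrow> 0 < c \<tau>" "\<And>\<tau> z. \<tau> \<in> Z \<Longrightarrow> (\<forall>\<sigma>\<in>Z - {\<tau>}. \<delta> \<le> norm (z - \<sigma>)) \<Longrightarrow>
      c \<tau> * (1 + norm z) ^ card (Z - {\<tau>}) \<le> (\<Prod>\<sigma>\<in>Z - {\<tau>}. norm (z - \<sigma>))"
    by metis
  show ?thesis
  proof (rule exI[of _ "\<Sum>\<tau>\<in>Z. 1 / c \<tau>"], intro conjI allI)
    show "0 \<le> (\<Sum>\<tau>\<in>Z. 1 / c \<tau>)" using c(1) by (intro sum_nonneg) (simp add: less_imp_le)
    fix x
    have "\<exists>\<tau>\<in>Z. \<forall>\<sigma>\<in>Z - {\<tau>}. \<delta> \<le> norm (x - \<sigma>)"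
    proof (cases "\<exists>\<tau>\<in>Z. norm (x - \<tau>) < \<delta>")
      case True
      then obtain \<tau> where t: "\<tau> \<in> Z" "norm (x - \<tau>) < \<delta>" by blast
      have "\<delta> \<le> norm (x - \<sigma>)" if "\<sigma> \<in> Z - {\<tau>}" for \<sigma>
        using sep[of \<sigma> \<tau>] that t norm_triangle_ineq[of "\<sigma> - x" "x - \<tau>"] by (auto simp: dist_norm norm_minus_commute)
      thus ?thesis using t(1) by blast
    next
      case False thus ?thesis using Z(2) by force
    qed
    then obtain \<tau> where t: "\<tau> \<in> Z" "\<forall>\<sigma>\<in>Z - {\<tau>}. \<delta> \<le> norm (x - \<sigma>)" by blast
    let ?p = "\<lambda>\<tau>. \<Prod>\<sigma>\<in>Z - {\<tau>}. norm (x - \<sigma>)"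
    have "(1 + norm x) ^ (card Z - 1) \<le> 1 / c \<tau> * ?p \<tau>"
      using c(2)[OF t] c(1)[OF t(1)] t(1) Z(1) by (simp add: field_simps)
    also have "\<dots> \<le> (\<Sum>\<tau>\<in>Z. 1 / c \<tau>) * (\<Sum>\<tau>\<in>Z. ?p \<tau>)"
    proof (intro mult_mono)
      show "1 / c \<tau> \<le> (\<Sum>\<tau>\<in>Z. 1 / c \<tau>)" using t Z(1) c(1) by (intro member_le_sum) (auto simp: less_imp_le)
      show "?p \<tau> \<le> (\<Sum>\<tau>\<in>Z. ?p \<tau>)" using t Z(1) by (intro member_le_sum) (auto intro: prod_nonneg)
      show "0 \<le> (\<Sum>\<tau>\<in>Z. 1 / c \<tau>)" using c(1) by (intro sum_nonneg) (simp add: less_imp_le)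
    qed (auto intro: prod_nonneg)
    finally show "(1 + norm x) ^ (card Z - 1) \<le> (\<Sum>\<tau>\<in>Z. 1 / c \<tau>) * (\<Sum>\<tau>\<in>Z. ?p \<tau>)" .
  qed
qed

context pair_poly
begin

text \<open>
  The homogenization of \<open>p\<close>, evaluated at \<open>(F, d)\<close>. Unlike \<open>P (F / d)\<close> it is entire, and if \<open>F\<close> and \<open>d\<close> have no
  common zero, it does not vanish at the poles of \<open>F / d\<close>.
\<close>
definition hom :: "(complex \<Rightarrow> complex) \<Rightarrow> complex \<Rightarrow> complex" where
  "hom F z = lead_coeff p * (\<Prod>\<tau>\<in>roots. F z - \<tau> * d z)"

text \<open>
  The derivative of \<open>P (F / d)\<close>, multiplied by \<open>d ^ (q + 1)\<close>.
\<close>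
definition ldiff :: "(complex \<Rightarrow> complex) \<Rightarrow> complex \<Rightarrow> complex" where
  "ldiff F z = (F z - a * d z) ^ n * (F z - b * d z) ^ m * wronskian F d z"

lemma hom_affine: "d z \<noteq> 0 \<Longrightarrow> hom F z = d z ^ q * P (F z / d z)"
proof -
  assume z: "d z \<noteq> 0"
  have "(\<Prod>\<tau>\<in>roots. F z - \<tau> * d z) = (\<Prod>\<tau>\<in>roots. d z * (F z / d z - \<tau>))"
    using z by (intro prod.cong) (auto simp: field_simps)
  also have "\<dots> = d z ^ q * (\<Prod>\<tau>\<in>roots. F z / d z - \<tau>)" by (simp only: prod.distrib prod_constant card_roots)
  finally show ?thesis by (simp add: hom_def P_factor mult_ac)
qed

lemma hom_at_zero: "d z = 0 \<Longrightarrow> hom F z = lead_coeff p * F z ^ q"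
  by (simp only: hom_def mult_zero_right diff_zero prod_constant card_roots)

lemma hom_hol: "F holomorphic_on UNIV \<Longrightarrow> hom F holomorphic_on UNIV"
  unfolding hom_def by (intro holomorphic_intros d_hol)

lemma ldiff_hol: "F holomorphic_on UNIV \<Longrightarrow> ldiff F holomorphic_on UNIV"
  unfolding ldiff_def by (intro holomorphic_intros wronskian_hol d_hol)

lemma hom_f_nz: "entire_nz (hom f)"
  unfolding hom_def using p_nz
  by (intro entire_nz_mult entire_nz_const entire_nz_prod finite_roots f_lin_nz) auto

lemma hom_f_zero:
  assumes "hom f z = 0"
  shows "d z \<noteq> 0" "f z - a * d z \<noteq> 0" "f z - b * d z \<noteq> 0"
proof -
  show dz: "d z \<noteq> 0"
  proof
    assume "d z = 0"
    hence "f z ^ q = 0" using assms hom_at_zero[of z f] p_nz by simp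
    hence "f z = 0" by (simp only: power_eq_0_iff)
    thus False using cop_f[of z] \<open>d z = 0\<close> by simp
  qed
  hence "P (f z / d z) = 0" using assms hom_affine[OF dz, of f] by simp
  hence "f z / d z \<noteq> a" "f z / d z \<noteq> b" using pa pb by auto
  thus "f z - a * d z \<noteq> 0" "f z - b * d z \<noteq> 0" using dz by (auto simp: field_simps)
qed

text \<open>
  This expresses \<open>d^(q + 1) * (P (F / d))'\<close> through \<open>hom F = d^q * P (F / d)\<close>. The identity is clear off the
  zeros of \<open>d\<close> and extends to them.
\<close>
lemma ldiff_eq:
  assumes F: "F holomorphic_on UNIV"
  shows "ldiff F z = deriv (hom F) z * d z - of_nat q * hom F z * deriv d z"
proof -
  have "ldiff F = (\<lambda>z. deriv (hom F) z * d z - of_nat q * hom F z * deriv d z)"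
  proof (rule entire_eq_offI[OF d ldiff_hol[OF F]])
    fix z assume z: "d z \<noteq> 0"
    have 1: "((\<lambda>z. P (F z / d z)) has_field_derivative poly (pderiv p) (F z / d z) * (wronskian F d z / d z ^ 2)) (at z)"
      by (rule DERIV_chain2[OF poly_DERIV quotient_deriv[OF F z]])
    have 2: "((\<lambda>z. d z ^ q) has_field_derivative of_nat q * (deriv d z * d z ^ (q - Suc 0))) (at z)"
      by (rule DERIV_power[OF entire_has_deriv[OF d_hol]])
    have "eventually (\<lambda>w. d w \<noteq> 0) (nhds z)"
      using entire_open_nz[OF d_hol] z by (auto simp: eventually_nhds)
    hence ev: "eventually (\<lambda>w. d w ^ q * P (F w / d w) = hom F w) (nhds z)"
      by eventually_elim (rule hom_affine[symmetric])
    have "((\<lambda>w. d w ^ q * P (F w / d w)) has_field_derivative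
        of_nat q * (deriv d z * d z ^ (q - Suc 0)) * P (F z / d z) +
        poly (pderiv p) (F z / d z) * (wronskian F d z / d z ^ 2) * d z ^ q) (at z)"
      by (rule DERIV_mult[OF 2 1])
    hence "(hom F has_field_derivative
        of_nat q * (deriv d z * d z ^ (q - Suc 0)) * P (F z / d z) +
        poly (pderiv p) (F z / d z) * (wronskian F d z / d z ^ 2) * d z ^ q) (at z)"
      by (simp only: DERIV_cong_ev[OF refl ev refl])
    hence D: "deriv (hom F) z = of_nat q * (deriv d z * d z ^ (q - Suc 0)) * P (F z / d z) +
        poly (pderiv p) (F z / d z) * (wronskian F d z / d z ^ 2) * d z ^ q"
      by (rule DERIV_imp_deriv)
    have e: "F z - a * d z = d z * (F z / d z - a)" "F z - b * d z = d z * (F z / d z - b)"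
      using z by (auto simp: field_simps)
    define N where "N = m + n"
    have dq: "d z ^ q = d z ^ n * d z ^ m * d z" "d z ^ (q - Suc 0) = d z ^ n * d z ^ m"
      by (simp_all add: power_add mult_ac)
    show "ldiff F z = deriv (hom F) z * d z - of_nat q * hom F z * deriv d z"
      unfolding D hom_affine[OF z] ldiff_def e poly_pderiv_p dq power_mult_distrib
      using z by (simp add: power2_eq_square algebra_simps del: of_nat_add of_nat_Suc)
  qed (intro holomorphic_intros entire_deriv hom_hol F d_hol)
  thus ?thesis by (rule fun_cong)
qed

text \<open>
  The second main theorem for the targets \<open>a\<close>, \<open>b\<close>, the zeros of \<open>P\<close> and infinity, with the ramification
  term \<open>W\<close> kept. It is the mean of a pointwise estimate:
  by \<open>partial_fraction_lower\<close>, \<open>(norm d + norm f)^(q + 1)\<close> times \<open>norm W\<close> is at most the product of all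
  \<open>norm (f - \<tau> d)\<close> and \<open>norm d\<close>, times the sum over \<open>\<tau>\<close> of the logarithmic derivatives of \<open>f / d - \<tau>\<close>.
\<close>
lemma second_main_theorem:
  assumes E: "countable E" "zradii d \<subseteq> E" "zradii (wronskian f d) \<subseteq> E"
    "\<And>\<tau>. \<tau> \<in> insert a (insert b roots) \<Longrightarrow> zradii (\<lambda>z. f z - \<tau> * d z) \<subseteq> E"
  shows "\<exists>C. \<forall>r. growth E r \<longrightarrow>
    (real q + 1) * cmean r (\<lambda>z. ln (norm (d z) + norm (f z))) + lmean r (wronskian f d) \<le>
    lmean r (hom f) + (lmean r (\<lambda>z. f z - a * d z) + (lmean r (\<lambda>z. f z - b * d z) + lmean r d)) + C * (1 + ln (V r))"
proof -
  define Z where "Z = insert a (insert b roots)"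
  have Z: "finite Z" "Z \<noteq> {}" "card Z = q + 2"
    using finite_roots a_notin_roots ab card_roots by (auto simp: Z_def)
  let ?l = "\<lambda>\<tau> z. f z - \<tau> * d z"
  let ?LD = "\<lambda>\<tau> z. norm (deriv (?l \<tau>) z / ?l \<tau> z - deriv d z / d z)"
  obtain C0 where C0: "0 \<le> C0" "\<And>x. (1 + norm x) ^ (card Z - 1) \<le> C0 * (\<Sum>\<tau>\<in>Z. \<Prod>\<sigma>\<in>Z - {\<tau>}. norm (x - \<sigma>))"
    using partial_fraction_lower[OF Z(1,2)] by blast
  have ex: "\<exists>C\<ge>0. \<forall>r \<rho>. growth E r \<longrightarrow> r \<le> \<rho> \<longrightarrow> \<rho> < r + 1/2 * r / V r \<longrightarrow> \<rho> \<notin> E \<longrightarrow>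
     cmean \<rho> (\<lambda>z. lnp (?LD \<tau> z)) \<le> C * (1 + ln (V r))" if "\<tau> \<in> Z" for \<tau>
  proof (rule logderiv_small[OF f_lin_nz d E(1) _ E(2)])
    show "zradii (\<lambda>z. f z - \<tau> * d z) \<subseteq> E" using E(4) that by (simp add: Z_def)
    show "norm (f z - \<tau> * d z) + norm (d z) \<le> (2 + norm \<tau>) * size z ^ 1" for z
    proof -
      have "norm (f z - \<tau> * d z) \<le> (1 + norm \<tau>) * size z"
        by (rule order_trans[OF norm_f_lin_le]) (intro mult_left_mono df_le_size, simp)
      moreover have "norm (d z) \<le> size z" by (simp add: size_def)
      ultimately show ?thesis by (simp add: algebra_simps)
    qed
    show "0 < 2 + norm \<tau>" by (simp add: add_pos_nonneg)
  qed
  have ex2: "\<forall>\<tau>\<in>Z. \<exists>C. \<forall>r. growth E r \<longrightarrow> cmean r (\<lambda>z. lnp (?LD \<tau> z)) \<le> C * (1 + ln (V r))"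
  proof
    fix \<tau> assume t: "\<tau> \<in> Z"
    show "\<exists>C. \<forall>r. growth E r \<longrightarrow> cmean r (\<lambda>z. lnp (?LD \<tau> z)) \<le> C * (1 + ln (V r))"
    proof -
      obtain C where C: "\<forall>r \<rho>. growth E r \<longrightarrow> r \<le> \<rho> \<longrightarrow> \<rho> < r + 1/2 * r / V r \<longrightarrow> \<rho> \<notin> E \<longrightarrow>
        cmean \<rho> (\<lambda>z. lnp (?LD \<tau> z)) \<le> C * (1 + ln (V r))" using ex[OF t] by blast
      have "cmean r (\<lambda>z. lnp (?LD \<tau> z)) \<le> C * (1 + ln (V r))" if "growth E r" for r
      proof -
        have "1 \<le> r" "r \<notin> E" "1 \<le> V r" using that by (auto simp: growth_radius_def)
        hence "r < r + 1/2 * r / V r" by simp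
        thus ?thesis using C that \<open>r \<notin> E\<close> by blast
      qed
      thus ?thesis by blast
    qed
  qed
  from bchoice[OF ex2] obtain CC where CC': "\<forall>\<tau>\<in>Z. \<forall>r. growth E r \<longrightarrow> cmean r (\<lambda>z. lnp (?LD \<tau> z)) \<le> CC \<tau> * (1 + ln (V r))" ..
  note CC = CC'[rule_format]
  define k where "k = lnp C0 + real (card Z) * ln 2 + \<bar>ln (norm (lead_coeff p))\<bar>"
  have k0: "0 \<le> k" by (simp add: k_def)
  show ?thesis
  proof (rule exI[of _ "k + (\<Sum>\<tau>\<in>Z. CC \<tau>)"], intro allI impI)
    fix r assume r: "growth E r"
    have r1: "1 \<le> r" "r \<notin> E" "1 \<le> V r" "0 \<le> r" using r by (auto simp: growth_radius_def)
    have nzG: "F z \<noteq> 0" if "norm z = r" "zradii F \<subseteq> E" for F z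
      using zradii_notin[of r F z] that r1 by auto
    have nz: "d z \<noteq> 0" "wronskian f d z \<noteq> 0" "\<And>\<tau>. \<tau> \<in> Z \<Longrightarrow> f z - \<tau> * d z \<noteq> 0" if "norm z = r" for z
      using nzG[OF that E(2)] nzG[OF that E(3)] nzG[OF that E(4)] unfolding Z_def by blast+
    have nzh: "hom f z \<noteq> 0" if "norm z = r" for z
      using nz(3)[OF that] p_nz finite_roots by (auto simp: hom_def Z_def)
    let ?W = "wronskian f d"
    have pt: "(real q + 1) * ln (norm (d z) + norm (f z)) + ln (norm (?W z)) \<le>
       (ln (norm (hom f z)) + (ln (norm (?l a z)) + (ln (norm (?l b z)) + ln (norm (d z))))) + (k + (\<Sum>\<tau>\<in>Z. lnp (?LD \<tau> z)))"
      if z: "norm z = r" for z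
    proof -
      note nz = nz[OF z]
      define D where "D = norm (d z)"
      define Pr where "Pr = (\<Prod>\<sigma>\<in>Z. norm (?l \<sigma> z))"
      have D: "0 < D" using nz by (simp add: D_def)
      have Pr: "0 < Pr" unfolding Pr_def by (intro prod_pos) (use nz in auto)
      have W: "0 < norm (?W z)" using nz by simp
      have sc: "norm (?l \<tau> z) = D * norm (f z / d z - \<tau>)" for \<tau>
      proof -
        have "?l \<tau> z = d z * (f z / d z - \<tau>)" using nz by (simp add: field_simps)
        thus ?thesis by (simp only: norm_mult D_def)
      qed
      have s1: "norm (d z) + norm (f z) = D * (1 + norm (f z / d z))"
        using nz by (simp add: D_def norm_divide distrib_left)
      have ld: "?LD \<tau> z = norm (?W z) / (norm (?l \<tau> z) * D)" if "\<tau> \<in> Z" for \<tau>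
        using logderiv_diff_wronskian[of "?l \<tau>" z d] nz(1) nz(3)[OF that] wronskian_minus[OF f d_hol, of \<tau>]
        by (simp add: norm_divide norm_mult D_def)
      have "(norm (d z) + norm (f z)) ^ (q + 1) = D ^ (q + 1) * (1 + norm (f z / d z)) ^ (q + 1)"
        unfolding s1 power_mult_distrib ..
      also have "\<dots> \<le> D ^ (q + 1) * (C0 * (\<Sum>\<tau>\<in>Z. \<Prod>\<sigma>\<in>Z - {\<tau>}. norm (f z / d z - \<sigma>)))"
        using C0(2)[of "f z / d z"] D Z(3) by (intro mult_left_mono) auto
      also have "\<dots> = C0 * (\<Sum>\<tau>\<in>Z. D ^ (q + 1) * (\<Prod>\<sigma>\<in>Z - {\<tau>}. norm (f z / d z - \<sigma>)))"
        by (simp only: sum_distrib_left mult_ac)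
      also have "(\<Sum>\<tau>\<in>Z. D ^ (q + 1) * (\<Prod>\<sigma>\<in>Z - {\<tau>}. norm (f z / d z - \<sigma>))) = (\<Sum>\<tau>\<in>Z. Pr / norm (?l \<tau> z))"
      proof (rule sum.cong)
        fix \<tau> assume t: "\<tau> \<in> Z"
        have "card (Z - {\<tau>}) = q + 1" using t Z by simp
        hence "D ^ (q + 1) * (\<Prod>\<sigma>\<in>Z - {\<tau>}. norm (f z / d z - \<sigma>)) = (\<Prod>\<sigma>\<in>Z - {\<tau>}. D * norm (f z / d z - \<sigma>))"
          by (simp only: prod.distrib prod_constant)
        also have "\<dots> = (\<Prod>\<sigma>\<in>Z - {\<tau>}. norm (?l \<sigma> z))" by (simp only: sc)
        also have "\<dots> = Pr / norm (?l \<tau> z)"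
          using nz(3)[OF t] Z(1) t unfolding Pr_def by (simp add: prod.remove[of Z \<tau>])
        finally show "D ^ (q + 1) * (\<Prod>\<sigma>\<in>Z - {\<tau>}. norm (f z / d z - \<sigma>)) = Pr / norm (?l \<tau> z)" .
      qed simp
      finally have "(norm (d z) + norm (f z)) ^ (q + 1) * norm (?W z) \<le> C0 * (\<Sum>\<tau>\<in>Z. Pr / norm (?l \<tau> z)) * norm (?W z)"
        by (intro mult_right_mono) auto
      also have "\<dots> = C0 * (\<Sum>\<tau>\<in>Z. (Pr * D) * ?LD \<tau> z)"
        unfolding mult.assoc sum_distrib_right
      proof (intro arg_cong[where f = "\<lambda>x. C0 * x"] sum.cong refl)
        fix \<tau> assume "\<tau> \<in> Z"
        thus "Pr / norm (?l \<tau> z) * norm (?W z) = Pr * (D * ?LD \<tau> z)" using ld D by simp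
      qed
      also have "\<dots> = (Pr * D) * (C0 * (\<Sum>\<tau>\<in>Z. ?LD \<tau> z))" by (simp only: sum_distrib_left mult_ac)
      finally have le: "(norm (d z) + norm (f z)) ^ (q + 1) * norm (?W z) \<le> (Pr * D) * (C0 * (\<Sum>\<tau>\<in>Z. ?LD \<tau> z))" .
      have lhs: "0 < (norm (d z) + norm (f z)) ^ (q + 1) * norm (?W z)"
        using df_pos[of z] W by simp
      have R0: "0 < C0 * (\<Sum>\<tau>\<in>Z. ?LD \<tau> z)"
        by (rule zero_less_mult_pos[OF less_le_trans[OF lhs le]]) (use Pr D in simp)
      have "ln ((norm (d z) + norm (f z)) ^ (q + 1) * norm (?W z)) \<le> ln ((Pr * D) * (C0 * (\<Sum>\<tau>\<in>Z. ?LD \<tau> z)))"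
        by (rule ln_mono[OF le lhs])
      also have "\<dots> = ln Pr + ln D + ln (C0 * (\<Sum>\<tau>\<in>Z. ?LD \<tau> z))"
        using Pr D R0 by (simp only: ln_mult_pos mult_pos_pos)
      also have "ln (C0 * (\<Sum>\<tau>\<in>Z. ?LD \<tau> z)) \<le> lnp (C0 * (\<Sum>\<tau>\<in>Z. ?LD \<tau> z))" by (rule ln_le_lnp[OF R0])
      also have "\<dots> \<le> lnp C0 + lnp (\<Sum>\<tau>\<in>Z. ?LD \<tau> z)" using C0(1) by (intro lnp_mult sum_nonneg) auto
      also have "lnp (\<Sum>\<tau>\<in>Z. ?LD \<tau> z) \<le> (\<Sum>\<tau>\<in>Z. lnp (?LD \<tau> z)) + card Z * ln 2" using Z(1) by (intro lnp_sum) auto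
      finally have 1: "ln ((norm (d z) + norm (f z)) ^ (q + 1) * norm (?W z)) \<le>
         ln Pr + ln D + (lnp C0 + ((\<Sum>\<tau>\<in>Z. lnp (?LD \<tau> z)) + card Z * ln 2))" by linarith
      have 2: "ln ((norm (d z) + norm (f z)) ^ (q + 1) * norm (?W z)) = (real q + 1) * ln (norm (d z) + norm (f z)) + ln (norm (?W z))"
      proof -
        have "real (q + 1) = real q + 1" by simp
        thus ?thesis unfolding ln_mult_pos[OF zero_less_power[OF df_pos] W] ln_realpow by (simp only:)
      qed
      have 3: "ln Pr + ln (norm (lead_coeff p)) = ln (norm (hom f z)) + (ln (norm (?l a z)) + ln (norm (?l b z)))"
      proof -
        have pr: "Pr = norm (?l a z) * (norm (?l b z) * (\<Prod>\<sigma>\<in>roots. norm (?l \<sigma> z)))"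
          unfolding Pr_def Z_def using finite_roots a_notin_roots ab by simp
        have "norm (hom f z) = norm (lead_coeff p) * (\<Prod>\<sigma>\<in>roots. norm (?l \<sigma> z))"
          by (simp add: hom_def norm_mult prod_norm)
        hence "Pr * norm (lead_coeff p) = norm (hom f z) * (norm (?l a z) * norm (?l b z))" using pr by simp
        hence "ln (Pr * norm (lead_coeff p)) = ln (norm (hom f z) * (norm (?l a z) * norm (?l b z)))" by simp
        thus ?thesis using Pr nzh[OF z] nz(3)[of a] nz(3)[of b] p_nz by (simp add: ln_mult Z_def)
      qed
      show ?thesis using 1 3 unfolding 2 k_def D_def by linarith
    qed
    have hl: "?l \<tau> holomorphic_on UNIV" for \<tau> by (intro holomorphic_intros f d_hol)
    have c1: "continuous_on (sphere 0 r) (\<lambda>z. (real q + 1) * ln (norm (d z) + norm (f z)))"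
      by (intro continuous_on_mult continuous_on_const cont_ln_df)
    have c2: "continuous_on (sphere 0 r) (\<lambda>z. ln (norm (?W z)))"
      by (rule continuous_on_ln_norm) (use nz Wf in auto)
    have c3: "continuous_on (sphere 0 r) (\<lambda>z. ln (norm (hom f z)))"
      by (rule continuous_on_ln_norm) (use nzh hom_hol f in auto)
    have c4: "continuous_on (sphere 0 r) (\<lambda>z. ln (norm (?l a z)))"
      by (rule continuous_on_ln_norm[OF hl]) (use nz(3) in \<open>auto simp: Z_def\<close>)
    have c5: "continuous_on (sphere 0 r) (\<lambda>z. ln (norm (?l b z)))"
      by (rule continuous_on_ln_norm[OF hl]) (use nz(3) in \<open>auto simp: Z_def\<close>)
    have c6: "continuous_on (sphere 0 r) (\<lambda>z. ln (norm (d z)))"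
      by (rule continuous_on_ln_norm[OF d_hol]) (use nz in auto)
    have c7: "continuous_on (sphere 0 r) (\<lambda>z. lnp (?LD \<tau> z))" if "\<tau> \<in> Z" for \<tau>
      by (intro continuous_on_lnp continuous_on_norm continuous_on_diff continuous_on_divide entire_continuous entire_deriv hl d_hol)
         (use nz that in auto)
    have c8: "continuous_on (sphere 0 r) (\<lambda>z. \<Sum>\<tau>\<in>Z. lnp (?LD \<tau> z))" by (rule continuous_on_sum) (rule c7)
    note ca = continuous_on_add[OF c3 continuous_on_add[OF c4 continuous_on_add[OF c5 c6]]]
    note cb = continuous_on_add[OF continuous_on_const[of _ k] c8]
    have "cmean r (\<lambda>z. (real q + 1) * ln (norm (d z) + norm (f z)) + ln (norm (?W z))) \<le>
       cmean r (\<lambda>z. (ln (norm (hom f z)) + (ln (norm (?l a z)) + (ln (norm (?l b z)) + ln (norm (d z))))) + (k + (\<Sum>\<tau>\<in>Z. lnp (?LD \<tau> z))))"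
      by (rule cmean_mono[OF continuous_on_add[OF c1 c2] continuous_on_add[OF ca cb] r1(4) pt])
    also have "\<dots> = (lmean r (hom f) + (lmean r (?l a) + (lmean r (?l b) + lmean r d))) + (k + (\<Sum>\<tau>\<in>Z. cmean r (\<lambda>z. lnp (?LD \<tau> z))))"
      using cmean_sum[of Z r "\<lambda>\<tau> z. lnp (?LD \<tau> z)", OF c7 r1(4) Z(1)]
      by (simp only: cmean_add[OF ca cb r1(4)] cmean_add[OF c3 continuous_on_add[OF c4 continuous_on_add[OF c5 c6]] r1(4)]
         cmean_add[OF c4 continuous_on_add[OF c5 c6] r1(4)] cmean_add[OF c5 c6 r1(4)]
         cmean_add[OF continuous_on_const c8 r1(4)] cmean_const)
    also have "cmean r (\<lambda>z. (real q + 1) * ln (norm (d z) + norm (f z)) + ln (norm (?W z))) =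
        (real q + 1) * cmean r (\<lambda>z. ln (norm (d z) + norm (f z))) + lmean r ?W"
      by (simp only: cmean_add[OF c1 c2 r1(4)] cmean_cmult)
    finally have fin: "(real q + 1) * cmean r (\<lambda>z. ln (norm (d z) + norm (f z))) + lmean r ?W \<le>
       (lmean r (hom f) + (lmean r (?l a) + (lmean r (?l b) + lmean r d))) + (k + (\<Sum>\<tau>\<in>Z. cmean r (\<lambda>z. lnp (?LD \<tau> z))))" .
    have "(\<Sum>\<tau>\<in>Z. cmean r (\<lambda>z. lnp (?LD \<tau> z))) \<le> (\<Sum>\<tau>\<in>Z. CC \<tau> * (1 + ln (V r)))"
      by (intro sum_mono CC r)
    also have "\<dots> = (\<Sum>\<tau>\<in>Z. CC \<tau>) * (1 + ln (V r))" by (simp only: sum_distrib_right)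
    finally have s: "(\<Sum>\<tau>\<in>Z. cmean r (\<lambda>z. lnp (?LD \<tau> z))) \<le> (\<Sum>\<tau>\<in>Z. CC \<tau>) * (1 + ln (V r))" .
    have "0 \<le> k * ln (V r)" using k0 r1 by simp
    hence "k + (\<Sum>\<tau>\<in>Z. CC \<tau>) * (1 + ln (V r)) \<le> (k + (\<Sum>\<tau>\<in>Z. CC \<tau>)) * (1 + ln (V r))" by (simp add: algebra_simps)
    thus "(real q + 1) * cmean r (\<lambda>z. ln (norm (d z) + norm (f z))) + lmean r ?W \<le>
       lmean r (hom f) + (lmean r (?l a) + (lmean r (?l b) + lmean r d)) + (k + (\<Sum>\<tau>\<in>Z. CC \<tau>)) * (1 + ln (V r))"
      using fin s by linarith
  qed
qed

end

section \<open>Functions sharing the zeros of P\<close>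

context crit_poly
begin

text \<open>
  Otherwise \<open>P - w\<close> would be a \<open>q\<close>-th power of a linear factor, and \<open>P\<close> would have one critical point only.
\<close>
lemma two_distinct_preimages: "\<exists>x y. x \<noteq> y \<and> P x = w \<and> P y = w"
proof -
  define r where "r = p - [:w:]"
  have dr: "pderiv r = pderiv p" by (simp add: r_def pderiv_diff)
  have "degree (p + (- [:w:])) = degree p" by (rule degree_add_eq_left) (simp add: degree_p)
  hence degr: "degree r = q" unfolding r_def diff_conv_add_uminus degree_p .
  have rnz: "r \<noteq> 0" using degr by auto
  have "\<not> constant (poly r)" using degr constant_degree[of r] by simp
  then obtain x where x: "poly r x = 0" using fundamental_theorem_of_algebra by blast
  show ?thesis
  proof (rule ccontr)
    assume neg: "\<not> ?thesis"
    have only: "y = x" if "poly r y = 0" for y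
      using neg that x unfolding r_def by auto
    obtain s where s: "r = [:-x, 1:] ^ order x r * s" "\<not> [:-x, 1:] dvd s" using order_decomp[OF rnz] by blast
    have "poly s y \<noteq> 0" for y
    proof
      assume y: "poly s y = 0"
      hence "poly r y = 0" by (subst s(1)) simp
      hence "y = x" by (rule only)
      thus False using y s(2) by (simp add: poly_eq_0_iff_dvd)
    qed
    hence "constant (poly s)" using fundamental_theorem_of_algebra by blast
    hence "degree s = 0" by (simp add: constant_degree)
    then obtain c where c: "s = [:c:]" by (metis degree_eq_zeroE)
    define k where "k = order x r"
    have r_eq: "r = [:-x, 1:] ^ k * [:c:]" using s(1) c unfolding k_def by simp
    have c0: "c \<noteq> 0" using rnz r_eq by auto
    have "degree r = degree ([:-x, 1:] ^ k) + degree [:c:]"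
      using rnz c0 unfolding r_eq by (intro degree_mult_eq) auto
    hence k: "k = q" using degr by (simp add: degree_linear_power)
    have "((\<lambda>z. poly r z) has_field_derivative poly (pderiv r) z) (at z)" for z by (rule poly_DERIV)
    moreover have "poly r = (\<lambda>z. (z - x) ^ q * c)" by (rule ext, subst r_eq) (simp add: k algebra_simps)
    moreover have "((\<lambda>z. (z - x) ^ q * c) has_field_derivative of_nat q * ((1 - 0) * (z - x) ^ (q - Suc 0)) * c) (at z)" for z
      by (intro DERIV_cmult_right DERIV_power DERIV_diff DERIV_ident DERIV_const)
    ultimately have "poly (pderiv r) z = of_nat q * ((1 - 0) * (z - x) ^ (q - Suc 0)) * c" for z
      using DERIV_unique by metis
    hence D: "poly (pderiv p) z = of_nat q * (z - x) ^ (m + n) * c" for z using dr by simp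
    have qn: "(of_nat q :: complex) \<noteq> 0" unfolding of_nat_eq_0_iff by simp
    have "of_nat q * (a - x) ^ (m + n) * c = 0" unfolding D[symmetric] poly_pderiv_p using n1 by simp
    hence "a = x" using c0 qn unfolding mult_eq_0_iff power_eq_0_iff by auto
    have "of_nat q * (b - x) ^ (m + n) * c = 0" unfolding D[symmetric] poly_pderiv_p using m1 by simp
    hence "b = x" using c0 qn unfolding mult_eq_0_iff power_eq_0_iff by auto
    with \<open>a = x\<close> show False using ab by simp
  qed
qed

end

definition ld :: "(complex \<Rightarrow> complex) \<Rightarrow> complex \<Rightarrow> complex" where "ld F z = deriv F z / F z"

lemma ld_mult:
  assumes "F holomorphic_on UNIV" "G holomorphic_on UNIV" "F z \<noteq> 0" "G z \<noteq> 0"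
  shows "ld (\<lambda>z. F z * G z) z = ld F z + ld G z"
proof -
  have "deriv (\<lambda>z. F z * G z) z = deriv F z * G z + deriv G z * F z"
    by (intro DERIV_imp_deriv DERIV_mult entire_has_deriv assms)
  thus ?thesis using assms(3,4) by (simp add: ld_def field_simps)
qed

lemma ld_power:
  assumes "F holomorphic_on UNIV" "F z \<noteq> 0"
  shows "ld (\<lambda>z. F z ^ k) z = of_nat k * ld F z"
proof (induction k)
  case 0 thus ?case by (simp add: ld_def)
next
  case (Suc k)
  have "ld (\<lambda>z. F z * F z ^ k) z = ld F z + ld (\<lambda>z. F z ^ k) z"
    by (rule ld_mult) (use assms in \<open>auto intro!: holomorphic_intros\<close>)
  thus ?case using Suc by (simp add: algebra_simps)
qed

lemma deriv_eq_ld: "F z \<noteq> 0 \<Longrightarrow> deriv F z = ld F z * F z" by (simp add: ld_def)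

lemma wronskian_eq_ld: "F z \<noteq> 0 \<Longrightarrow> G z \<noteq> 0 \<Longrightarrow> wronskian F G z = (ld F z - ld G z) * (F z * G z)"
  by (simp add: wronskian_def ld_def field_simps)

context pair_poly
begin

lemma norm_hom_le: "\<exists>C>0. \<forall>z. norm (hom f z) \<le> C * (norm (d z) + norm (f z)) ^ q"
proof (rule exI[of _ "norm (lead_coeff p) * (\<Prod>\<tau>\<in>roots. 1 + norm \<tau>)"], intro conjI allI)
  show "0 < norm (lead_coeff p) * (\<Prod>\<tau>\<in>roots. 1 + norm \<tau>)"
    using p_nz by (intro mult_pos_pos prod_pos) (auto intro: add_pos_nonneg)
  fix z
  have "(\<Prod>\<tau>\<in>roots. norm (f z - \<tau> * d z)) \<le> (\<Prod>\<tau>\<in>roots. (1 + norm \<tau>) * (norm (d z) + norm (f z)))"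
    by (intro prod_mono conjI norm_f_lin_le norm_ge_zero)
  also have "\<dots> = (\<Prod>\<tau>\<in>roots. 1 + norm \<tau>) * (norm (d z) + norm (f z)) ^ q"
    by (simp only: prod.distrib prod_constant card_roots)
  finally have "norm (lead_coeff p) * (\<Prod>\<tau>\<in>roots. norm (f z - \<tau> * d z)) \<le> norm (lead_coeff p) * ((\<Prod>\<tau>\<in>roots. 1 + norm \<tau>) * (norm (d z) + norm (f z)) ^ q)"
    by (rule mult_left_mono) simp
  thus "norm (hom f z) \<le> norm (lead_coeff p) * (\<Prod>\<tau>\<in>roots. 1 + norm \<tau>) * (norm (d z) + norm (f z)) ^ q"
    by (simp only: hom_def norm_mult prod_norm mult.assoc)
qed

lemma lmean_le_characteristic:
  assumes X: "X holomorphic_on UNIV" "\<And>z. norm z = r \<Longrightarrow> X z \<noteq> 0" and r: "0 \<le> r"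
    and bd: "\<And>z. norm (X z) \<le> C * (norm (d z) + norm (f z)) ^ k" "0 < C"
  shows "lmean r X \<le> ln C + real k * cmean r (\<lambda>z. ln (norm (d z) + norm (f z)))"
proof -
  have c: "continuous_on (sphere 0 r) (\<lambda>z. real k * ln (norm (d z) + norm (f z)))"
    by (intro continuous_on_mult continuous_on_const cont_ln_df)
  have "lmean r X \<le> cmean r (\<lambda>z. ln C + real k * ln (norm (d z) + norm (f z)))"
  proof (rule cmean_mono)
    fix z :: complex assume z: "norm z = r"
    have "ln (norm (X z)) \<le> ln (C * (norm (d z) + norm (f z)) ^ k)" using X(2)[OF z] by (intro ln_mono bd) auto
    also have "\<dots> = ln C + ln ((norm (d z) + norm (f z)) ^ k)" using bd(2) df_pos[of z] by (intro ln_mult_pos) auto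
    also have "ln ((norm (d z) + norm (f z)) ^ k) = real k * ln (norm (d z) + norm (f z))" by (rule ln_realpow)
    finally show "ln (norm (X z)) \<le> ln C + real k * ln (norm (d z) + norm (f z))" .
  qed (use X r c in \<open>auto intro!: continuous_on_ln_norm continuous_on_add continuous_on_const\<close>)
  also have "\<dots> = ln C + real k * cmean r (\<lambda>z. ln (norm (d z) + norm (f z)))"
    by (simp only: cmean_add[OF continuous_on_const c r] cmean_const cmean_cmult)
  finally show ?thesis .
qed

text \<open>
  The bound contains the logarithmic derivative of \<open>f / d\<close> in place of \<open>deriv f\<close>, which is not controlled
  pointwise by \<open>size\<close>.
\<close>
lemma norm_ldiff_le:
  assumes nz: "f z \<noteq> 0" "d z \<noteq> 0"
  shows "norm (ldiff f z) \<le> (1 + norm a) ^ n * (1 + norm b) ^ m * size z ^ (n + m + 2) * norm (deriv f z / f z - deriv d z / d z)"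
proof -
  have l: "norm (f z - \<tau> * d z) \<le> (1 + norm \<tau>) * size z" for \<tau>
    by (rule order_trans[OF norm_f_lin_le]) (intro mult_left_mono df_le_size, simp)
  have W: "norm (wronskian f d z) \<le> size z ^ 2 * norm (deriv f z / f z - deriv d z / d z)"
  proof -
    have "norm (wronskian f d z) = norm (deriv f z / f z - deriv d z / d z) * (norm (f z) * norm (d z))"
      using logderiv_diff_wronskian[of f z d, OF nz] nz by (simp add: norm_divide norm_mult)
    also have "\<dots> \<le> norm (deriv f z / f z - deriv d z / d z) * (size z * size z)"
      by (intro mult_left_mono mult_mono) (use size_pos[of z] in \<open>auto simp: size_def\<close>)
    finally show ?thesis by (simp add: power2_eq_square mult_ac)
  qed
  have "norm (ldiff f z) = norm (f z - a * d z) ^ n * norm (f z - b * d z) ^ m * norm (wronskian f d z)"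
    by (simp add: ldiff_def norm_mult norm_power)
  also have "\<dots> \<le> ((1 + norm a) * size z) ^ n * ((1 + norm b) * size z) ^ m * (size z ^ 2 * norm (deriv f z / f z - deriv d z / d z))"
    by (intro mult_mono power_mono l W) (use size_pos[of z] in \<open>auto simp: less_imp_le\<close>)
  also have "\<dots> = (1 + norm a) ^ n * (1 + norm b) ^ m * size z ^ (n + m + 2) * norm (deriv f z / f z - deriv d z / d z)"
    by (simp only: power_mult_distrib power_add mult_ac)
  finally show ?thesis .
qed

lemma V_swap: "entire_pair.V d g f = V"
proof -
  interpret sw: entire_pair d g f by (rule swap_pair)
  show ?thesis by (rule ext) (simp add: V_def sw.V_def size_def sw.size_def add_ac)
qed

text \<open>
  The inequality \<open>norm d * size \<le> (norm d + norm f) * (norm d + norm g)\<close> holds pointwise, and the mean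
  of \<open>ln (norm d)\<close> is bounded below.
\<close>
lemma V_le_characteristics:
  assumes E: "zradii d \<subseteq> E"
  shows "\<exists>C\<ge>0. \<forall>r\<ge>1. r \<notin> E \<longrightarrow> V r \<le> cmean r (\<lambda>z. ln (norm (d z) + norm (f z))) + cmean r (\<lambda>z. ln (norm (d z) + norm (g z))) + C \<and>
     lmean r d \<le> cmean r (\<lambda>z. ln (norm (d z) + norm (f z))) \<and> lmean r d \<le> cmean r (\<lambda>z. ln (norm (d z) + norm (g z)))"
proof -
  interpret sw: entire_pair d g f by (rule swap_pair)
  obtain C where C: "0 \<le> C" "\<And>r. 1 \<le> r \<Longrightarrow> r \<notin> zradii d \<Longrightarrow> - C \<le> lmean r d" using lmean_lower_bound[OF d] by blast
  show ?thesis
  proof (rule exI[of _ C], intro conjI allI impI C(1))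
    fix r :: real assume r: "1 \<le> r" "r \<notin> E"
    hence r0: "0 \<le> r" by simp
    have dz: "d z \<noteq> 0" if "norm z = r" for z using that r E by (auto simp: zradii_def)
    have cd: "continuous_on (sphere 0 r) (\<lambda>z. ln (norm (d z)))" by (rule continuous_on_ln_norm[OF d_hol]) (use dz in auto)
    have "V r \<le> cmean r (\<lambda>z. (ln (norm (d z) + norm (f z)) + ln (norm (d z) + norm (g z))) - ln (norm (d z)))"
      unfolding V_def
    proof (rule cmean_mono[OF cont_ln_size _ r0])
      fix z :: complex assume z: "norm z = r"
      have "norm (d z) * size z \<le> (norm (d z) + norm (f z)) * (norm (d z) + norm (g z))"
        by (simp add: size_def algebra_simps)
      hence "ln (norm (d z) * size z) \<le> ln ((norm (d z) + norm (f z)) * (norm (d z) + norm (g z)))"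
        using dz[OF z] size_pos[of z] by (intro ln_mono) auto
      moreover have "ln (norm (d z) * size z) = ln (norm (d z)) + ln (size z)"
        using dz[OF z] size_pos[of z] by (intro ln_mult_pos) auto
      moreover have "ln ((norm (d z) + norm (f z)) * (norm (d z) + norm (g z))) = ln (norm (d z) + norm (f z)) + ln (norm (d z) + norm (g z))"
        by (rule ln_mult_pos[OF df_pos dg_pos])
      ultimately show "ln (size z) \<le> (ln (norm (d z) + norm (f z)) + ln (norm (d z) + norm (g z))) - ln (norm (d z))" by linarith
    qed (intro continuous_on_diff continuous_on_add cont_ln_df sw.cont_ln_df cd)
    also have "\<dots> = (cmean r (\<lambda>z. ln (norm (d z) + norm (f z))) + cmean r (\<lambda>z. ln (norm (d z) + norm (g z)))) - lmean r d"
      by (simp only: cmean_diff[OF continuous_on_add[OF cont_ln_df sw.cont_ln_df] cd r0] cmean_add[OF cont_ln_df sw.cont_ln_df r0])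
    finally show "V r \<le> cmean r (\<lambda>z. ln (norm (d z) + norm (f z))) + cmean r (\<lambda>z. ln (norm (d z) + norm (g z))) + C"
      using C(2)[of r] r E by fastforce
    show "lmean r d \<le> cmean r (\<lambda>z. ln (norm (d z) + norm (f z)))"
      by (rule cmean_mono[OF cd cont_ln_df r0]) (use dz in \<open>auto intro!: ln_mono\<close>)
    show "lmean r d \<le> cmean r (\<lambda>z. ln (norm (d z) + norm (g z)))"
      by (rule cmean_mono[OF cd sw.cont_ln_df r0]) (use dz in \<open>auto intro!: ln_mono\<close>)
  qed
qed

end

text \<open>
  The functions \<open>f / d\<close> and \<open>g / d\<close> share the set of zeros of \<open>P\<close>, counting multiplicities.
\<close>
locale shared_pair = pair_poly +
  fixes \<phi> :: "complex \<Rightarrow> complex"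
  assumes phi_hol: "\<phi> holomorphic_on UNIV" and phi_nz: "\<And>z. \<phi> z \<noteq> 0"
    and hom_eq: "\<And>z. hom f z = \<phi> z * hom g z"
begin

abbreviation "Wf \<equiv> wronskian f d"
abbreviation "Wg \<equiv> wronskian g d"
abbreviation "af \<equiv> (\<lambda>z. f z - a * d z)"
abbreviation "bf \<equiv> (\<lambda>z. f z - b * d z)"
abbreviation "ag \<equiv> (\<lambda>z. g z - a * d z)"
abbreviation "bg \<equiv> (\<lambda>z. g z - b * d z)"

text \<open>
  \<open>K / T\<close> is the function \<open>H\<close> of the introduction, the logarithmic derivative of
  \<open>(1 / P(f))' / (1 / P(g))'\<close>: its numerator is \<open>K\<close> and \<open>T\<close> is the common
  denominator. All terms of \<open>K\<close> are entire, as \<open>\<phi>\<close> has no zeros.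
\<close>
definition T :: "complex \<Rightarrow> complex" where "T z = af z * bf z * (ag z * bg z) * (Wf z * Wg z)"
definition K :: "complex \<Rightarrow> complex" where
  "K z = af z * bf z * (ag z * bg z) * wronskian Wf Wg z
    + of_nat n * (Wf z * Wg z) * (bf z * bg z) * wronskian af ag z
    + of_nat m * (Wf z * Wg z) * (af z * ag z) * wronskian bf bg z
    - 2 * ld \<phi> z * T z"

lemma forms_hol: "af holomorphic_on UNIV" "bf holomorphic_on UNIV" "ag holomorphic_on UNIV" "bg holomorphic_on UNIV"
  "Wf holomorphic_on UNIV" "Wg holomorphic_on UNIV" "hom f holomorphic_on UNIV" "hom g holomorphic_on UNIV"
  "ldiff f holomorphic_on UNIV" "ldiff g holomorphic_on UNIV" "ld \<phi> holomorphic_on UNIV"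
proof -
  show "af holomorphic_on UNIV" "bf holomorphic_on UNIV" "ag holomorphic_on UNIV" "bg holomorphic_on UNIV"
    by (intro holomorphic_intros f g d_hol)+
  show "Wf holomorphic_on UNIV" "Wg holomorphic_on UNIV" by (rule wronskian_hol; rule f g d_hol)+
  show "hom f holomorphic_on UNIV" "hom g holomorphic_on UNIV" by (rule hom_hol f g)+
  show "ldiff f holomorphic_on UNIV" "ldiff g holomorphic_on UNIV" by (rule ldiff_hol f g)+
  show "ld \<phi> holomorphic_on UNIV"
    unfolding ld_def[abs_def] by (intro holomorphic_intros entire_deriv phi_hol phi_nz)
qed

lemma K_hol: "K holomorphic_on UNIV"
proof -
  note w = wronskian_hol[OF forms_hol(5,6)] wronskian_hol[OF forms_hol(1,3)] wronskian_hol[OF forms_hol(2,4)]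
  have T: "T holomorphic_on UNIV" unfolding T_def by (intro holomorphic_on_mult forms_hol(1-6))
  show ?thesis unfolding K_def
    by (intro holomorphic_on_add holomorphic_on_diff[where g = "\<lambda>z. 2 * ld \<phi> z * T z"] holomorphic_on_mult holomorphic_on_const w forms_hol T)
qed

lemma forms_nz: "entire_nz af" "entire_nz bf" "entire_nz ag" "entire_nz bg" "entire_nz (hom f)" "entire_nz (hom g)" "entire_nz T"
proof -
  interpret sw: pair_poly d g f p m n a b by (rule swap_fg)
  show "entire_nz af" "entire_nz bf" "entire_nz ag" "entire_nz bg" "entire_nz (hom f)" "entire_nz (hom g)"
    by (rule f_lin_nz sw.f_lin_nz hom_f_nz sw.hom_f_nz)+
  show "entire_nz T" unfolding T_def
    by (intro entire_nz_mult f_lin_nz sw.f_lin_nz Wf Wg)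
qed

text \<open>
  The second formula expresses \<open>H\<close> through \<open>\<phi>\<close>, using \<open>hom f = \<phi> * hom g\<close> to eliminate the logarithmic
  derivatives of \<open>hom f\<close> and \<open>hom g\<close>, which would have poles at the shared points.
\<close>
lemma logderiv_eq:
  assumes "T z \<noteq> 0" "hom f z \<noteq> 0" "hom g z \<noteq> 0"
  shows "ld (\<lambda>z. ldiff f z * hom g z ^ 2) z - ld (\<lambda>z. ldiff g z * hom f z ^ 2) z = K z / T z"
    and "ld (ldiff f) z - ld (ldiff g) z - 2 * ld \<phi> z = K z / T z"
proof -
  have nz: "af z \<noteq> 0" "bf z \<noteq> 0" "ag z \<noteq> 0" "bg z \<noteq> 0" "Wf z \<noteq> 0" "Wg z \<noteq> 0" using assms(1) by (auto simp: T_def)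
  have ldf: "ld (ldiff f) z = of_nat n * ld af z + of_nat m * ld bf z + ld Wf z"
  proof -
    have "ld (\<lambda>z. af z ^ n * bf z ^ m * Wf z) z = ld (\<lambda>z. af z ^ n * bf z ^ m) z + ld Wf z"
      by (rule ld_mult) (use nz forms_hol in \<open>auto intro!: holomorphic_intros\<close>)
    also have "ld (\<lambda>z. af z ^ n * bf z ^ m) z = ld (\<lambda>z. af z ^ n) z + ld (\<lambda>z. bf z ^ m) z"
      by (rule ld_mult) (use nz forms_hol in \<open>auto intro!: holomorphic_intros\<close>)
    finally show ?thesis using nz forms_hol by (simp add: ldiff_def[abs_def] ld_power)
  qed
  have ldg: "ld (ldiff g) z = of_nat n * ld ag z + of_nat m * ld bg z + ld Wg z"
  proof -
    have "ld (\<lambda>z. ag z ^ n * bg z ^ m * Wg z) z = ld (\<lambda>z. ag z ^ n * bg z ^ m) z + ld Wg z"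
      by (rule ld_mult) (use nz forms_hol in \<open>auto intro!: holomorphic_intros\<close>)
    also have "ld (\<lambda>z. ag z ^ n * bg z ^ m) z = ld (\<lambda>z. ag z ^ n) z + ld (\<lambda>z. bg z ^ m) z"
      by (rule ld_mult) (use nz forms_hol in \<open>auto intro!: holomorphic_intros\<close>)
    finally show ?thesis using nz forms_hol by (simp add: ldiff_def[abs_def] ld_power)
  qed
  have K: "K z = (of_nat n * ld af z + of_nat m * ld bf z + ld Wf z - (of_nat n * ld ag z + of_nat m * ld bg z + ld Wg z) - 2 * ld \<phi> z) * T z"
    unfolding K_def T_def using nz by (simp add: wronskian_eq_ld algebra_simps)
  show 2: "ld (ldiff f) z - ld (ldiff g) z - 2 * ld \<phi> z = K z / T z"
    using assms(1) by (simp add: K ldf ldg)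
  have lnz: "ldiff f z \<noteq> 0" "ldiff g z \<noteq> 0" using nz by (auto simp: ldiff_def)
  have "ld (hom f) z = ld \<phi> z + ld (hom g) z"
  proof -
    have "hom f = (\<lambda>z. \<phi> z * hom g z)" using hom_eq by (rule ext)
    thus ?thesis using ld_mult[OF phi_hol forms_hol(8) phi_nz assms(3)] by simp
  qed
  moreover have "ld (\<lambda>z. ldiff f z * hom g z ^ 2) z = ld (ldiff f) z + 2 * ld (hom g) z"
    by (subst ld_mult) (use lnz forms_hol assms in \<open>auto intro!: holomorphic_intros simp: ld_power\<close>)
  moreover have "ld (\<lambda>z. ldiff g z * hom f z ^ 2) z = ld (ldiff g) z + 2 * ld (hom f) z"
    by (subst ld_mult) (use lnz forms_hol assms in \<open>auto intro!: holomorphic_intros simp: ld_power\<close>)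
  ultimately show "ld (\<lambda>z. ldiff f z * hom g z ^ 2) z - ld (\<lambda>z. ldiff g z * hom f z ^ 2) z = K z / T z"
    using 2 by (simp add: algebra_simps)
qed

lemma ldiff_f_eq: "ldiff f z = \<phi> z * ldiff g z + deriv \<phi> z * hom g z * d z"
proof -
  have "hom f = (\<lambda>z. \<phi> z * hom g z)" using hom_eq by (rule ext)
  hence "deriv (hom f) z = deriv \<phi> z * hom g z + deriv (hom g) z * \<phi> z"
    by (simp only:) (intro DERIV_imp_deriv DERIV_mult entire_has_deriv phi_hol forms_hol)
  thus ?thesis unfolding ldiff_eq[OF f] ldiff_eq[OF g] hom_eq by (simp add: algebra_simps del: of_nat_add of_nat_Suc)
qed

text \<open>
  At a zero of \<open>hom g\<close>, substitute \<open>ldiff f = \<phi> * ldiff g + deriv \<phi> * hom g * d\<close> into the second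
  formula for \<open>H\<close>. The terms without a factor \<open>hom g\<close> cancel, where the derivative of \<open>hom g\<close> is expressed
  through \<open>ldiff g\<close>. Clearing denominators introduces a factor \<open>\<beta>\<close>, which is coprime to \<open>hom g\<close> because \<open>P\<close> does
  not vanish at \<open>a\<close> and \<open>b\<close>.
\<close>
lemma K_divisible:
  "\<exists>J. J holomorphic_on UNIV \<and> (\<forall>z. K z = J z * hom g z)"
proof -
  interpret sw: pair_poly d g f p m n a b by (rule swap_fg)
  let ?Lf = "ldiff f" and ?Lg = "ldiff g"
  define \<beta> where "\<beta> = (\<lambda>z. \<phi> z * (af z * ag z) ^ (n - 1) * (bf z * bg z) ^ (m - 1))"
  define M where "M = (\<lambda>z. \<phi> z * deriv (deriv \<phi>) z * d z * ?Lg z + (of_nat q + 1) * \<phi> z * deriv \<phi> z * deriv d z * ?Lg z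
     - \<phi> z * deriv \<phi> z * d z * deriv ?Lg z - 2 * deriv \<phi> z ^ 2 * d z * ?Lg z)"
  have bh: "\<beta> holomorphic_on UNIV" unfolding \<beta>_def by (intro holomorphic_intros phi_hol forms_hol)
  have Mh: "M holomorphic_on UNIV" unfolding M_def by (intro holomorphic_intros entire_deriv phi_hol forms_hol d_hol)
  have SS: "entire_nz (\<lambda>z. T z * (hom f z * hom g z))" by (intro entire_nz_mult forms_nz)
  have "(\<lambda>z. K z * \<beta> z) = (\<lambda>z. hom g z * M z)"
  proof (rule entire_eq_offI[OF SS])
    fix z assume "T z * (hom f z * hom g z) \<noteq> 0"
    hence nz: "T z \<noteq> 0" "hom f z \<noteq> 0" "hom g z \<noteq> 0" by auto
    have nz2: "af z \<noteq> 0" "bf z \<noteq> 0" "ag z \<noteq> 0" "bg z \<noteq> 0" "Wf z \<noteq> 0" "Wg z \<noteq> 0" using nz(1) by (auto simp: T_def)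
    have lnz: "?Lf z \<noteq> 0" "?Lg z \<noteq> 0" using nz2 by (auto simp: ldiff_def)
    have TB: "T z * \<beta> z = \<phi> z * (?Lf z * ?Lg z)"
    proof -
      have n': "x ^ n = x * x ^ (n - 1)" and m': "x ^ m = x * x ^ (m - 1)" for x :: complex
        using n1 m1 by (metis One_nat_def Suc_pred' less_le_trans pos2 power_Suc)+
      show ?thesis unfolding T_def \<beta>_def ldiff_def n' m' by (simp add: power_mult_distrib mult_ac)
    qed
    have "K z * \<beta> z = (ld ?Lf z - ld ?Lg z - 2 * ld \<phi> z) * (T z * \<beta> z)"
      using logderiv_eq(2)[OF nz] nz(1) by simp
    also have "\<dots> = \<phi> z * (deriv ?Lf z * ?Lg z - ?Lf z * deriv ?Lg z) - 2 * deriv \<phi> z * ?Lf z * ?Lg z"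
      unfolding TB deriv_eq_ld[of ?Lf, OF lnz(1)] deriv_eq_ld[of ?Lg, OF lnz(2)] deriv_eq_ld[of \<phi>, OF phi_nz]
      by (simp add: algebra_simps)
    finally have 1: "K z * \<beta> z = \<phi> z * (deriv ?Lf z * ?Lg z - ?Lf z * deriv ?Lg z) - 2 * deriv \<phi> z * ?Lf z * ?Lg z" .
    have "?Lf = (\<lambda>z. \<phi> z * ?Lg z + deriv \<phi> z * hom g z * d z)" using ldiff_f_eq by (rule ext)
    hence dL: "deriv ?Lf z = (deriv \<phi> z * ?Lg z + deriv ?Lg z * \<phi> z) + ((deriv (deriv \<phi>) z * hom g z + deriv (hom g) z * deriv \<phi> z) * d z + deriv d z * (deriv \<phi> z * hom g z))"
      by (simp only:) (intro DERIV_imp_deriv DERIV_add DERIV_mult entire_has_deriv entire_deriv phi_hol forms_hol d_hol)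
    have hg: "deriv (hom g) z * d z = ?Lg z + of_nat q * hom g z * deriv d z" using ldiff_eq[OF g, of z] by simp
    have dL': "deriv ?Lf z = deriv \<phi> z * ?Lg z + deriv ?Lg z * \<phi> z + deriv (deriv \<phi>) z * hom g z * d z
        + deriv \<phi> z * (?Lg z + of_nat q * hom g z * deriv d z) + deriv d z * deriv \<phi> z * hom g z"
      unfolding dL hg[symmetric] by (simp add: algebra_simps)
    show "K z * \<beta> z = hom g z * M z"
      unfolding 1 dL' ldiff_f_eq M_def by (simp add: algebra_simps power2_eq_square del: of_nat_add of_nat_Suc)
  qed (intro holomorphic_intros K_hol bh Mh forms_hol)+
  hence eq: "K z * \<beta> z = hom g z * M z" for z by (rule fun_cong)
  have cop: "hom g z \<noteq> 0 \<or> \<beta> z \<noteq> 0" for z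
    using hom_f_zero[of z] sw.hom_f_zero[of z] hom_eq[of z] phi_nz[of z] by (auto simp: \<beta>_def)
  obtain J where "J holomorphic_on UNIV" "\<And>z. K z = J z * hom g z"
    using entire_divide_coprime[OF forms_nz(6) K_hol bh Mh eq cop] by metis
  thus ?thesis by blast
qed

end

context pair_poly
begin

lemma size_swap: "entire_pair.size d g f = size"
proof -
  interpret sw: entire_pair d g f by (rule swap_pair)
  show ?thesis by (rule ext) (simp add: size_def sw.size_def add_ac)
qed

lemma logderiv_small_f:
  assumes E: "countable E" "zradii f \<subseteq> E" "zradii d \<subseteq> E"
  shows "\<exists>C\<ge>0. \<forall>r \<rho>. growth E r \<longrightarrow> r \<le> \<rho> \<longrightarrow> \<rho> < r + 1/2 * r / V r \<longrightarrow> \<rho> \<notin> E \<longrightarrow>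
     cmean \<rho> (\<lambda>z. lnp (norm (deriv f z / f z - deriv d z / d z))) \<le> C * (1 + ln (V r))"
proof (rule logderiv_small[OF _ d E])
  show "entire_nz f" using f_lin_nz[of 0] by simp
  show "norm (f z) + norm (d z) \<le> 1 * size z ^ 1" for z by (simp add: size_def)
qed simp

end

context shared_pair
begin

text \<open>
  \<open>H\<close> is a difference of logarithmic derivatives of \<open>A\<close> and \<open>B\<close>, but these contain
  derivatives of \<open>f\<close> and \<open>g\<close>, so the growth of their means has to be estimated by the logarithmic derivative lemma
  first. Applied to \<open>f / d\<close> and \<open>g / d\<close>, the lemma gives bounds on an interval of length \<open>r / (2 V r)\<close> beyond \<open>r\<close>, and half of
  this interval is left for its second application, to \<open>A\<close> and \<open>B\<close>.
\<close>
lemma logderiv_K: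
  assumes E: "countable E" "zradii d \<subseteq> E" "zradii f \<subseteq> E" "zradii g \<subseteq> E" "zradii T \<subseteq> E" "zradii (hom f) \<subseteq> E" "zradii (hom g) \<subseteq> E"
  shows "\<exists>C. \<forall>r. growth E r \<longrightarrow> cmean r (\<lambda>z. lnp (norm (K z / T z))) \<le> C * (1 + ln (V r))"
proof -
  interpret sw: pair_poly d g f p m n a b by (rule swap_fg)
  have nzE: "F z \<noteq> 0" if "norm z \<notin> E" "zradii F \<subseteq> E" for F z
    using that by (auto simp: zradii_def)
  let ?F = "\<lambda>z. norm (deriv f z / f z - deriv d z / d z)" and ?G = "\<lambda>z. norm (deriv g z / g z - deriv d z / d z)"
  define A where "A = (\<lambda>z. ldiff f z * hom g z ^ 2)"
  define B where "B = (\<lambda>z. ldiff g z * hom f z ^ 2)"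
  have A: "entire_nz A" unfolding A_def ldiff_def by (intro entire_nz_mult entire_nz_power forms_nz Wf)
  have B: "entire_nz B" unfolding B_def ldiff_def by (intro entire_nz_mult entire_nz_power forms_nz Wg)
  have Tnz: "af z \<noteq> 0" "bf z \<noteq> 0" "ag z \<noteq> 0" "bg z \<noteq> 0" "Wf z \<noteq> 0" "Wg z \<noteq> 0" if "norm z \<notin> E" for z
    using nzE[OF that E(5)] by (auto simp: T_def)
  have AB0: "A z \<noteq> 0" "B z \<noteq> 0" if "norm z \<notin> E" for z
    using Tnz[OF that] nzE[OF that E(6)] nzE[OF that E(7)] by (auto simp: A_def B_def ldiff_def)
  have EA: "zradii A \<subseteq> E" "zradii B \<subseteq> E" using AB0 by (auto simp: zradii_def)
  obtain Cf where Cf: "0 \<le> Cf" "\<forall>r \<rho>. growth E r \<longrightarrow> r \<le> \<rho> \<longrightarrow> \<rho> < r + 1/2 * r / V r \<longrightarrow> \<rho> \<notin> E \<longrightarrow> cmean \<rho> (\<lambda>z. lnp (?F z)) \<le> Cf * (1 + ln (V r))"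
    using logderiv_small_f[OF E(1,3,2)] by auto
  obtain Cg where Cg: "0 \<le> Cg" "\<forall>r \<rho>. growth E r \<longrightarrow> r \<le> \<rho> \<longrightarrow> \<rho> < r + 1/2 * r / V r \<longrightarrow> \<rho> \<notin> E \<longrightarrow> cmean \<rho> (\<lambda>z. lnp (?G z)) \<le> Cg * (1 + ln (V r))"
    using sw.logderiv_small_f[OF E(1,4,2)] unfolding V_swap by auto
  obtain Hf where Hf: "0 < Hf" "\<And>z. norm (hom f z) \<le> Hf * (norm (d z) + norm (f z)) ^ q" using norm_hom_le by blast
  obtain Hg where Hg: "0 < Hg" "\<And>z. norm (hom g z) \<le> Hg * (norm (d z) + norm (g z)) ^ q" using sw.norm_hom_le by blast
  define H where "H = max Hf Hg"
  have H: "0 < H" using Hf by (simp add: H_def)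
  have hf: "norm (hom f z) \<le> H * size z ^ q" for z
    using df_pos[of z] df_le_size[of z] Hf(1) H by (intro order_trans[OF Hf(2)] mult_mono power_mono) (auto simp: H_def)
  have hg: "norm (hom g z) \<le> H * size z ^ q" for z
    using dg_pos[of z] dg_le_size[of z] Hg(1) H by (intro order_trans[OF Hg(2)] mult_mono power_mono) (auto simp: H_def)
  define K1 where "K1 = (1 + norm a) ^ n * (1 + norm b) ^ m * H^2"
  have K1: "0 < K1" using H by (auto simp: K1_def intro!: mult_pos_pos zero_less_power add_pos_nonneg)
  define k where "k = n + m + 2 + q * 2"
  have pt: "norm (A z) + norm (B z) \<le> K1 * size z ^ k * (?F z + ?G z)" if z: "norm z \<notin> E" for z
  proof -
    have nz: "f z \<noteq> 0" "g z \<noteq> 0" "d z \<noteq> 0" using nzE[OF z] E by auto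
    have s0: "0 \<le> size z" using size_pos[of z] by simp
    have "norm (A z) \<le> ((1 + norm a) ^ n * (1 + norm b) ^ m * size z ^ (n + m + 2) * ?F z) * (H * size z ^ q) ^ 2"
      unfolding A_def norm_mult norm_power
      by (intro mult_mono power_mono norm_ldiff_le hg) (use nz s0 in auto)
    also have "\<dots> = K1 * size z ^ k * ?F z"
      unfolding K1_def k_def power_mult_distrib power_add power_mult by (simp only: mult_ac)
    finally have 1: "norm (A z) \<le> K1 * size z ^ k * ?F z" .
    have "norm (B z) \<le> ((1 + norm a) ^ n * (1 + norm b) ^ m * size z ^ (n + m + 2) * ?G z) * (H * size z ^ q) ^ 2"
      unfolding B_def norm_mult norm_power
      by (intro mult_mono power_mono sw.norm_ldiff_le[unfolded size_swap] hf) (use nz s0 in auto)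
    also have "\<dots> = K1 * size z ^ k * ?G z"
      unfolding K1_def k_def power_mult_distrib power_add power_mult by (simp only: mult_ac)
    finally show ?thesis using 1 by (simp add: distrib_left)
  qed
  define c where "c = (\<bar>ln K1\<bar> + ln 2) + 2 * real k + (Cf + Cg)"
  have bd: "cmean \<rho> (\<lambda>z. ln (norm (A z) + norm (B z))) \<le> c * V r"
    if r: "growth E r" "r < \<rho>" "\<rho> < r + 1/2 * r / V r" "\<rho> \<notin> E" for r \<rho>
  proof -
    have V: "1 \<le> V r" "1 \<le> r" using r(1) by (auto simp: growth_radius_def)
    have "1/2 * r / V r \<le> r / V r" using V by (intro divide_right_mono) auto
    hence V2: "V \<rho> \<le> 2 * V r" using r by (auto simp: growth_radius_def)
    have \<rho>0: "0 \<le> \<rho>" using r V by linarith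
    have nz: "f z \<noteq> 0" "g z \<noteq> 0" "d z \<noteq> 0" "A z \<noteq> 0" if "norm z = \<rho>" for z
      using nzE[of z] E AB0[of z] r(4) that by auto
    have c1: "continuous_on (sphere 0 \<rho>) (\<lambda>z. lnp (?F z))" and c2: "continuous_on (sphere 0 \<rho>) (\<lambda>z. lnp (?G z))"
      by (intro continuous_on_lnp continuous_on_norm continuous_on_diff continuous_on_divide entire_continuous entire_deriv f g d_hol;
          use nz in auto)+
    have c3: "continuous_on (sphere 0 \<rho>) (\<lambda>z. real k * ln (size z))"
      by (intro continuous_on_mult continuous_on_const cont_ln_size)
    have c4: "continuous_on (sphere 0 \<rho>) (\<lambda>z. ln (norm (A z) + norm (B z)))"
      by (intro continuous_intros entire_continuous entire_nzD A B) (use nz in \<open>auto simp: add_nonneg_eq_0_iff\<close>)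
    have "cmean \<rho> (\<lambda>z. ln (norm (A z) + norm (B z))) \<le> cmean \<rho> (\<lambda>z. (ln K1 + ln 2) + (real k * ln (size z) + (lnp (?F z) + lnp (?G z))))"
    proof (rule cmean_mono[OF c4 _ \<rho>0])
      show "continuous_on (sphere 0 \<rho>) (\<lambda>z. (ln K1 + ln 2) + (real k * ln (size z) + (lnp (?F z) + lnp (?G z))))"
        by (intro continuous_on_add continuous_on_const c1 c2 c3)
      fix z :: complex assume z: "norm z = \<rho>"
      have p: "0 < norm (A z) + norm (B z)" using nz(4)[OF z] by (simp add: add_pos_nonneg)
      have le: "norm (A z) + norm (B z) \<le> K1 * size z ^ k * (?F z + ?G z)" by (rule pt) (use z r in simp)
      have p2: "0 < K1 * size z ^ k" using K1 size_pos[of z] by simp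
      have p3: "0 < ?F z + ?G z" by (rule zero_less_mult_pos[OF less_le_trans[OF p le] p2])
      have "ln (norm (A z) + norm (B z)) \<le> ln (K1 * size z ^ k * (?F z + ?G z))" by (rule ln_mono[OF le p])
      also have "\<dots> = ln K1 + real k * ln (size z) + ln (?F z + ?G z)"
        unfolding ln_mult_pos[OF p2 p3] ln_mult_pos[OF K1 zero_less_power[OF size_pos]] ln_realpow ..
      also have "ln (?F z + ?G z) \<le> lnp (?F z + ?G z)" by (rule ln_le_lnp[OF p3])
      also have "\<dots> \<le> lnp (?F z) + lnp (?G z) + ln 2" by (rule lnp_add) auto
      finally show "ln (norm (A z) + norm (B z)) \<le> (ln K1 + ln 2) + (real k * ln (size z) + (lnp (?F z) + lnp (?G z)))" by simp
    qed
    also have "\<dots> = (ln K1 + ln 2) + (real k * V \<rho> + (cmean \<rho> (\<lambda>z. lnp (?F z)) + cmean \<rho> (\<lambda>z. lnp (?G z))))"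
      by (simp only: cmean_add[OF continuous_on_const continuous_on_add[OF c3 continuous_on_add[OF c1 c2]] \<rho>0]
          cmean_add[OF c3 continuous_on_add[OF c1 c2] \<rho>0] cmean_add[OF c1 c2 \<rho>0] cmean_const cmean_cmult V_def)
    also have "\<dots> \<le> (\<bar>ln K1\<bar> + ln 2) * V r + (real k * (2 * V r) + (Cf * V r + Cg * V r))"
    proof (intro add_mono mult_left_mono V2)
      have "(\<bar>ln K1\<bar> + ln 2) * 1 \<le> (\<bar>ln K1\<bar> + ln 2) * V r" by (intro mult_left_mono V(1)) auto
      thus "ln K1 + ln 2 \<le> (\<bar>ln K1\<bar> + ln 2) * V r" by (smt (verit))
      have lnV: "1 + ln (V r) \<le> V r" using ln_le_minus_one[of "V r"] V by simp
      have "cmean \<rho> (\<lambda>z. lnp (?F z)) \<le> Cf * (1 + ln (V r))" using Cf(2) r by auto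
      also have "\<dots> \<le> Cf * V r" by (intro mult_left_mono lnV Cf(1))
      finally show "cmean \<rho> (\<lambda>z. lnp (?F z)) \<le> Cf * V r" .
      have "cmean \<rho> (\<lambda>z. lnp (?G z)) \<le> Cg * (1 + ln (V r))" using Cg(2) r by auto
      also have "\<dots> \<le> Cg * V r" by (intro mult_left_mono lnV Cg(1))
      finally show "cmean \<rho> (\<lambda>z. lnp (?G z)) \<le> Cg * V r" .
    qed auto
    also have "\<dots> = c * V r" by (simp add: c_def algebra_simps)
    finally show ?thesis .
  qed
  obtain C where C: "\<forall>r \<rho>. growth E r \<longrightarrow> r \<le> \<rho> \<longrightarrow> \<rho> < r + 1/4 * r / V r \<longrightarrow> \<rho> \<notin> E \<longrightarrow>
     cmean \<rho> (\<lambda>z. lnp (norm (deriv A z / A z - deriv B z / B z))) \<le> C * (1 + ln (V r))"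
    using logderiv_growth[OF A B E(1) EA, of "1/4" "1/2" V c] bd by auto
  show ?thesis
  proof (rule exI[of _ C], intro allI impI)
    fix r assume r: "growth E r"
    have r1: "1 \<le> r" "r \<notin> E" "1 \<le> V r" using r by (auto simp: growth_radius_def)
    have "r < r + 1/4 * r / V r" using r1 by simp
    hence "cmean r (\<lambda>z. lnp (norm (deriv A z / A z - deriv B z / B z))) \<le> C * (1 + ln (V r))" using C r r1 by auto
    moreover have "cmean r (\<lambda>z. lnp (norm (K z / T z))) = cmean r (\<lambda>z. lnp (norm (deriv A z / A z - deriv B z / B z)))"
    proof (rule cmean_cong)
      fix z :: complex assume "norm z = r"
      hence z: "norm z \<notin> E" using r1 by simp
      show "lnp (norm (K z / T z)) = lnp (norm (deriv A z / A z - deriv B z / B z))"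
        using logderiv_eq(1)[OF nzE[OF z E(5)] nzE[OF z E(6)] nzE[OF z E(7)]] by (simp add: ld_def A_def B_def)
    qed (use r1 in simp)
    ultimately show "cmean r (\<lambda>z. lnp (norm (K z / T z))) \<le> C * (1 + ln (V r))" by simp
  qed
qed

text \<open>
  Write \<open>K = J * hom g\<close>. Then the mean of \<open>hom g\<close> is, up to a constant, at most that of \<open>K\<close>, which
  is the mean of \<open>T\<close> plus at most the proximity function of \<open>K / T\<close>.
\<close>
lemma K_estimate:
  assumes E: "countable E" "zradii d \<subseteq> E" "zradii f \<subseteq> E" "zradii g \<subseteq> E" "zradii T \<subseteq> E" "zradii (hom f) \<subseteq> E" "zradii (hom g) \<subseteq> E"
    and Knz: "entire_nz K" "zradii K \<subseteq> E"
  shows "\<exists>C. \<forall>r. growth E r \<longrightarrow> lmean r (hom g) \<le>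
     (lmean r af + lmean r bf + (lmean r ag + lmean r bg) + (lmean r Wf + lmean r Wg)) + C * (1 + ln (V r))"
proof -
  have nzE: "F z \<noteq> 0" if "norm z \<notin> E" "zradii F \<subseteq> E" for F z
    using that by (auto simp: zradii_def)
  obtain J where J: "J holomorphic_on UNIV" "\<forall>z. K z = J z * hom g z" using K_divisible by blast
  have Jnz: "entire_nz J" using J Knz(1) unfolding entire_nz_def by auto
  obtain CJ where CJ: "0 \<le> CJ" "\<And>r. 1 \<le> r \<Longrightarrow> r \<notin> zradii J \<Longrightarrow> - CJ \<le> lmean r J" using lmean_lower_bound[OF Jnz] by blast
  have EJ: "zradii J \<subseteq> E" using J(2) Knz(2) by (auto simp: zradii_def)
  obtain C where C: "\<And>r. growth E r \<Longrightarrow> cmean r (\<lambda>z. lnp (norm (K z / T z))) \<le> C * (1 + ln (V r))"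
    using logderiv_K[OF E] by blast
  show ?thesis
  proof (rule exI[of _ "C + CJ"], intro allI impI)
    fix r assume r: "growth E r"
    have r1: "1 \<le> r" "r \<notin> E" "1 \<le> V r" "0 \<le> r" using r by (auto simp: growth_radius_def)
    have nz: "K z \<noteq> 0" "T z \<noteq> 0" "J z \<noteq> 0" "hom g z \<noteq> 0" "af z \<noteq> 0" "bf z \<noteq> 0" "ag z \<noteq> 0" "bg z \<noteq> 0" "Wf z \<noteq> 0" "Wg z \<noteq> 0"
      if "norm z = r" for z
    proof -
      have z: "norm z \<notin> E" using that r1 by simp
      show "K z \<noteq> 0" "T z \<noteq> 0" "J z \<noteq> 0" "hom g z \<noteq> 0" using nzE[OF z] E Knz EJ by auto
      thus "af z \<noteq> 0" "bf z \<noteq> 0" "ag z \<noteq> 0" "bg z \<noteq> 0" "Wf z \<noteq> 0" "Wg z \<noteq> 0" by (auto simp: T_def)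
    qed
    have lT: "lmean r T = lmean r af + lmean r bf + (lmean r ag + lmean r bg) + (lmean r Wf + lmean r Wg)"
    proof -
      have h1: "(\<lambda>z. af z * bf z) holomorphic_on UNIV" "(\<lambda>z. ag z * bg z) holomorphic_on UNIV" "(\<lambda>z. Wf z * Wg z) holomorphic_on UNIV"
        "(\<lambda>z. af z * bf z * (ag z * bg z)) holomorphic_on UNIV"
        by (intro holomorphic_on_mult forms_hol)+
      have "lmean r T = lmean r (\<lambda>z. af z * bf z * (ag z * bg z)) + lmean r (\<lambda>z. Wf z * Wg z)"
        unfolding T_def[abs_def] by (rule lmean_mult[OF h1(4,3) r1(4)]) (use nz in auto)
      also have "lmean r (\<lambda>z. af z * bf z * (ag z * bg z)) = lmean r (\<lambda>z. af z * bf z) + lmean r (\<lambda>z. ag z * bg z)"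
        by (rule lmean_mult[OF h1(1,2) r1(4)]) (use nz in auto)
      also have "lmean r (\<lambda>z. af z * bf z) = lmean r af + lmean r bf"
        by (rule lmean_mult[OF forms_hol(1,2) r1(4)]) (use nz in auto)
      also have "lmean r (\<lambda>z. ag z * bg z) = lmean r ag + lmean r bg"
        by (rule lmean_mult[OF forms_hol(3,4) r1(4)]) (use nz in auto)
      also have "lmean r (\<lambda>z. Wf z * Wg z) = lmean r Wf + lmean r Wg"
        by (rule lmean_mult[OF forms_hol(5,6) r1(4)]) (use nz in auto)
      finally show ?thesis .
    qed
    have "lmean r K = lmean r (\<lambda>z. J z * hom g z)" by (simp only: J(2))
    also have "\<dots> = lmean r J + lmean r (hom g)"
      by (rule lmean_mult[OF J(1) forms_hol(8) r1(4)]) (use nz in auto)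
    finally have 1: "lmean r K = lmean r J + lmean r (hom g)" .
    have "- CJ \<le> lmean r J" by (rule CJ(2)) (use r1 EJ in auto)
    have cT: "continuous_on (sphere 0 r) (\<lambda>z. ln (norm (T z)))"
      by (rule continuous_on_ln_norm) (use nz forms_nz(7) in auto)
    have cK: "continuous_on (sphere 0 r) (\<lambda>z. lnp (norm (K z / T z)))"
      by (intro continuous_on_lnp continuous_on_norm continuous_on_divide entire_continuous K_hol entire_nzD forms_nz) (use nz in auto)
    have "lmean r K \<le> cmean r (\<lambda>z. lnp (norm (K z / T z)) + ln (norm (T z)))"
    proof (rule cmean_mono[OF _ continuous_on_add[OF cK cT] r1(4)])
      show "continuous_on (sphere 0 r) (\<lambda>z. ln (norm (K z)))" by (rule continuous_on_ln_norm[OF K_hol]) (use nz in auto)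
      fix z :: complex assume z: "norm z = r"
      have "ln (norm (K z)) = ln (norm (K z / T z) * norm (T z))" using nz(2)[OF z] by (simp add: norm_divide)
      also have "\<dots> = ln (norm (K z / T z)) + ln (norm (T z))"
        by (rule ln_mult_pos) (simp_all add: nz(1,2)[OF z])
      finally have eq: "ln (norm (K z)) = ln (norm (K z / T z)) + ln (norm (T z))" .
      have "0 < norm (K z / T z)" by (simp add: nz(1,2)[OF z])
      from ln_le_lnp[OF this] show "ln (norm (K z)) \<le> lnp (norm (K z / T z)) + ln (norm (T z))"
        unfolding eq by (rule add_right_mono)
    qed
    also have "\<dots> = cmean r (\<lambda>z. lnp (norm (K z / T z))) + lmean r T" by (rule cmean_add[OF cK cT r1(4)])
    finally have 2: "lmean r K \<le> C * (1 + ln (V r)) + lmean r T" using C[OF r] by linarith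
    have "0 \<le> CJ * ln (V r)" using CJ(1) r1 by simp
    thus "lmean r (hom g) \<le> (lmean r af + lmean r bf + (lmean r ag + lmean r bg) + (lmean r Wf + lmean r Wg)) + (C + CJ) * (1 + ln (V r))"
      using 1 2 \<open>- CJ \<le> lmean r J\<close> lT by (simp add: algebra_simps)
  qed
qed

text \<open>
  Add the second main theorems for \<open>f\<close> and \<open>g\<close> and \<open>K_estimate\<close>: the Wronskians cancel. Of the two means of \<open>hom f\<close>
  and \<open>hom g\<close>, which are equal up to a constant, one is estimated by \<open>K_estimate\<close> and the other one by half of
  \<open>q (T(f) + T(g))\<close>; the means of \<open>af, bf, ag, bg\<close> occur twice and contribute \<open>4 (T(f) + T(g))\<close>,
  those of \<open>d\<close> one more. The result is \<open>(q + 1) x \<le> (q / 2 + 5) x\<close> up to logarithmic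
  terms, where \<open>x = T(f) + T(g)\<close>.
\<close>
lemma K_vanishes:
  assumes mn: "8 \<le> m + n"
  shows "K z = 0"
proof (rule ccontr)
  assume "K z \<noteq> 0"
  hence Knz: "entire_nz K" using K_hol by (auto simp: entire_nz_def)
  interpret sw: pair_poly d g f p m n a b by (rule swap_fg)
  define Z where "Z = insert a (insert b roots)"
  have finZ: "finite Z" using finite_roots by (simp add: Z_def)
  define E where "E = zradii d \<union> zradii f \<union> zradii g \<union> zradii T \<union> zradii (hom f) \<union> zradii (hom g) \<union> zradii K
     \<union> (\<Union>\<tau>\<in>Z. zradii (\<lambda>z. f z - \<tau> * d z)) \<union> (\<Union>\<tau>\<in>Z. zradii (\<lambda>z. g z - \<tau> * d z)) \<union> zradii Wf \<union> zradii Wg"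
  have f': "entire_nz f" using f_lin_nz[of 0] by simp
  have g': "entire_nz g" using sw.f_lin_nz[of 0] by simp
  have cu: "countable (\<Union>\<tau>\<in>Z. zradii (\<lambda>z. f z - \<tau> * d z))" "countable (\<Union>\<tau>\<in>Z. zradii (\<lambda>z. g z - \<tau> * d z))"
    by (rule countable_UN[OF countable_finite[OF finZ]]; rule countable_zradii; rule f_lin_nz sw.f_lin_nz)+
  have E: "countable E" unfolding E_def
    by (intro countable_Un countable_zradii d f' g' forms_nz Knz Wf Wg cu)
  have sub: "zradii d \<subseteq> E" "zradii f \<subseteq> E" "zradii g \<subseteq> E" "zradii T \<subseteq> E" "zradii (hom f) \<subseteq> E" "zradii (hom g) \<subseteq> E" "zradii K \<subseteq> E"
    "zradii Wf \<subseteq> E" "zradii Wg \<subseteq> E"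
    by (auto simp: E_def)
  have subf: "zradii (\<lambda>z. f z - \<tau> * d z) \<subseteq> E" if "\<tau> \<in> insert a (insert b roots)" for \<tau>
    using that unfolding E_def Z_def[symmetric] by blast
  have subg: "zradii (\<lambda>z. g z - \<tau> * d z) \<subseteq> E" if "\<tau> \<in> insert a (insert b roots)" for \<tau>
    using that unfolding E_def Z_def[symmetric] by blast
  have nzE: "F z \<noteq> 0" if "norm z \<notin> E" "zradii F \<subseteq> E" for F z
    using that by (auto simp: zradii_def)
  let ?Tf = "\<lambda>r. cmean r (\<lambda>z. ln (norm (d z) + norm (f z)))" and ?Tg = "\<lambda>r. cmean r (\<lambda>z. ln (norm (d z) + norm (g z)))"
  obtain C1 where C1: "\<And>r. growth E r \<Longrightarrow> (real q + 1) * ?Tf r + lmean r Wf \<le>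
    lmean r (hom f) + (lmean r af + (lmean r bf + lmean r d)) + C1 * (1 + ln (V r))"
    using second_main_theorem[OF E sub(1) sub(8) subf] by blast
  obtain C2 where C2: "\<And>r. growth E r \<Longrightarrow> (real q + 1) * ?Tg r + lmean r Wg \<le>
    lmean r (hom g) + (lmean r ag + (lmean r bg + lmean r d)) + C2 * (1 + ln (V r))"
    using sw.second_main_theorem[OF E sub(1) sub(9) subg] unfolding V_swap by blast
  obtain C3 where C3: "\<And>r. growth E r \<Longrightarrow> lmean r (hom g) \<le>
     (lmean r af + lmean r bf + (lmean r ag + lmean r bg) + (lmean r Wf + lmean r Wg)) + C3 * (1 + ln (V r))"
    using K_estimate[OF E sub(1-6) Knz sub(7)] by blast
  obtain C4 where C4: "0 \<le> C4" "\<And>r. 1 \<le> r \<Longrightarrow> r \<notin> E \<Longrightarrow> V r \<le> ?Tf r + ?Tg r + C4"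
     "\<And>r. 1 \<le> r \<Longrightarrow> r \<notin> E \<Longrightarrow> lmean r d \<le> ?Tf r" "\<And>r. 1 \<le> r \<Longrightarrow> r \<notin> E \<Longrightarrow> lmean r d \<le> ?Tg r"
    using V_le_characteristics[OF sub(1)] by auto
  obtain Hf where Hf: "0 < Hf" "\<And>z. norm (hom f z) \<le> Hf * (norm (d z) + norm (f z)) ^ q" using norm_hom_le by blast
  obtain Hg where Hg: "0 < Hg" "\<And>z. norm (hom g z) \<le> Hg * (norm (d z) + norm (g z)) ^ q" using sw.norm_hom_le by blast
  have lf: "norm (f z - \<tau> * d z) \<le> (1 + norm \<tau>) * (norm (d z) + norm (f z)) ^ 1" for z \<tau> using norm_f_lin_le[of z \<tau>] by simp
  have lg: "norm (g z - \<tau> * d z) \<le> (1 + norm \<tau>) * (norm (d z) + norm (g z)) ^ 1" for z \<tau> using sw.norm_f_lin_le[of z \<tau>] by simp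
  define c where "c = \<bar>ln Hf\<bar> + \<bar>ln Hg\<bar> + \<bar>ln (norm (\<phi> 0))\<bar> + 4 * \<bar>ln (1 + norm a)\<bar> + 4 * \<bar>ln (1 + norm b)\<bar> + C4"
  define C where "C = 2 * (\<bar>C1\<bar> + \<bar>C2\<bar> + \<bar>C3\<bar>) + 2 * c"
  show False
  proof (rule no_slow_growth[OF E])
    fix r assume r: "growth E r"
    have r1: "1 \<le> r" "r \<notin> E" "1 \<le> V r" "0 \<le> r" "0 < r" using r by (auto simp: growth_radius_def)
    have nz: "hom f z \<noteq> 0" "hom g z \<noteq> 0" "af z \<noteq> 0" "bf z \<noteq> 0" "ag z \<noteq> 0" "bg z \<noteq> 0" if "norm z = r" for z
    proof -
      have z: "norm z \<notin> E" using that r1 by simp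
      show "hom f z \<noteq> 0" "hom g z \<noteq> 0" using nzE[OF z] sub by auto
      have "T z \<noteq> 0" using nzE[OF z] sub by auto
      thus "af z \<noteq> 0" "bf z \<noteq> 0" "ag z \<noteq> 0" "bg z \<noteq> 0" by (auto simp: T_def)
    qed
    have p: "0 < 1 + norm a" "0 < 1 + norm b" by (auto intro: add_pos_nonneg)
    have h1: "lmean r (hom f) \<le> ln Hf + real q * ?Tf r" by (rule lmean_le_characteristic[OF forms_hol(7) nz(1) r1(4) Hf(2,1)])
    have h2: "lmean r (hom g) \<le> ln Hg + real q * ?Tg r" by (rule sw.lmean_le_characteristic[OF forms_hol(8) nz(2) r1(4) Hg(2,1)])
    have h3: "lmean r af \<le> ln (1 + norm a) + real 1 * ?Tf r" by (rule lmean_le_characteristic[OF forms_hol(1) nz(3) r1(4) lf p(1)])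
    have h4: "lmean r bf \<le> ln (1 + norm b) + real 1 * ?Tf r" by (rule lmean_le_characteristic[OF forms_hol(2) nz(4) r1(4) lf p(2)])
    have h5: "lmean r ag \<le> ln (1 + norm a) + real 1 * ?Tg r" by (rule sw.lmean_le_characteristic[OF forms_hol(3) nz(5) r1(4) lg p(1)])
    have h6: "lmean r bg \<le> ln (1 + norm b) + real 1 * ?Tg r" by (rule sw.lmean_le_characteristic[OF forms_hol(4) nz(6) r1(4) lg p(2)])
    have h7: "lmean r (hom f) = ln (norm (\<phi> 0)) + lmean r (hom g)"
    proof -
      have "lmean r (hom f) = lmean r (\<lambda>z. \<phi> z * hom g z)" by (simp only: hom_eq)
      also have "\<dots> = lmean r \<phi> + lmean r (hom g)" by (rule lmean_mult[OF phi_hol forms_hol(8) r1(4)]) (use nz phi_nz in auto)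
      also have "lmean r \<phi> = ln (norm (\<phi> 0))"
        by (rule lmean_nonzero) (use phi_hol phi_nz r1 in \<open>auto simp: entire_nz_def\<close>)
      finally show ?thesis .
    qed
    define x where "x = ?Tf r + ?Tg r"
    define Q where "Q = real q"
    define L where "L = 1 + ln (V r)"
    have L: "1 \<le> L" using r1 by (simp add: L_def)
    have Q: "9 \<le> Q" using mn by (simp add: Q_def)
    \<comment> \<open>\<open>i1\<close>: both second main theorems; \<open>i2\<close>: the estimate of \<open>K\<close>; \<open>i3\<close> to \<open>i5\<close>: first main theorem bounds by \<open>x\<close>.\<close>
    have i1: "(Q + 1) * x + (lmean r Wf + lmean r Wg) \<le> lmean r (hom f) + lmean r (hom g) +
        (lmean r af + lmean r bf + lmean r ag + lmean r bg) + 2 * lmean r d + (C1 + C2) * L"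
      using C1[OF r] C2[OF r] unfolding x_def Q_def L_def ring_distribs by linarith
    have i2: "lmean r (hom g) - (lmean r Wf + lmean r Wg) \<le> (lmean r af + lmean r bf + lmean r ag + lmean r bg) + C3 * L"
      using C3[OF r] unfolding L_def by linarith
    have i3: "2 * lmean r (hom f) \<le> Q * x + (ln Hf + ln Hg + ln (norm (\<phi> 0)))"
      using h1 h2 h7 unfolding x_def Q_def ring_distribs by linarith
    have i4: "lmean r af + lmean r bf + lmean r ag + lmean r bg \<le> 2 * x + 2 * ln (1 + norm a) + 2 * ln (1 + norm b)"
      using h3 h4 h5 h6 unfolding x_def by simp
    have i5: "2 * lmean r d \<le> x" using C4(3,4)[OF r1(1,2)] unfolding x_def by linarith
    have "(Q + 1) * x \<le> lmean r (hom f) + 2 * (lmean r af + lmean r bf + lmean r ag + lmean r bg) + 2 * lmean r d + (C1 + C2 + C3) * L"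
      using i1 i2 unfolding ring_distribs by linarith
    hence "2 * ((Q + 1) * x) \<le> Q * x + 10 * x + (ln Hf + ln Hg + ln (norm (\<phi> 0)) + 8 * ln (1 + norm a) + 8 * ln (1 + norm b)) + 2 * ((C1 + C2 + C3) * L)"
      using i3 i4 i5 unfolding ring_distribs by linarith
    hence "(Q - 8) * x \<le> 2 * ((C1 + C2 + C3) * L) + 2 * (c - C4)"
    proof -
      assume *: "2 * ((Q + 1) * x) \<le> Q * x + 10 * x + (ln Hf + ln Hg + ln (norm (\<phi> 0)) + 8 * ln (1 + norm a) + 8 * ln (1 + norm b)) + 2 * ((C1 + C2 + C3) * L)"
      have "(Q - 8) * x = 2 * ((Q + 1) * x) - (Q * x + 10 * x)" by (simp add: algebra_simps)
      moreover have "ln Hf + ln Hg + ln (norm (\<phi> 0)) + 8 * ln (1 + norm a) + 8 * ln (1 + norm b) \<le> 2 * (c - C4)"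
        unfolding c_def by (smt (verit))
      ultimately show ?thesis using * by linarith
    qed
    moreover have "(C1 + C2 + C3) * L \<le> (\<bar>C1\<bar> + \<bar>C2\<bar> + \<bar>C3\<bar>) * L" using L by (intro mult_right_mono) auto
    ultimately have b1: "(Q - 8) * x \<le> 2 * ((\<bar>C1\<bar> + \<bar>C2\<bar> + \<bar>C3\<bar>) * L) + 2 * (c - C4)" by linarith
    have c0: "0 \<le> c - C4" by (simp add: c_def)
    have rhs0: "0 \<le> 2 * ((\<bar>C1\<bar> + \<bar>C2\<bar> + \<bar>C3\<bar>) * L) + 2 * (c - C4)" using c0 L by simp
    have "x \<le> 2 * ((\<bar>C1\<bar> + \<bar>C2\<bar> + \<bar>C3\<bar>) * L) + 2 * (c - C4)"
    proof (cases "x \<le> 0")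
      case False
      hence "1 * x \<le> (Q - 8) * x" using Q by (intro mult_right_mono) auto
      thus ?thesis using b1 by linarith
    qed (use rhs0 in linarith)
    moreover have "V r \<le> x + C4" using C4(2)[OF r1(1,2)] unfolding x_def .
    ultimately have "V r \<le> 2 * ((\<bar>C1\<bar> + \<bar>C2\<bar> + \<bar>C3\<bar>) * L) + 2 * c" using C4(1) unfolding ring_distribs by linarith
    also have "\<dots> \<le> 2 * ((\<bar>C1\<bar> + \<bar>C2\<bar> + \<bar>C3\<bar>) * L) + 2 * c * L"
      using mult_left_mono[OF L, of "2 * c"] c0 C4(1) by simp
    also have "\<dots> = C * L" by (simp add: C_def algebra_simps)
    finally show "V r \<le> C * (1 + ln (V r))" by (simp add: L_def)
  qed
qed

text \<open>
  Since \<open>H\<close> vanishes, \<open>(1 / P(f))'\<close> is a constant multiple \<open>c\<close> of \<open>(1 / P(g))'\<close>, and hence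
  \<open>1 / P(f) - c / P(g)\<close> is a constant \<open>c1\<close>. If \<open>c1\<close> is zero, then \<open>\<phi>\<close> is constant. Otherwise
  \<open>1 / \<phi> - c = c1 * P(g)\<close>; this shows that \<open>g\<close> has no poles and that \<open>P(g)\<close> omits the value \<open>- c / c1\<close>,
  so that \<open>g\<close> is constant by Picard's little theorem.
\<close>
lemma phi_constant:
  assumes mn: "8 \<le> m + n"
  shows "\<exists>A. A \<noteq> 0 \<and> (\<forall>z. \<phi> z = A)"
proof -
  interpret sw: pair_poly d g f p m n a b by (rule swap_fg)
  let ?A = "\<lambda>z. ldiff f z * hom g z ^ 2" and ?B = "\<lambda>z. ldiff g z * hom f z ^ 2"
  have Ah: "?A holomorphic_on UNIV" by (intro holomorphic_on_mult holomorphic_on_power forms_hol)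
  have B: "entire_nz ?B" unfolding ldiff_def by (intro entire_nz_mult entire_nz_power forms_nz Wg)
  have SS: "entire_nz (\<lambda>z. T z * (hom f z * hom g z))" by (intro entire_nz_mult forms_nz)
  have "wronskian ?A ?B = (\<lambda>_. 0)"
  proof (rule entire_eq_offI[OF SS])
    fix z assume "T z * (hom f z * hom g z) \<noteq> 0"
    hence nz: "T z \<noteq> 0" "hom f z \<noteq> 0" "hom g z \<noteq> 0" by auto
    hence ABz: "?A z \<noteq> 0" "?B z \<noteq> 0" by (auto simp: T_def ldiff_def)
    have "ld ?A z - ld ?B z = 0" unfolding logderiv_eq(1)[OF nz] using K_vanishes[OF mn] by simp
    thus "wronskian ?A ?B z = 0" unfolding wronskian_eq_ld[of ?A z ?B, OF ABz] by simp
  qed (use wronskian_hol[OF Ah entire_nzD[OF B]] in auto)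
  hence W0: "deriv ?A z * ?B z = ?A z * deriv ?B z" for z
    using fun_cong[of "wronskian ?A ?B" "\<lambda>_. 0" z] unfolding wronskian_def by (simp only: right_minus_eq)
  obtain c where c: "\<And>z. ?A z = c * ?B z" using entire_wronskian_0[OF Ah B W0] by blast
  \<comment> \<open>As \<open>P(f) = \<phi> P(g)\<close>, the function \<open>X\<close> divided by \<open>hom g\<close> is \<open>1 / P(f) - c / P(g)\<close>.\<close>
  define X where "X = (\<lambda>z. (1 / \<phi> z - c) * d z ^ q)"
  have Xh: "X holomorphic_on UNIV" unfolding X_def by (intro holomorphic_intros phi_hol d_hol phi_nz)
  have key: "deriv \<phi> z * hom g z * d z = (c * \<phi> z ^ 2 - \<phi> z) * ldiff g z" for z
  proof -
    have "(\<lambda>z. ldiff f z) = (\<lambda>z. c * \<phi> z ^ 2 * ldiff g z)"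
    proof (rule entire_eq_offI[OF forms_nz(6)])
      fix w assume "hom g w \<noteq> 0"
      hence "hom g w ^ 2 \<noteq> 0" by simp
      moreover have "ldiff f w * hom g w ^ 2 = (c * \<phi> w ^ 2 * ldiff g w) * hom g w ^ 2"
        using c[of w] by (simp add: hom_eq power_mult_distrib mult_ac)
      ultimately show "ldiff f w = c * \<phi> w ^ 2 * ldiff g w" using mult_right_cancel by blast
    qed (intro holomorphic_on_mult holomorphic_on_power holomorphic_on_const forms_hol phi_hol)+
    from fun_cong[OF this, of z] show ?thesis using ldiff_f_eq[of z] by (simp add: algebra_simps)
  qed
  have W2: "deriv X z * hom g z = X z * deriv (hom g) z" for z
  proof -
    have "wronskian X (hom g) = (\<lambda>_. 0)"
    proof (rule entire_eq_offI[OF d])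
      fix z assume dz: "d z \<noteq> 0"
      have "((\<lambda>z. 1 / \<phi> z - c) has_field_derivative - deriv \<phi> z / \<phi> z ^ 2) (at z)"
        using DERIV_diff[OF DERIV_divide[OF DERIV_const entire_has_deriv[OF phi_hol] phi_nz, of 1] DERIV_const, of c z]
        by (simp add: power2_eq_square)
      from DERIV_mult[OF this DERIV_power[OF entire_has_deriv[OF d_hol], of q]]
      have "(X has_field_derivative (- deriv \<phi> z / \<phi> z ^ 2) * d z ^ q + of_nat q * (deriv d z * d z ^ (q - Suc 0)) * (1 / \<phi> z - c)) (at z)"
        by (simp only: X_def)
      hence DX: "deriv X z = (- deriv \<phi> z / \<phi> z ^ 2) * d z ^ q + of_nat q * (deriv d z * d z ^ (q - Suc 0)) * (1 / \<phi> z - c)"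
        by (rule DERIV_imp_deriv)
      have dq: "d z ^ q = d z ^ (m + n) * d z" "d z ^ (q - Suc 0) = d z ^ (m + n)" by simp_all
      have hg: "deriv (hom g) z * d z = ldiff g z + of_nat q * hom g z * deriv d z" using ldiff_eq[OF g, of z] by simp
      define D where "D = d z ^ (m + n)"
      have "\<phi> z ^ 2 * (deriv X z * hom g z) = (- (deriv \<phi> z * hom g z * d z) + of_nat q * deriv d z * hom g z * (\<phi> z - c * \<phi> z ^ 2)) * D"
        unfolding DX dq D_def[symmetric] using phi_nz[of z]
        by (simp add: field_simps power2_eq_square del: of_nat_add of_nat_Suc)
      also have "\<dots> = (\<phi> z - c * \<phi> z ^ 2) * (ldiff g z + of_nat q * hom g z * deriv d z) * D"
        unfolding key by (simp add: algebra_simps del: of_nat_add of_nat_Suc)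
      also have "\<dots> = \<phi> z ^ 2 * (X z * deriv (hom g) z)"
        unfolding hg[symmetric] X_def dq D_def[symmetric] using phi_nz[of z]
        by (simp add: field_simps power2_eq_square)
      finally have "deriv X z * hom g z = X z * deriv (hom g) z" using phi_nz[of z] by simp
      thus "wronskian X (hom g) z = 0" by (simp add: wronskian_def)
    qed (use wronskian_hol[OF Xh forms_hol(8)] in auto)
    thus ?thesis using fun_cong[of "wronskian X (hom g)" "\<lambda>_. 0" z] unfolding wronskian_def by (simp only: right_minus_eq)
  qed
  obtain c1 where c1: "\<And>z. X z = c1 * hom g z" using entire_wronskian_0[OF Xh forms_nz(6) W2] by blast
  show ?thesis
  proof (cases "c1 = 0")
    case True
    have "(\<lambda>z. 1 / \<phi> z) = (\<lambda>_. c)"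
    proof (rule entire_eq_offI[OF d])
      fix w assume "d w \<noteq> 0"
      thus "1 / \<phi> w = c" using c1[of w] True by (simp add: X_def)
    qed (intro holomorphic_intros phi_hol phi_nz)+
    from fun_cong[OF this] have ic: "1 / \<phi> z = c" for z .
    hence e: "\<phi> z = 1 / c" for z using ic[of z, symmetric] by simp
    moreover have "1 / c \<noteq> 0" using e[of 0] phi_nz[of 0] by simp
    ultimately show ?thesis by blast
  next
    case False
    have dnz: "d z \<noteq> 0" for z
    proof
      assume dz: "d z = 0"
      hence "X z = 0" by (simp add: X_def)
      hence "hom g z = 0" using c1[of z] False by simp
      thus False using sw.hom_f_zero(1) dz by blast
    qed
    have gh: "(\<lambda>z. g z / d z) holomorphic_on UNIV" by (intro holomorphic_intros g d_hol dnz)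
    have omit: "P (g z / d z) \<noteq> - c / c1" for z
    proof
      assume e: "P (g z / d z) = - c / c1"
      have "(1 / \<phi> z - c) * d z ^ q = c1 * (d z ^ q * P (g z / d z))"
        using c1[of z] unfolding X_def hom_affine[OF dnz] .
      hence "1 / \<phi> z - c = c1 * P (g z / d z)" using dnz[of z] by simp
      hence "1 / \<phi> z = 0" using e False by simp
      thus False using phi_nz[of z] by simp
    qed
    obtain x y where xy: "x \<noteq> y" "P x = - c / c1" "P y = - c / c1" using two_distinct_preimages by blast
    have "range (\<lambda>z. g z / d z) \<inter> {x, y} = {}" using omit xy by auto
    then obtain k where k: "(\<lambda>z. g z / d z) = (\<lambda>_. k)" using little_Picard[OF gh xy(1)] by blast
    have "g z = k * d z" for z using fun_cong[OF k, of z] dnz[of z] by (simp add: field_simps)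
    hence "\<not> entire_nz (\<lambda>z. g z - k * d z)" by (simp add: entire_nz_def)
    thus ?thesis using sw.f_lin_nz[of k] by blast
  qed
qed

text \<open>
  The case distinctions bring the functional equation into the form of the two exclusion lemmas,
  which assume that \<open>a\<close> has exponent at least \<open>3\<close> and that \<open>P b \<noteq> A * P a\<close>; the roles of \<open>a, b\<close> and
  of \<open>f, g\<close> can be exchanged. Both possibilities \<open>P b = A * P a\<close> and \<open>P a = A * P b\<close> cannot hold at
  once, since \<open>P a + P b\<close> is nonzero.
\<close>
theorem f_eq_g:
  assumes mn: "8 \<le> m + n" and PP: "P a + P b \<noteq> 0"
  shows "f z = g z"
proof (rule ccontr)
  assume "f z \<noteq> g z"
  hence fg: "entire_nz (\<lambda>z. f z - g z)" "entire_nz (\<lambda>z. g z - f z)"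
    unfolding entire_nz_def using holomorphic_on_diff[OF f g] holomorphic_on_diff[OF g f] by (auto intro!: exI[of _ z])
  obtain A where A: "A \<noteq> 0" "\<And>z. \<phi> z = A" using phi_constant[OF mn] by blast
  have rel: "P (f z / d z) = A * P (g z / d z)" if "d z \<noteq> 0" for z
    using hom_eq[of z] that unfolding A(2) hom_affine[OF that] by simp
  have rel': "P (g z / d z) = (1 / A) * P (f z / d z)" if "d z \<noteq> 0" for z
    using rel[OF that] A(1) by simp
  interpret s1: pair_poly d g f p m n a b by (rule swap_fg)
  interpret s2: pair_poly d f g p n m b a by (rule swap_ab)
  interpret s3: pair_poly d g f p n m b a by (rule s2.swap_fg)
  show False
  proof (cases "A = 1")
    case True
    hence rel1: "P (f z / d z) = P (g z / d z)" if "d z \<noteq> 0" for z using rel[OF that] by simp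
    show False
    proof (cases "3 \<le> n")
      case True thus False using no_solution_equal_values[OF rel1 fg(1)] by blast
    next
      case False
      hence "3 \<le> m" using mn by simp
      thus False using s2.no_solution_equal_values[OF rel1 fg(1)] by blast
    qed
  next
    case A1: False
    have two: "P b \<noteq> A * P a \<or> P a \<noteq> A * P b"
    proof (rule ccontr)
      assume "\<not> ?thesis"
      hence e: "P b = A * P a" "P a = A * P b" by auto
      hence "P a + P b = A * (P a + P b)" by (simp add: algebra_simps)
      thus False using PP A1 by simp
    qed
    have inv: "1 / A \<noteq> 1" using A1 A(1) by simp
    show False
    proof (cases "3 \<le> n")
      case True
      show False using two
      proof
        assume "P b \<noteq> A * P a"
        thus False using no_solution_scaled[OF rel A1 _ True] by blast
      next
        assume "P a \<noteq> A * P b"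
        hence "P b \<noteq> 1 / A * P a" using A(1) by (simp add: field_simps)
        thus False using s1.no_solution_scaled[OF rel' inv _ True] by blast
      qed
    next
      case False
      hence m3: "3 \<le> m" using mn by simp
      show False using two
      proof
        assume "P a \<noteq> A * P b"
        thus False using s2.no_solution_scaled[OF rel A1 _ m3] by blast
      next
        assume "P b \<noteq> A * P a"
        hence "P a \<noteq> 1 / A * P b" using A(1) by (simp add: field_simps)
        thus False using s3.no_solution_scaled[OF rel' inv _ m3] by blast
      qed
    qed
  qed
qed

end

section \<open>The polynomial as a primitive\<close>

definition crit_primitive :: "nat \<Rightarrow> nat \<Rightarrow> complex \<Rightarrow> complex \<Rightarrow> complex \<Rightarrow> complex poly" where
  "crit_primitive m n a b c =
     (\<Sum>i=0..m. \<Sum>j=0..n. monom (of_nat (m choose i) * of_nat (n choose j) *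
        ((-1) ^ (i + j) / of_nat (n + m + 1 - i - j)) * a ^ j * b ^ i) (n + m + 1 - i - j)) + [:c:]"

lemma poly_crit_primitive: "poly (crit_primitive m n a b c) z = P_fun m n a b c z"
  by (simp add: crit_primitive_def P_fun_def Q_fun_def poly_sum poly_monom mult_ac)

text \<open>
  Term-by-term differentiation undoes the denominators in the double sum, which then factors into two
  binomial expansions.
\<close>
lemma pderiv_crit_primitive: "pderiv (crit_primitive m n a b c) = [:-a, 1:] ^ n * [:-b, 1:] ^ m"
proof -
  have binom: "(z - x) ^ k = (\<Sum>i=0..k. of_nat (k choose i) * (-1) ^ i * x ^ i * z ^ (k - i))" for z x :: complex and k
  proof -
    have "(z - x) ^ k = (- x + z) ^ k" by simp
    also have "\<dots> = (\<Sum>i\<le>k. of_nat (k choose i) * (- x) ^ i * z ^ (k - i))" by (rule binomial_ring)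
    also have "\<dots> = (\<Sum>i=0..k. of_nat (k choose i) * (-1) ^ i * x ^ i * z ^ (k - i))"
      unfolding atMost_atLeast0 by (intro sum.cong refl) (subst power_minus, simp)
    finally show ?thesis .
  qed
  have "poly (pderiv (crit_primitive m n a b c)) z = poly ([:-a, 1:] ^ n * [:-b, 1:] ^ m) z" for z
  proof -
    have summand: "of_nat (n + m + 1 - i - j) * (of_nat (m choose i) * of_nat (n choose j) *
        ((-1) ^ (i + j) / of_nat (n + m + 1 - i - j)) * a ^ j * b ^ i) * z ^ (n + m + 1 - i - j - 1) =
        (of_nat (m choose i) * (-1) ^ i * b ^ i * z ^ (m - i)) * (of_nat (n choose j) * (-1) ^ j * a ^ j * z ^ (n - j))"
      if "i \<in> {0..m}" "j \<in> {0..n}" for i j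
    proof -
      have k: "n + m + 1 - i - j - 1 = (m - i) + (n - j)" using that by auto
      have nz: "(of_nat (n + m + 1 - i - j) :: complex) \<noteq> 0" unfolding of_nat_eq_0_iff using that by auto
      have cancel: "N * (x * y * (e / N) * u * v) * w = x * y * e * u * v * w" if "N \<noteq> 0" for N x y e u v w :: complex
        using that by simp
      show ?thesis unfolding cancel[OF nz] k power_add by (simp add: mult_ac)
    qed
    have pderiv_sum: "pderiv (sum h A) = (\<Sum>i\<in>A. pderiv (h i))" for h :: "nat \<Rightarrow> complex poly" and A
      by (induction A rule: infinite_finite_induct) (simp_all add: pderiv_add)
    have "poly (pderiv (crit_primitive m n a b c)) z =
      (\<Sum>i=0..m. \<Sum>j=0..n. of_nat (n + m + 1 - i - j) * (of_nat (m choose i) * of_nat (n choose j) *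
        ((-1) ^ (i + j) / of_nat (n + m + 1 - i - j)) * a ^ j * b ^ i) * z ^ (n + m + 1 - i - j - 1))"
      unfolding crit_primitive_def pderiv_add pderiv_sum pderiv_monom
      by (simp only: poly_add poly_sum poly_monom pderiv_pCons pderiv_0) simp
    also have "\<dots> = (\<Sum>i=0..m. \<Sum>j=0..n. (of_nat (m choose i) * (-1) ^ i * b ^ i * z ^ (m - i)) *
        (of_nat (n choose j) * (-1) ^ j * a ^ j * z ^ (n - j)))"
      by (intro sum.cong refl) (rule summand)
    also have "\<dots> = (z - b) ^ m * (z - a) ^ n" unfolding binom[of z b] binom[of z a] sum_product ..
    also have "\<dots> = poly ([:-a, 1:] ^ n * [:-b, 1:] ^ m) z" by simp
    finally show ?thesis .
  qed
  thus ?thesis by (subst poly_eq_poly_eq_iff[symmetric]) (rule ext)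
qed

section \<open>From meromorphic functions to pairs of entire functions\<close>

definition zero_divisor :: "(complex \<Rightarrow> complex) \<Rightarrow> (complex \<times> nat) set" where
  "zero_divisor F = {(z, k). F z = 0 \<and> int k = zorder F z}"

lemma entire_nz_zorder_ge_0:
  assumes "entire_nz F"
  shows "0 \<le> zorder F z"
proof (rule zorder_ge_0)
  show "F analytic_on {z}" using entire_nzD[OF assms] by (auto simp: analytic_at)
  show "\<exists>\<^sub>F w in at z. F w \<noteq> 0" using entire_nz_eventually[OF assms] by (simp add: eventually_frequently)
qed

text \<open>
  Zeros of functions that do not vanish identically have finite order, so the divisor determines
  both the zeros and their orders.
\<close>
lemma entire_divide_same_divisor:
  assumes F: "entire_nz F" and G: "entire_nz G" and eq: "zero_divisor F = zero_divisor G"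
  obtains \<phi> where "\<phi> holomorphic_on UNIV" "\<And>w. \<phi> w \<noteq> 0" "\<And>w. F w = \<phi> w * G w"
proof -
  have sub: "G z = 0 \<and> zorder G z = zorder F z"
    if "F z = 0" "entire_nz F" "zero_divisor F = zero_divisor G" for F G :: "complex \<Rightarrow> complex" and z
  proof -
    have "(z, nat (zorder F z)) \<in> zero_divisor G"
      unfolding that(3)[symmetric] using that(1) entire_nz_zorder_ge_0[OF that(2), of z] by (simp add: zero_divisor_def)
    thus ?thesis using entire_nz_zorder_ge_0[OF that(2), of z] by (simp add: zero_divisor_def)
  qed
  have 1: "F z = 0 \<longleftrightarrow> G z = 0" for z using sub[OF _ F eq, of z] sub[OF _ G eq[symmetric], of z] by blast
  have 2: "zorder F z = zorder G z" if "F z = 0" for z using sub[OF that F eq] by simp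
  from entire_divide_same_zeros[OF F G 1 2] that show ?thesis by blast
qed

text \<open>
  The Weierstrass factorization of a meromorphic function. The denominator vanishes exactly at the poles
  and the numerator does not, so \<open>F / D\<close> evaluates to the conventional value \<open>0\<close> at the poles.
\<close>
lemma meromorphic_quotient:
  assumes u: "u nicely_meromorphic_on UNIV"
  shows "\<exists>F D. F holomorphic_on UNIV \<and> entire_nz D \<and> (\<forall>z. D z = 0 \<longleftrightarrow> is_pole u z) \<and>
    value_points u Infty = zero_divisor D \<and> (\<forall>z. D z \<noteq> 0 \<or> F z \<noteq> 0) \<and> (\<forall>z. u z = F z / D z)"
proof -
  obtain h f1 D where h: "h holomorphic_on UNIV" "f1 holomorphic_on UNIV" "D holomorphic_on UNIV"
    and z1: "\<forall>z. f1 z = 0 \<longleftrightarrow> \<not> is_pole u z \<and> u z = 0" and z2: "\<forall>z. D z = 0 \<longleftrightarrow> is_pole u z"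
    and o2: "\<forall>z. is_pole u z \<longrightarrow> zorder D z = - zorder u z"
    and hnz: "\<forall>z. h z \<noteq> 0" and eq: "\<forall>z. u z = h z * f1 z / D z"
    by (rule weierstrass_factorization_meromorphic_UNIV[OF u])
  have "\<exists>z. D z \<noteq> 0"
  proof (rule ccontr)
    assume "\<nexists>z. D z \<noteq> 0"
    hence D0: "D z = 0" for z by blast
    hence "u = (\<lambda>_. 0)" using eq by (intro ext) simp
    moreover have "is_pole u 0" using z2 D0[of 0] by blast
    ultimately show False using not_is_pole_holomorphic[of UNIV 0 "\<lambda>_. 0 :: complex"] by simp
  qed
  hence D: "entire_nz D" using h(3) by (simp add: entire_nz_def)
  have v: "value_points u Infty = zero_divisor D"
    using z2 o2 unfolding zero_divisor_def value_points.simps by auto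
  have cop: "D z \<noteq> 0 \<or> h z * f1 z \<noteq> 0" for z using z1 z2 hnz by auto
  have hol: "(\<lambda>z. h z * f1 z) holomorphic_on UNIV" by (intro holomorphic_on_mult h)
  show ?thesis
    by (rule exI[of _ "\<lambda>z. h z * f1 z"], rule exI[of _ D]) (use hol D z2 v cop eq in blast)
qed

lemma wronskian_nonconstant:
  assumes F: "F holomorphic_on UNIV" and D: "entire_nz D" and cop: "\<And>z. D z \<noteq> 0 \<or> F z \<noteq> 0"
    and u: "\<And>z. u z = F z / D z" and nc: "\<not> u constant_on UNIV"
  shows "entire_nz (wronskian F D)"
proof (rule ccontr)
  assume "\<not> entire_nz (wronskian F D)"
  hence W: "wronskian F D z = 0" for z
    unfolding entire_nz_def using wronskian_hol[OF F entire_nzD[OF D]] by blast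
  have W0: "deriv F z * D z = F z * deriv D z" for z
    using W[of z] unfolding wronskian_def by (simp only: right_minus_eq)
  obtain c where c: "\<And>z. F z = c * D z" using entire_wronskian_0[OF F D W0] by blast
  have "u z = c" for z using cop[of z] c[of z] u[of z] by auto
  thus False using nc by (auto simp: constant_on_def)
qed

context pair_poly
begin

text \<open>
  Near a zero, \<open>hom f\<close> is the product of \<open>f / d - \<tau>\<close> for one root \<open>\<tau>\<close> and a function that does not
  vanish, as the roots of \<open>P\<close> are simple.
\<close>
lemma zorder_hom:
  assumes "hom f z = 0"
  shows "zorder (hom f) z = zorder (\<lambda>w. f w / d w - f z / d z) z"
proof -
  define \<tau> where "\<tau> = f z / d z"
  have dz: "d z \<noteq> 0" using hom_f_zero(1)[OF assms] .
  have \<tau>: "\<tau> \<in> roots" using assms hom_affine[OF dz, of f] dz by (simp add: roots_def \<tau>_def)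
  define R where "R = (\<lambda>w. lead_coeff p * d w * (\<Prod>\<sigma>\<in>roots - {\<tau>}. f w - \<sigma> * d w))"
  have Rh: "R holomorphic_on UNIV" unfolding R_def by (intro holomorphic_intros f d_hol)
  have Ran: "R analytic_on {z}" using Rh by (auto simp: analytic_at)
  have "f z - \<sigma> * d z \<noteq> 0" if "\<sigma> \<noteq> \<tau>" for \<sigma> using that dz by (auto simp: \<tau>_def field_simps)
  hence Rz: "R z \<noteq> 0" unfolding R_def using dz p_nz finite_roots by auto
  have split: "hom f w = (f w / d w - \<tau>) * R w" if "d w \<noteq> 0" for w
  proof -
    have "hom f w = lead_coeff p * ((f w - \<tau> * d w) * (\<Prod>\<sigma>\<in>roots - {\<tau>}. f w - \<sigma> * d w))"
      unfolding hom_def by (subst prod.remove[OF finite_roots \<tau>]) simp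
    also have "f w - \<tau> * d w = (f w / d w - \<tau>) * d w" using that by (simp add: field_simps)
    finally show ?thesis by (simp only: R_def mult_ac)
  qed
  have ev: "eventually (\<lambda>w. hom f w = (f w / d w - \<tau>) * R w) (at z)"
    using entire_nz_eventually[OF d] by eventually_elim (rule split)
  have "(\<lambda>w. f w / d w - \<tau>) analytic_on {z}"
    using f d_hol dz by (intro analytic_intros) (auto simp: analytic_at)
  moreover have "\<exists>\<^sub>F w in at z. (f w / d w - \<tau>) * R w \<noteq> 0"
  proof -
    have "eventually (\<lambda>w. (f w / d w - \<tau>) * R w \<noteq> 0) (at z)"
      using ev entire_nz_eventually[OF hom_f_nz, of z] by eventually_elim simp
    thus ?thesis by (simp add: eventually_frequently)
  qed
  ultimately have "zorder (\<lambda>w. (f w / d w - \<tau>) * R w) z = zorder (\<lambda>w. f w / d w - \<tau>) z + zorder R z"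
    by (intro zorder_times_analytic' isolated_singularity_at_analytic not_essential_analytic Ran)
  moreover have "zorder R z = 0" by (rule zorder_eq_0I[OF Ran Rz])
  moreover have "zorder (hom f) z = zorder (\<lambda>w. (f w / d w - \<tau>) * R w) z"
    by (rule zorder_cong[OF ev refl])
  ultimately show ?thesis by (simp add: \<tau>_def)
qed

text \<open>
  The shared points of the set of roots, with their multiplicities, are the zeros of the entire function \<open>hom f\<close>.
\<close>
lemma E_pts_roots:
  assumes u: "\<And>z. u z = f z / d z" and pole: "\<And>z. d z = 0 \<longleftrightarrow> is_pole u z"
  shows "E_pts u (Fin ` roots) = zero_divisor (hom f)"
proof -
  have ueq: "u = (\<lambda>z. f z / d z)" by (rule ext) (rule u)
  have zero: "hom f z = 0 \<longleftrightarrow> \<not> is_pole u z \<and> u z \<in> roots" for z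
    using hom_f_zero(1)[of z] hom_affine[of z f] u[of z] pole[of z] by (auto simp: roots_def)
  have ord: "zorder (hom f) z = zorder (\<lambda>w. u w - u z) z" if "hom f z = 0" for z
    using zorder_hom[OF that] by (simp only: ueq)
  have "(z, k) \<in> E_pts u (Fin ` roots) \<longleftrightarrow> (z, k) \<in> zero_divisor (hom f)" for z k
  proof -
    have "(z, k) \<in> E_pts u (Fin ` roots) \<longleftrightarrow> \<not> is_pole u z \<and> u z \<in> roots \<and> int k = zorder (\<lambda>w. u w - u z) z"
      by (auto simp: E_pts_def)
    also have "\<dots> \<longleftrightarrow> (z, k) \<in> zero_divisor (hom f)" using zero[of z] ord[of z] by (auto simp: zero_divisor_def)
    finally show ?thesis .
  qed
  thus ?thesis by auto
qed

end

theorem theorem3p6: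
  fixes m n :: nat and a b c :: complex and f g :: "complex \<Rightarrow> complex"
  assumes "m + n \<ge> 8" and "min m n \<ge> 2" and "max m n \<ge> 3"
    and "b \<noteq> 0" and "a \<noteq> b"
    and "c \<notin> {0, - Q_fun m n a b a, - Q_fun m n a b b,
                - ((Q_fun m n a b a + Q_fun m n a b b) / 2)}"
    and "f nicely_meromorphic_on UNIV" and "\<not> f constant_on UNIV"
    and "g nicely_meromorphic_on UNIV" and "\<not> g constant_on UNIV"
    and "share_CM f g {Infty}"
    and "share_CM f g (Fin ` S2 m n a b c)"
  shows "f = g"
proof -
  define p where "p = crit_primitive m n a b c"
  have P: "poly p z = Q_fun m n a b z + c" for z
    by (simp add: p_def poly_crit_primitive P_fun_def)
  have nz: "poly p a \<noteq> 0" "poly p b \<noteq> 0" "poly p a + poly p b \<noteq> 0"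
  proof -
    have c: "c \<noteq> - Q_fun m n a b a" "c \<noteq> - Q_fun m n a b b" "c \<noteq> - ((Q_fun m n a b a + Q_fun m n a b b) / 2)"
      using assms(6) by simp_all
    show "poly p a \<noteq> 0" "poly p b \<noteq> 0" using c(1,2) by (auto simp: P add_eq_0_iff)
    show "poly p a + poly p b \<noteq> 0"
    proof
      assume "poly p a + poly p b = 0"
      hence "c = - ((Q_fun m n a b a + Q_fun m n a b b) / 2)"
        unfolding P by (simp add: eq_neg_iff_add_eq_0 field_simps)
      thus False using c(3) by contradiction
    qed
  qed
  interpret crit_poly p m n a b
    by unfold_locales (use assms nz pderiv_crit_primitive in \<open>simp_all add: p_def\<close>)
  have roots: "roots = S2 m n a b c" by (simp add: roots_def S2_def P P_fun_def)
  obtain F D where F: "F holomorphic_on UNIV" and D: "entire_nz D" and Dp: "\<And>z. D z = 0 \<longleftrightarrow> is_pole f z"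
    and Dv: "value_points f Infty = zero_divisor D" and Dc: "\<And>z. D z \<noteq> 0 \<or> F z \<noteq> 0" and fe: "\<And>z. f z = F z / D z"
    using meromorphic_quotient[OF assms(7)] by metis
  obtain G0 D0 where G0: "G0 holomorphic_on UNIV" and D0: "entire_nz D0" and D0p: "\<And>z. D0 z = 0 \<longleftrightarrow> is_pole g z"
    and D0v: "value_points g Infty = zero_divisor D0" and D0c: "\<And>z. D0 z \<noteq> 0 \<or> G0 z \<noteq> 0" and ge0: "\<And>z. g z = G0 z / D0 z"
    using meromorphic_quotient[OF assms(9)] by metis
  have "zero_divisor D0 = zero_divisor D"
    using assms(11) Dv D0v by (simp add: share_CM_def E_pts_def)
  then obtain \<xi> where \<xi>: "\<xi> holomorphic_on UNIV" "\<And>w. \<xi> w \<noteq> 0" "\<And>w. D0 w = \<xi> w * D w"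
    using entire_divide_same_divisor[OF D0 D] by metis
  define G where "G = (\<lambda>z. G0 z / \<xi> z)"
  have G: "G holomorphic_on UNIV" unfolding G_def by (intro holomorphic_on_divide G0 \<xi>)
  have ge: "g z = G z / D z" for z unfolding ge0 G_def \<xi>(3) by simp
  have Dpg: "D z = 0 \<longleftrightarrow> is_pole g z" for z using D0p[of z] \<xi>(2,3)[of z] by simp
  have Dcg: "D z \<noteq> 0 \<or> G z \<noteq> 0" for z using D0c[of z] \<xi>(2,3)[of z] by (auto simp: G_def)
  interpret pair_poly D F G p m n a b
    by (intro pair_poly.intro entire_pair.intro crit_poly_axioms D F G Dc Dcg
      wronskian_nonconstant[OF F D Dc fe assms(8)] wronskian_nonconstant[OF G D Dcg ge assms(10)])
  interpret sw: pair_poly D G F p m n a b by (rule swap_fg)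
  have "zero_divisor (hom F) = zero_divisor (hom G)"
    using E_pts_roots[of f, OF fe Dp] sw.E_pts_roots[of g, OF ge Dpg] assms(12)
    unfolding share_CM_def roots by simp
  then obtain \<phi> where \<phi>: "\<phi> holomorphic_on UNIV" "\<And>w. \<phi> w \<noteq> 0" "\<And>w. hom F w = \<phi> w * hom G w"
    using entire_divide_same_divisor[OF hom_f_nz sw.hom_f_nz] by metis
  interpret shared_pair D F G p m n a b \<phi>
    by (intro shared_pair.intro shared_pair_axioms.intro pair_poly_axioms \<phi>)
  show "f = g"
  proof (rule ext)
    fix z
    show "f z = g z" using f_eq_g[OF assms(1) nz(3), of z] by (simp only: fe ge)
  qed
qed

end
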